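(* Let $\Bbbk$ be a field, $G$ a group, and $X\subset G$ a finite subset that is a union of conjugacy classes of $G$ and generates $G$. Let $V=\bigoplus_{x\in X}V_x$ be a (link-indecomposable) Yetter-Drinfeld module over $\Bbbk G$ with support exactly $X$ and with each $V_x=\Bbbk v_x$ one-dimensional. Let $B(V)\#\Bbbk G$ be the bosonization of the Nichols algebra $B(V)$, let $\tilde G$ be the universal coalgebra covering group of $B(V)$, and write $G=\tilde G/N$ with $N\vartriangleleft\tilde G$ the kernel of the surjection $\tilde G\to G$, $[v_x]\mapsto x$. Then every covering Hopf algebra of $B(V)\#\Bbbk G$ is of the form $B(V)\#\Bbbk(\tilde G/M)$ for some normal subgroup $M\vartriangleleft\tilde G$ with $[N,\tilde G]\subseteq M\subseteq N$; here $\tilde G/M$ acts on $V$ through $\tilde G/M\to\tilde G/N=G$, the vector $v_x$ has degree $[v_x]M$, and the covering map is $b\#gM\mapsto b\#gN$.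
   Context: $[N,\tilde G]$ denotes the subgroup generated by all $ngn^{-1}g^{-1}$, $n\in N$, $g\in\tilde G$. **Braiding and embedding.** The braiding of $V$ is $c(v_x\otimes v_y)=(x.v_y)\otimes v_x$. Let $Q_V$ be the quiver with one vertex and loops $v_x$ ($x\in X$). Its path coalgebra $\Bbbk Q_V$ (basis the paths, comultiplication deconcatenation) is identified with the cotensor coalgebra $C(V)=\bigoplus_{n\ge0}V^{\otimes n}$, with $v_{x_1}\otimes\cdots\otimes v_{x_n}$ corresponding to the path $v_{x_1}\cdots v_{x_n}$. Then $B(V)=\bigoplus_n\operatorname{Im}\mathfrak S_n\subseteq\Bbbk Q_V$, where $\mathfrak S_n=\sum_{\sigma\in\mathbb S_n}\hat\sigma$ is the quantum symmetrizer ($\hat{\ }$ the Matsumoto section $\mathbb S_n\to\mathbb B_n$, the braid group acting via $c$). **Universal coalgebra covering group.** An element $b=\sum_{i\in I}\lambda_ip_i\in B(V)$ (distinct paths $p_i$, nonzero $\lambda_i\in\Bbbk$, $|I|\ge2$) is *minimal* if $\sum_{i\in I'}\lambda_ip_i\notin B(V)$ for every nonempty proper subset $I'\subset I$. Write $p\sim p'$ if $p,p'$ are two of the paths occurring in some minimal element. The fundamental group $\pi_1(Q_V)$ is the free group on the classes $[v_x]$, $x\in X$; with $[v_{x_1}\cdots v_{x_n}]=[v_{x_1}]\cdots[v_{x_n}]$, the universal coalgebra covering group $\tilde G$ is the quotient of $\pi_1(Q_V)$ by the normal subgroup generated by all $[p]^{-1}[p']$ with $p\sim p'$. Since $B(V)$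 is $G$-graded, $[v_x]\mapsto x$ defines a surjective homomorphism $\tilde G\to G$. **Hopf coverings.** Let $R\#\Bbbk H$ and $R\#\Bbbk G$ be coradically graded pointed Hopf algebras that are bosonizations of the same braided graded Hopf algebra $R$, and let $f:H\to G$ be a surjective group homomorphism. A Hopf algebra map $F:R\#\Bbbk H\to R\#\Bbbk G$ is a *Hopf covering* if $F(r\#h)=r\#f(h)$ for all $r\in R$, $h\in H$; then $R\#\Bbbk H$ is called a covering Hopf algebra of $R\#\Bbbk G$, with covering group $H$. Covering Hopf algebras are taken to be link-indecomposable (indecomposable as coalgebras; for $R=B(V)$ this means that $H$ is generated by the degrees of the homogeneous elements of $V$). "Of the form $B(V)\#\Bbbk(\tilde G/M)$" is understood up to an identification (isomorphism) of the covering group $H$ with $\tilde G/M$. *)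

theory Defs
  imports
    Complex_Main
    "HOL-Algebra.Coset"
    "HOL-Algebra.Generated_Groups"
    "HOL-Library.Poly_Mapping"
    "HOL-Combinatorics.Permutations"
begin

section \<open>Linear algebra in spaces with a basis\<close>

text \<open>
  The space with basis \<open>'b\<close> is \<open>'b \<Rightarrow>\<^sub>0 'k\<close>, where \<open>single b 1\<close> is the basis vector of \<open>b\<close>; all
  vector spaces below are subspaces of such spaces.  For subspaces \<open>U\<close> of \<open>'b \<Rightarrow>\<^sub>0 'k\<close> and \<open>W\<close> of
  \<open>'c \<Rightarrow>\<^sub>0 'k\<close>, the tensor product of \<open>U\<close> and \<open>W\<close> is realised as the span of the pure tensors inside
  \<open>('b \<times> 'c) \<Rightarrow>\<^sub>0 'k\<close>, which is a faithful model because \<open>'k\<close> is a field.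
\<close>

definition scl :: "'k::field \<Rightarrow> ('b \<Rightarrow>\<^sub>0 'k) \<Rightarrow> ('b \<Rightarrow>\<^sub>0 'k)"
  where "scl c u = Poly_Mapping.map ((*) c) u"

lemma lookup_scl: "Poly_Mapping.lookup (scl c u) b = c * Poly_Mapping.lookup u b"
  by (simp add: scl_def Poly_Mapping.map.rep_eq when_def)

global_interpretation lin: vector_space "scl :: 'k::field \<Rightarrow> ('b \<Rightarrow>\<^sub>0 'k) \<Rightarrow> ('b \<Rightarrow>\<^sub>0 'k)"
  by unfold_locales (auto intro!: poly_mapping_eqI simp: lookup_scl lookup_add algebra_simps)

abbreviation bvec :: "'b \<Rightarrow> ('b \<Rightarrow>\<^sub>0 'k::field)"
  where "bvec b \<equiv> Poly_Mapping.single b 1"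

definition free :: "'b set \<Rightarrow> ('b \<Rightarrow>\<^sub>0 'k::field) set"
  where "free X = {u. Poly_Mapping.keys u \<subseteq> X}"

definition linear_on :: "('b \<Rightarrow>\<^sub>0 'k::field) set \<Rightarrow> (('b \<Rightarrow>\<^sub>0 'k) \<Rightarrow> ('c \<Rightarrow>\<^sub>0 'k)) \<Rightarrow> bool"
  where "linear_on U f \<longleftrightarrow>
    (\<forall>x\<in>U. \<forall>y\<in>U. f (x + y) = f x + f y) \<and> (\<forall>c. \<forall>x\<in>U. f (scl c x) = scl c (f x))"

definition linear_form_on :: "('b \<Rightarrow>\<^sub>0 'k::field) set \<Rightarrow> (('b \<Rightarrow>\<^sub>0 'k) \<Rightarrow> 'k) \<Rightarrow> bool"
  where "linear_form_on U f \<longleftrightarrow>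
    (\<forall>x\<in>U. \<forall>y\<in>U. f (x + y) = f x + f y) \<and> (\<forall>c. \<forall>x\<in>U. f (scl c x) = c * f x)"

definition linext :: "('b \<Rightarrow> ('c \<Rightarrow>\<^sub>0 'k)) \<Rightarrow> ('b \<Rightarrow>\<^sub>0 'k::field) \<Rightarrow> ('c \<Rightarrow>\<^sub>0 'k)"
  where "linext F u = (\<Sum>b\<in>Poly_Mapping.keys u. scl (Poly_Mapping.lookup u b) (F b))"

definition reindex :: "('b \<Rightarrow> 'c) \<Rightarrow> ('b \<Rightarrow>\<^sub>0 'k::field) \<Rightarrow> ('c \<Rightarrow>\<^sub>0 'k)"
  where "reindex \<phi> = linext (\<lambda>b. bvec (\<phi> b))"

definition tens :: "('b \<Rightarrow>\<^sub>0 'k::field) \<Rightarrow> ('c \<Rightarrow>\<^sub>0 'k) \<Rightarrow> (('b \<times> 'c) \<Rightarrow>\<^sub>0 'k)"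
  where "tens u w = (\<Sum>b\<in>Poly_Mapping.keys u. \<Sum>c\<in>Poly_Mapping.keys w.
    Poly_Mapping.single (b, c) (Poly_Mapping.lookup u b * Poly_Mapping.lookup w c))"

definition tensor ::
    "('b \<Rightarrow>\<^sub>0 'k::field) set \<Rightarrow> ('c \<Rightarrow>\<^sub>0 'k) set \<Rightarrow> (('b \<times> 'c) \<Rightarrow>\<^sub>0 'k) set"
  where "tensor U W = lin.span {tens u w | u w. u \<in> U \<and> w \<in> W}"

text \<open>
  The sections \<open>rsec z b\<close> and \<open>lsec z c\<close> are the coefficients in
  \<open>z = \<Sum>b. b \<otimes> rsec z b = \<Sum>c. lsec z c \<otimes> c\<close>.  If \<open>z\<close> lies in the tensor product of \<open>U\<close> and \<open>W\<close>, then
  \<open>lsec z c \<in> U\<close> and \<open>rsec z b \<in> W\<close>, so the maps \<open>id \<otimes> g\<close>, \<open>f \<otimes> id\<close> and \<open>f \<otimes> g\<close> are given there by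
  the formulas \<open>rmap\<close>, \<open>lmap\<close>, \<open>tmap\<close>, even if \<open>f\<close> and \<open>g\<close> are linear only on \<open>U\<close> and \<open>W\<close>.
\<close>

definition rsec :: "(('b \<times> 'c) \<Rightarrow>\<^sub>0 'k::field) \<Rightarrow> 'b \<Rightarrow> ('c \<Rightarrow>\<^sub>0 'k)"
  where "rsec z b = Poly_Mapping.map_key (\<lambda>c. (b, c)) z"

definition lsec :: "(('b \<times> 'c) \<Rightarrow>\<^sub>0 'k::field) \<Rightarrow> 'c \<Rightarrow> ('b \<Rightarrow>\<^sub>0 'k)"
  where "lsec z c = Poly_Mapping.map_key (\<lambda>b. (b, c)) z"

definition rmap ::
    "(('c \<Rightarrow>\<^sub>0 'k) \<Rightarrow> ('d \<Rightarrow>\<^sub>0 'k)) \<Rightarrow> (('b \<times> 'c) \<Rightarrow>\<^sub>0 'k::field) \<Rightarrow> (('b \<times> 'd) \<Rightarrow>\<^sub>0 'k)"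
  where "rmap g z = (\<Sum>b\<in>fst ` Poly_Mapping.keys z. tens (bvec b) (g (rsec z b)))"

definition lmap ::
    "(('b \<Rightarrow>\<^sub>0 'k) \<Rightarrow> ('d \<Rightarrow>\<^sub>0 'k)) \<Rightarrow> (('b \<times> 'c) \<Rightarrow>\<^sub>0 'k::field) \<Rightarrow> (('d \<times> 'c) \<Rightarrow>\<^sub>0 'k)"
  where "lmap f z = (\<Sum>c\<in>snd ` Poly_Mapping.keys z. tens (f (lsec z c)) (bvec c))"

definition tmap ::
    "(('b \<Rightarrow>\<^sub>0 'k) \<Rightarrow> ('d \<Rightarrow>\<^sub>0 'k)) \<Rightarrow> (('c \<Rightarrow>\<^sub>0 'k) \<Rightarrow> ('e \<Rightarrow>\<^sub>0 'k))
      \<Rightarrow> (('b \<times> 'c) \<Rightarrow>\<^sub>0 'k::field) \<Rightarrow> (('d \<times> 'e) \<Rightarrow>\<^sub>0 'k)"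
  where "tmap f g z = lmap f (rmap g z)"

text \<open>The contractions \<open>id \<otimes> e\<close> and \<open>e \<otimes> id\<close> with a linear form \<open>e\<close>.\<close>

definition rcontract ::
    "(('c \<Rightarrow>\<^sub>0 'k) \<Rightarrow> 'k) \<Rightarrow> (('b \<times> 'c) \<Rightarrow>\<^sub>0 'k::field) \<Rightarrow> ('b \<Rightarrow>\<^sub>0 'k)"
  where "rcontract e z = (\<Sum>b\<in>fst ` Poly_Mapping.keys z. Poly_Mapping.single b (e (rsec z b)))"

definition lcontract ::
    "(('b \<Rightarrow>\<^sub>0 'k) \<Rightarrow> 'k) \<Rightarrow> (('b \<times> 'c) \<Rightarrow>\<^sub>0 'k::field) \<Rightarrow> ('c \<Rightarrow>\<^sub>0 'k)"
  where "lcontract e z = (\<Sum>c\<in>snd ` Poly_Mapping.keys z. Poly_Mapping.single c (e (lsec z c)))"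

definition flip :: "(('b \<times> 'c) \<Rightarrow>\<^sub>0 'k::field) \<Rightarrow> (('c \<times> 'b) \<Rightarrow>\<^sub>0 'k)"
  where "flip = reindex (\<lambda>(b, c). (c, b))"

definition middle ::
    "((('b \<times> 'b) \<Rightarrow>\<^sub>0 'k) \<Rightarrow> (('b \<times> 'b) \<Rightarrow>\<^sub>0 'k))
      \<Rightarrow> ((('b \<times> 'b) \<times> ('b \<times> 'b)) \<Rightarrow>\<^sub>0 'k::field) \<Rightarrow> ((('b \<times> 'b) \<times> ('b \<times> 'b)) \<Rightarrow>\<^sub>0 'k)"
  \<comment> \<open>\<open>id \<otimes> c \<otimes> id\<close>\<close>
  where "middle c z =
    reindex (\<lambda>(x, (y, y'), w). ((x, y), (y', w)))
      (rmap (lmap c) (reindex (\<lambda>((x, y), (y', w)). (x, (y, y'), w)) z))"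

section \<open>Graded Hopf algebras, ordinary and braided\<close>

text \<open>The multiplication is a linear map on the tensor square.\<close>

record (overloaded) ('b, 'k) hopf_data =
  hspace :: "('b \<Rightarrow>\<^sub>0 'k::field) set"
  hmult :: "(('b \<times> 'b) \<Rightarrow>\<^sub>0 'k::field) \<Rightarrow> ('b \<Rightarrow>\<^sub>0 'k)"
  hone :: "'b \<Rightarrow>\<^sub>0 'k::field"
  hcomult :: "('b \<Rightarrow>\<^sub>0 'k::field) \<Rightarrow> (('b \<times> 'b) \<Rightarrow>\<^sub>0 'k)"
  hcounit :: "('b \<Rightarrow>\<^sub>0 'k::field) \<Rightarrow> 'k"
  hgrad :: "nat \<Rightarrow> ('b \<Rightarrow>\<^sub>0 'k::field) set"

abbreviation hprod :: "('b, 'k::field) hopf_data \<Rightarrow> ('b \<Rightarrow>\<^sub>0 'k) \<Rightarrow> ('b \<Rightarrow>\<^sub>0 'k) \<Rightarrow> ('b \<Rightarrow>\<^sub>0 'k)"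
  where "hprod A x y \<equiv> hmult A (tens x y)"

definition is_algebra :: "('b, 'k::field) hopf_data \<Rightarrow> bool"
  where "is_algebra A \<longleftrightarrow>
    lin.subspace (hspace A) \<and>
    linear_on (tensor (hspace A) (hspace A)) (hmult A) \<and>
    hmult A ` tensor (hspace A) (hspace A) \<subseteq> hspace A \<and>
    hone A \<in> hspace A \<and>
    (\<forall>x\<in>hspace A. \<forall>y\<in>hspace A. \<forall>z\<in>hspace A.
      hprod A (hprod A x y) z = hprod A x (hprod A y z)) \<and>
    (\<forall>x\<in>hspace A. hprod A (hone A) x = x \<and> hprod A x (hone A) = x)"

definition is_coalgebra :: "('b, 'k::field) hopf_data \<Rightarrow> bool"
  where "is_coalgebra A \<longleftrightarrow>
    lin.subspace (hspace A) \<and>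
    linear_on (hspace A) (hcomult A) \<and>
    hcomult A ` hspace A \<subseteq> tensor (hspace A) (hspace A) \<and>
    linear_form_on (hspace A) (hcounit A) \<and>
    (\<forall>x\<in>hspace A.
      reindex (\<lambda>((a, b), c). (a, b, c)) (lmap (hcomult A) (hcomult A x)) =
      rmap (hcomult A) (hcomult A x)) \<and>
    (\<forall>x\<in>hspace A. lcontract (hcounit A) (hcomult A x) = x \<and>
      rcontract (hcounit A) (hcomult A x) = x)"

text \<open>
  The Hopf algebra axioms with respect to a braiding \<open>c\<close> of the tensor square; ordinary Hopf algebras
  are the case where \<open>c\<close> is the flip.
\<close>

definition hopf_axioms_wrt ::
    "((('b \<times> 'b) \<Rightarrow>\<^sub>0 'k) \<Rightarrow> (('b \<times> 'b) \<Rightarrow>\<^sub>0 'k)) \<Rightarrow> ('b, 'k::field) hopf_data \<Rightarrow> bool"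
  where "hopf_axioms_wrt c A \<longleftrightarrow>
    is_algebra A \<and> is_coalgebra A \<and>
    (\<forall>x\<in>hspace A. \<forall>y\<in>hspace A.
      hcomult A (hprod A x y) =
      tmap (hmult A) (hmult A) (middle c (tens (hcomult A x) (hcomult A y)))) \<and>
    hcomult A (hone A) = tens (hone A) (hone A) \<and>
    (\<forall>x\<in>hspace A. \<forall>y\<in>hspace A. hcounit A (hprod A x y) = hcounit A x * hcounit A y) \<and>
    hcounit A (hone A) = 1 \<and>
    (\<exists>S. linear_on (hspace A) S \<and> S ` hspace A \<subseteq> hspace A \<and>
      (\<forall>x\<in>hspace A.
        hmult A (lmap S (hcomult A x)) = scl (hcounit A x) (hone A) \<and>
        hmult A (rmap S (hcomult A x)) = scl (hcounit A x) (hone A)))"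

definition hopf_algebra :: "('b, 'k::field) hopf_data \<Rightarrow> bool"
  where "hopf_algebra A \<longleftrightarrow> hopf_axioms_wrt flip A"

definition compatible_grading :: "('b, 'k::field) hopf_data \<Rightarrow> bool"
  where "compatible_grading A \<longleftrightarrow>
    (\<forall>n. lin.subspace (hgrad A n)) \<and>
    lin.span (\<Union>n. hgrad A n) = hspace A \<and>
    (\<forall>I f. finite I \<and> (\<forall>n\<in>I. f n \<in> hgrad A n) \<and> (\<Sum>n\<in>I. f n) = 0 \<longrightarrow> (\<forall>n\<in>I. f n = 0)) \<and>
    (\<forall>m n. hmult A ` tensor (hgrad A m) (hgrad A n) \<subseteq> hgrad A (m + n)) \<and>
    hone A \<in> hgrad A 0 \<and>
    (\<forall>n. hcomult A ` hgrad A n \<subseteq> lin.span (\<Union>i\<le>n. tensor (hgrad A i) (hgrad A (n - i)))) \<and>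
    (\<forall>n>0. \<forall>x\<in>hgrad A n. hcounit A x = 0)"

definition subcoalgebra :: "('b, 'k::field) hopf_data \<Rightarrow> ('b \<Rightarrow>\<^sub>0 'k) set \<Rightarrow> bool"
  where "subcoalgebra A D \<longleftrightarrow>
    lin.subspace D \<and> D \<subseteq> hspace A \<and> hcomult A ` D \<subseteq> tensor D D"

definition simple_subcoalgebra :: "('b, 'k::field) hopf_data \<Rightarrow> ('b \<Rightarrow>\<^sub>0 'k) set \<Rightarrow> bool"
  where "simple_subcoalgebra A D \<longleftrightarrow>
    subcoalgebra A D \<and> D \<noteq> {0} \<and> (\<forall>E. subcoalgebra A E \<and> E \<subseteq> D \<longrightarrow> E = {0} \<or> E = D)"

definition pointed :: "('b, 'k::field) hopf_data \<Rightarrow> bool"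
  where "pointed A \<longleftrightarrow> (\<forall>D. simple_subcoalgebra A D \<longrightarrow> lin.dim D = 1)"

primrec coradical_filtration :: "('b, 'k::field) hopf_data \<Rightarrow> nat \<Rightarrow> ('b \<Rightarrow>\<^sub>0 'k) set"
  where
    "coradical_filtration A 0 = lin.span (\<Union>{D. simple_subcoalgebra A D})"
  | "coradical_filtration A (Suc n) =
      {x \<in> hspace A. hcomult A x \<in>
        lin.span (tensor (hspace A) (coradical_filtration A n) \<union>
          tensor (lin.span (\<Union>{D. simple_subcoalgebra A D})) (hspace A))}"

definition coradically_graded :: "('b, 'k::field) hopf_data \<Rightarrow> bool"
  where "coradically_graded A \<longleftrightarrow>
    compatible_grading A \<and> (\<forall>n. coradical_filtration A n = lin.span (\<Union>i\<le>n. hgrad A i))"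

definition link_indecomposable :: "('b, 'k::field) hopf_data \<Rightarrow> bool"
  where "link_indecomposable A \<longleftrightarrow>
    \<not> (\<exists>D E. subcoalgebra A D \<and> subcoalgebra A E \<and> D \<noteq> {0} \<and> E \<noteq> {0} \<and>
        D \<inter> E = {0} \<and> lin.span (D \<union> E) = hspace A)"

text \<open>Bialgebra maps between Hopf algebras preserve the antipode automatically.\<close>

definition hopf_map ::
    "('b, 'k::field) hopf_data \<Rightarrow> ('c, 'k) hopf_data \<Rightarrow> (('b \<Rightarrow>\<^sub>0 'k) \<Rightarrow> ('c \<Rightarrow>\<^sub>0 'k)) \<Rightarrow> bool"
  where "hopf_map A B F \<longleftrightarrow>
    linear_on (hspace A) F \<and> F ` hspace A \<subseteq> hspace B \<and>
    (\<forall>x\<in>hspace A. \<forall>y\<in>hspace A. F (hprod A x y) = hprod B (F x) (F y)) \<and>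
    F (hone A) = hone B \<and>
    (\<forall>x\<in>hspace A. hcomult B (F x) = tmap F F (hcomult A x)) \<and>
    (\<forall>x\<in>hspace A. hcounit B (F x) = hcounit A x)"

definition hopf_iso ::
    "('b, 'k::field) hopf_data \<Rightarrow> ('c, 'k) hopf_data \<Rightarrow> (('b \<Rightarrow>\<^sub>0 'k) \<Rightarrow> ('c \<Rightarrow>\<^sub>0 'k)) \<Rightarrow> bool"
  where "hopf_iso A B F \<longleftrightarrow> hopf_map A B F \<and> bij_betw F (hspace A) (hspace B)"

section \<open>Yetter-Drinfeld modules over group algebras\<close>

text \<open>
  A Yetter-Drinfeld module over the group algebra of \<open>K\<close> is a subspace \<open>W\<close> with an action
  \<open>act g w = g.w\<close> and a coaction \<open>d w = w\<^sub>(\<^sub>-\<^sub>1\<^sub>) \<otimes> w\<^sub>(\<^sub>0\<^sub>)\<close> such that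
  \<open>d (g.w) = g w\<^sub>(\<^sub>-\<^sub>1\<^sub>) g\<inverse> \<otimes> g.w\<^sub>(\<^sub>0\<^sub>)\<close>.
\<close>

definition yd_module ::
    "'g monoid \<Rightarrow> ('b \<Rightarrow>\<^sub>0 'k::field) set \<Rightarrow> ('g \<Rightarrow> ('b \<Rightarrow>\<^sub>0 'k) \<Rightarrow> ('b \<Rightarrow>\<^sub>0 'k))
      \<Rightarrow> (('b \<Rightarrow>\<^sub>0 'k) \<Rightarrow> (('g \<times> 'b) \<Rightarrow>\<^sub>0 'k)) \<Rightarrow> bool"
  where "yd_module K W act d \<longleftrightarrow>
    lin.subspace W \<and>
    (\<forall>g\<in>carrier K. linear_on W (act g) \<and> act g ` W \<subseteq> W) \<and>
    (\<forall>w\<in>W. act \<one>\<^bsub>K\<^esub> w = w) \<and>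
    (\<forall>g\<in>carrier K. \<forall>h\<in>carrier K. \<forall>w\<in>W. act (g \<otimes>\<^bsub>K\<^esub> h) w = act g (act h w)) \<and>
    linear_on W d \<and> d ` W \<subseteq> tensor (free (carrier K)) W \<and>
    (\<forall>w\<in>W. rmap d (d w) = reindex (\<lambda>(g, b). (g, g, b)) (d w)) \<and>
    (\<forall>w\<in>W. reindex snd (d w) = w) \<and>
    (\<forall>g\<in>carrier K. \<forall>w\<in>W.
      d (act g w) = tmap (reindex (\<lambda>h. g \<otimes>\<^bsub>K\<^esub> h \<otimes>\<^bsub>K\<^esub> inv\<^bsub>K\<^esub> g)) (act g) (d w))"

definition homogeneous ::
    "('b \<Rightarrow>\<^sub>0 'k::field) set \<Rightarrow> (('b \<Rightarrow>\<^sub>0 'k) \<Rightarrow> (('g \<times> 'b) \<Rightarrow>\<^sub>0 'k)) \<Rightarrow> 'g \<Rightarrow> ('b \<Rightarrow>\<^sub>0 'k) set"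
  where "homogeneous W d g = {w \<in> W. d w = tens (bvec g) w}"

definition yd_support ::
    "'g monoid \<Rightarrow> ('b \<Rightarrow>\<^sub>0 'k::field) set \<Rightarrow> (('b \<Rightarrow>\<^sub>0 'k) \<Rightarrow> (('g \<times> 'b) \<Rightarrow>\<^sub>0 'k)) \<Rightarrow> 'g set"
  where "yd_support K W d = {g \<in> carrier K. homogeneous W d g \<noteq> {0}}"

text \<open>The braiding \<open>u \<otimes> w \<mapsto> u\<^sub>(\<^sub>-\<^sub>1\<^sub>).w \<otimes> u\<^sub>(\<^sub>0\<^sub>)\<close>, evaluated degree by degree in the first leg of
  \<open>(d \<otimes> id) z\<close>.\<close>

definition yd_braiding ::
    "('g \<Rightarrow> ('b \<Rightarrow>\<^sub>0 'k) \<Rightarrow> ('b \<Rightarrow>\<^sub>0 'k)) \<Rightarrow> (('b \<Rightarrow>\<^sub>0 'k) \<Rightarrow> (('g \<times> 'b) \<Rightarrow>\<^sub>0 'k))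
      \<Rightarrow> (('b \<times> 'b) \<Rightarrow>\<^sub>0 'k::field) \<Rightarrow> (('b \<times> 'b) \<Rightarrow>\<^sub>0 'k)"
  where "yd_braiding act d z =
    (\<Sum>g\<in>(fst \<circ> fst) ` Poly_Mapping.keys (lmap d z).
      flip (rmap (act g) (Poly_Mapping.map_key (\<lambda>(b, c). ((g, b), c)) (lmap d z))))"

definition codiagonal ::
    "'g monoid \<Rightarrow> (('b \<Rightarrow>\<^sub>0 'k) \<Rightarrow> (('g \<times> 'b) \<Rightarrow>\<^sub>0 'k))
      \<Rightarrow> (('b \<times> 'b) \<Rightarrow>\<^sub>0 'k::field) \<Rightarrow> (('g \<times> 'b \<times> 'b) \<Rightarrow>\<^sub>0 'k)"
  where "codiagonal K d z = reindex (\<lambda>((g, b), (h, c)). (g \<otimes>\<^bsub>K\<^esub> h, b, c)) (tmap d d z)"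

text \<open>Graded Hopf algebras in the braided category of Yetter-Drinfeld modules: the structure maps are
  \<open>K\<close>-linear and \<open>K\<close>-colinear, and the grading is by Yetter-Drinfeld submodules.\<close>

definition braided_graded_hopf ::
    "'g monoid \<Rightarrow> ('b, 'k::field) hopf_data \<Rightarrow> ('g \<Rightarrow> ('b \<Rightarrow>\<^sub>0 'k) \<Rightarrow> ('b \<Rightarrow>\<^sub>0 'k))
      \<Rightarrow> (('b \<Rightarrow>\<^sub>0 'k) \<Rightarrow> (('g \<times> 'b) \<Rightarrow>\<^sub>0 'k)) \<Rightarrow> bool"
  where "braided_graded_hopf K R act d \<longleftrightarrow>
    yd_module K (hspace R) act d \<and>
    hopf_axioms_wrt (yd_braiding act d) R \<and>
    (\<forall>g\<in>carrier K.
      (\<forall>x\<in>hspace R. \<forall>y\<in>hspace R. act g (hprod R x y) = hprod R (act g x) (act g y)) \<and>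
      act g (hone R) = hone R \<and>
      (\<forall>x\<in>hspace R. hcomult R (act g x) = tmap (act g) (act g) (hcomult R x)) \<and>
      (\<forall>x\<in>hspace R. hcounit R (act g x) = hcounit R x)) \<and>
    (\<forall>z\<in>tensor (hspace R) (hspace R). d (hmult R z) = rmap (hmult R) (codiagonal K d z)) \<and>
    d (hone R) = tens (bvec \<one>\<^bsub>K\<^esub>) (hone R) \<and>
    (\<forall>x\<in>hspace R. rmap (hcomult R) (d x) = codiagonal K d (hcomult R x)) \<and>
    (\<forall>x\<in>hspace R. rcontract (hcounit R) (d x) = Poly_Mapping.single \<one>\<^bsub>K\<^esub> (hcounit R x)) \<and>
    compatible_grading R \<and>
    (\<forall>n. (\<forall>g\<in>carrier K. act g ` hgrad R n \<subseteq> hgrad R n) \<and>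
      d ` hgrad R n \<subseteq> tensor (free (carrier K)) (hgrad R n))"

text \<open>
  The bosonization: \<open>r # g\<close> is \<open>tens r (bvec g)\<close>, with
  \<open>(r # g) (s # h) = r (g.s) # g h\<close> and
  \<open>r # g \<mapsto> (r\<^sup>(\<^sup>1\<^sup>) # r\<^sup>(\<^sup>2\<^sup>)\<^sub>(\<^sub>-\<^sub>1\<^sub>) g) \<otimes> (r\<^sup>(\<^sup>2\<^sup>)\<^sub>(\<^sub>0\<^sub>) # g)\<close>.
  The calls of \<open>map_key\<close> and \<open>lsec\<close> extract the component in \<open>R\<close>, or in the tensor square of \<open>R\<close>, that
  belongs to given group elements.
\<close>

definition bosonization ::
    "'g monoid \<Rightarrow> ('b, 'k::field) hopf_data \<Rightarrow> ('g \<Rightarrow> ('b \<Rightarrow>\<^sub>0 'k) \<Rightarrow> ('b \<Rightarrow>\<^sub>0 'k))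
      \<Rightarrow> (('b \<Rightarrow>\<^sub>0 'k) \<Rightarrow> (('g \<times> 'b) \<Rightarrow>\<^sub>0 'k)) \<Rightarrow> ('b \<times> 'g, 'k) hopf_data"
  where "bosonization K R act d = \<lparr>
    hspace = tensor (hspace R) (free (carrier K)),
    hmult = (\<lambda>z. \<Sum>(g, h)\<in>(\<lambda>((b, g), (c, h)). (g, h)) ` Poly_Mapping.keys z.
      tens (hmult R (rmap (act g) (Poly_Mapping.map_key (\<lambda>(b, c). ((b, g), (c, h))) z)))
        (bvec (g \<otimes>\<^bsub>K\<^esub> h))),
    hone = tens (hone R) (bvec \<one>\<^bsub>K\<^esub>),
    hcomult = (\<lambda>z. \<Sum>g\<in>snd ` Poly_Mapping.keys z.
      reindex (\<lambda>(b, (h, c)). ((b, h \<otimes>\<^bsub>K\<^esub> g), (c, g))) (rmap d (hcomult R (lsec z g)))),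
    hcounit = (\<lambda>z. \<Sum>g\<in>snd ` Poly_Mapping.keys z. hcounit R (lsec z g)),
    hgrad = (\<lambda>n. tensor (hgrad R n) (free (carrier K)))\<rparr>"

definition hopf_covering ::
    "('b, 'k::field) hopf_data
      \<Rightarrow> 'h monoid \<Rightarrow> ('h \<Rightarrow> ('b \<Rightarrow>\<^sub>0 'k) \<Rightarrow> ('b \<Rightarrow>\<^sub>0 'k)) \<Rightarrow> (('b \<Rightarrow>\<^sub>0 'k) \<Rightarrow> (('h \<times> 'b) \<Rightarrow>\<^sub>0 'k))
      \<Rightarrow> 'g monoid \<Rightarrow> ('g \<Rightarrow> ('b \<Rightarrow>\<^sub>0 'k) \<Rightarrow> ('b \<Rightarrow>\<^sub>0 'k)) \<Rightarrow> (('b \<Rightarrow>\<^sub>0 'k) \<Rightarrow> (('g \<times> 'b) \<Rightarrow>\<^sub>0 'k))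
      \<Rightarrow> ('h \<Rightarrow> 'g) \<Rightarrow> ((('b \<times> 'h) \<Rightarrow>\<^sub>0 'k) \<Rightarrow> (('b \<times> 'g) \<Rightarrow>\<^sub>0 'k)) \<Rightarrow> bool"
  where "hopf_covering R H actH dH G actG dG f F \<longleftrightarrow>
    group H \<and> group G \<and>
    braided_graded_hopf H R actH dH \<and> braided_graded_hopf G R actG dG \<and>
    (let A = bosonization H R actH dH; B = bosonization G R actG dG in
      hopf_algebra A \<and> pointed A \<and> coradically_graded A \<and>
      hopf_algebra B \<and> pointed B \<and> coradically_graded B \<and>
      hopf_map A B F) \<and>
    f \<in> hom H G \<and> f ` carrier H = carrier G \<and>
    (\<forall>r\<in>hspace R. \<forall>h\<in>carrier H. F (tens r (bvec h)) = tens r (bvec (f h)))"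

definition covering_hopf_algebra ::
    "('b, 'k::field) hopf_data
      \<Rightarrow> 'h monoid \<Rightarrow> ('h \<Rightarrow> ('b \<Rightarrow>\<^sub>0 'k) \<Rightarrow> ('b \<Rightarrow>\<^sub>0 'k)) \<Rightarrow> (('b \<Rightarrow>\<^sub>0 'k) \<Rightarrow> (('h \<times> 'b) \<Rightarrow>\<^sub>0 'k))
      \<Rightarrow> 'g monoid \<Rightarrow> ('g \<Rightarrow> ('b \<Rightarrow>\<^sub>0 'k) \<Rightarrow> ('b \<Rightarrow>\<^sub>0 'k)) \<Rightarrow> (('b \<Rightarrow>\<^sub>0 'k) \<Rightarrow> (('g \<times> 'b) \<Rightarrow>\<^sub>0 'k))
      \<Rightarrow> ('h \<Rightarrow> 'g) \<Rightarrow> ((('b \<times> 'h) \<Rightarrow>\<^sub>0 'k) \<Rightarrow> (('b \<times> 'g) \<Rightarrow>\<^sub>0 'k)) \<Rightarrow> bool"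
  where "covering_hopf_algebra R H actH dH G actG dG f F \<longleftrightarrow>
    hopf_covering R H actH dH G actG dG f F \<and>
    link_indecomposable (bosonization H R actH dH)"

section \<open>Nichols algebras inside path coalgebras\<close>

text \<open>
  Here \<open>V = free X\<close>, the vectors \<open>v\<^sub>x = bvec x\<close> are the loops of the quiver, and a path is the list of
  its loops, so the path coalgebra lives in \<open>'a list \<Rightarrow>\<^sub>0 'k\<close>.  The argument \<open>c\<close> is the braiding of
  \<open>V\<close>; \<open>braid_at c i\<close> applies it to the tensor factors \<open>i\<close> and \<open>i + 1\<close>, counted from 0.
\<close>

definition braid_at ::
    "((('a \<times> 'a) \<Rightarrow>\<^sub>0 'k) \<Rightarrow> (('a \<times> 'a) \<Rightarrow>\<^sub>0 'k)) \<Rightarrow> nat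
      \<Rightarrow> ('a list \<Rightarrow>\<^sub>0 'k::field) \<Rightarrow> ('a list \<Rightarrow>\<^sub>0 'k)"
  where "braid_at c i = linext (\<lambda>p.
    reindex (\<lambda>(x, y). take i p @ [x, y] @ drop (i + 2) p) (c (bvec (p ! i, p ! (i + 1)))))"

definition reduced_word :: "nat \<Rightarrow> (nat \<Rightarrow> nat) \<Rightarrow> nat list"
  where "reduced_word n \<sigma> = (ARG_MIN length is.
    (\<forall>i\<in>set is. i + 1 < n) \<and> foldr (\<lambda>i \<tau>. transpose i (i + 1) \<circ> \<tau>) is id = \<sigma>)"

text \<open>The Matsumoto section; since \<open>c\<close> satisfies the braid equation, the choice of the reduced word
  does not matter.\<close>

definition matsumoto ::
    "((('a \<times> 'a) \<Rightarrow>\<^sub>0 'k) \<Rightarrow> (('a \<times> 'a) \<Rightarrow>\<^sub>0 'k)) \<Rightarrow> nat \<Rightarrow> (nat \<Rightarrow> nat)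
      \<Rightarrow> ('a list \<Rightarrow>\<^sub>0 'k::field) \<Rightarrow> ('a list \<Rightarrow>\<^sub>0 'k)"
  where "matsumoto c n \<sigma> = foldr (\<lambda>i T. braid_at c i \<circ> T) (reduced_word n \<sigma>) id"

definition quantum_symmetrizer ::
    "((('a \<times> 'a) \<Rightarrow>\<^sub>0 'k) \<Rightarrow> (('a \<times> 'a) \<Rightarrow>\<^sub>0 'k)) \<Rightarrow> nat
      \<Rightarrow> ('a list \<Rightarrow>\<^sub>0 'k::field) \<Rightarrow> ('a list \<Rightarrow>\<^sub>0 'k)"
  where "quantum_symmetrizer c n z = (\<Sum>\<sigma> | \<sigma> permutes {..<n}. matsumoto c n \<sigma> z)"

text \<open>The product of the cotensor coalgebra for which the quantum symmetrizers form an algebra map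
  from the tensor algebra.\<close>

definition quantum_shuffle ::
    "((('a \<times> 'a) \<Rightarrow>\<^sub>0 'k) \<Rightarrow> (('a \<times> 'a) \<Rightarrow>\<^sub>0 'k)) \<Rightarrow> 'a list \<Rightarrow> 'a list \<Rightarrow> ('a list \<Rightarrow>\<^sub>0 'k::field)"
  where "quantum_shuffle c p q = (let m = length p; n = length q in
    \<Sum>\<sigma> | \<sigma> permutes {..<m + n} \<and> strict_mono_on {..<m} \<sigma> \<and> strict_mono_on {m..<m + n} \<sigma>.
      matsumoto c (m + n) \<sigma> (bvec (p @ q)))"

definition nichols_comp ::
    "((('a \<times> 'a) \<Rightarrow>\<^sub>0 'k) \<Rightarrow> (('a \<times> 'a) \<Rightarrow>\<^sub>0 'k)) \<Rightarrow> 'a set \<Rightarrow> nat \<Rightarrow> ('a list \<Rightarrow>\<^sub>0 'k::field) set"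
  where "nichols_comp c X n = quantum_symmetrizer c n ` free {p. length p = n \<and> set p \<subseteq> X}"

definition nichols ::
    "((('a \<times> 'a) \<Rightarrow>\<^sub>0 'k) \<Rightarrow> (('a \<times> 'a) \<Rightarrow>\<^sub>0 'k)) \<Rightarrow> 'a set \<Rightarrow> ('a list, 'k::field) hopf_data"
  where "nichols c X = \<lparr>
    hspace = lin.span (\<Union>n. nichols_comp c X n),
    hmult = linext (\<lambda>(p, q). quantum_shuffle c p q),
    hone = bvec [],
    hcomult = linext (\<lambda>p. \<Sum>i\<le>length p. bvec (take i p, drop i p)),
    hcounit = (\<lambda>u. Poly_Mapping.lookup u []),
    hgrad = nichols_comp c X\<rparr>"

text \<open>The diagonal action and the codiagonal coaction on the tensor powers of \<open>V\<close>.\<close>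

primrec path_action ::
    "(('a \<Rightarrow>\<^sub>0 'k) \<Rightarrow> ('a \<Rightarrow>\<^sub>0 'k)) \<Rightarrow> 'a list \<Rightarrow> ('a list \<Rightarrow>\<^sub>0 'k::field)"
  where
    "path_action T [] = bvec []"
  | "path_action T (x # p) = reindex (\<lambda>(y, q). y # q) (tens (T (bvec x)) (path_action T p))"

primrec path_coaction ::
    "'g monoid \<Rightarrow> (('a \<Rightarrow>\<^sub>0 'k) \<Rightarrow> (('g \<times> 'a) \<Rightarrow>\<^sub>0 'k)) \<Rightarrow> 'a list \<Rightarrow> (('g \<times> 'a list) \<Rightarrow>\<^sub>0 'k::field)"
  where
    "path_coaction K d [] = bvec (\<one>\<^bsub>K\<^esub>, [])"
  | "path_coaction K d (x # p) =
      reindex (\<lambda>((g, y), (h, q)). (g \<otimes>\<^bsub>K\<^esub> h, y # q)) (tens (d (bvec x)) (path_coaction K d p))"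

definition tensor_action ::
    "('g \<Rightarrow> ('a \<Rightarrow>\<^sub>0 'k) \<Rightarrow> ('a \<Rightarrow>\<^sub>0 'k)) \<Rightarrow> 'g \<Rightarrow> ('a list \<Rightarrow>\<^sub>0 'k::field) \<Rightarrow> ('a list \<Rightarrow>\<^sub>0 'k)"
  where "tensor_action act g = linext (path_action (act g))"

definition tensor_coaction ::
    "'g monoid \<Rightarrow> (('a \<Rightarrow>\<^sub>0 'k) \<Rightarrow> (('g \<times> 'a) \<Rightarrow>\<^sub>0 'k))
      \<Rightarrow> ('a list \<Rightarrow>\<^sub>0 'k::field) \<Rightarrow> (('g \<times> 'a list) \<Rightarrow>\<^sub>0 'k)"
  where "tensor_coaction K d = linext (path_coaction K d)"

section \<open>The universal coalgebra covering group\<close>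

text \<open>The free group on \<open>X\<close>: words in the letters \<open>(x, True)\<close>, for \<open>x\<close>, and \<open>(x, False)\<close>, for
  \<open>x\<inverse>\<close>, modulo cancellation.\<close>

definition words :: "'a set \<Rightarrow> ('a \<times> bool) list set"
  where "words X = lists (X \<times> UNIV)"

definition cancel1 :: "'a set \<Rightarrow> (('a \<times> bool) list \<times> ('a \<times> bool) list) set"
  where "cancel1 X = {(u @ [(x, e), (x, \<not> e)] @ w, u @ w) | u w x e.
    u \<in> words X \<and> w \<in> words X \<and> x \<in> X}"

definition word_rel :: "'a set \<Rightarrow> (('a \<times> bool) list \<times> ('a \<times> bool) list) set"
  where "word_rel X = (cancel1 X \<union> (cancel1 X)\<inverse>)\<^sup>* \<inter> (words X \<times> words X)"

definition free_grp :: "'a set \<Rightarrow> ('a \<times> bool) list set monoid"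
  where "free_grp X = \<lparr>
    carrier = words X // word_rel X,
    monoid.mult = (\<lambda>A B. \<Union>u\<in>A. \<Union>w\<in>B. word_rel X `` {u @ w}),
    monoid.one = word_rel X `` {[]}\<rparr>"

definition free_gen :: "'a set \<Rightarrow> 'a \<Rightarrow> ('a \<times> bool) list set"
  where "free_gen X x = word_rel X `` {[(x, True)]}"

definition path_class :: "'a set \<Rightarrow> 'a list \<Rightarrow> ('a \<times> bool) list set"
  where "path_class X p = foldr (\<lambda>x A. free_gen X x \<otimes>\<^bsub>free_grp X\<^esub> A) p \<one>\<^bsub>free_grp X\<^esub>"

definition minimal_element :: "('b \<Rightarrow>\<^sub>0 'k::field) set \<Rightarrow> ('b \<Rightarrow>\<^sub>0 'k) \<Rightarrow> bool"
  where "minimal_element B b \<longleftrightarrow>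
    b \<in> B \<and> 2 \<le> card (Poly_Mapping.keys b) \<and>
    (\<forall>I. I \<noteq> {} \<and> I \<subset> Poly_Mapping.keys b \<longrightarrow>
      (\<Sum>p\<in>I. Poly_Mapping.single p (Poly_Mapping.lookup b p)) \<notin> B)"

definition path_sim :: "('b \<Rightarrow>\<^sub>0 'k::field) set \<Rightarrow> 'b \<Rightarrow> 'b \<Rightarrow> bool"
  where "path_sim B p p' \<longleftrightarrow>
    (\<exists>b. minimal_element B b \<and> p \<in> Poly_Mapping.keys b \<and> p' \<in> Poly_Mapping.keys b)"

definition normal_closure :: "('g, 'z) monoid_scheme \<Rightarrow> 'g set \<Rightarrow> 'g set"
  where "normal_closure K S =
    generate K {g \<otimes>\<^bsub>K\<^esub> s \<otimes>\<^bsub>K\<^esub> inv\<^bsub>K\<^esub> g | g s. g \<in> carrier K \<and> s \<in> S}"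

definition sim_relators :: "'a set \<Rightarrow> ('a list \<Rightarrow>\<^sub>0 'k::field) set \<Rightarrow> ('a \<times> bool) list set set"
  where "sim_relators X B = {inv\<^bsub>free_grp X\<^esub> path_class X p \<otimes>\<^bsub>free_grp X\<^esub> path_class X p' | p p'.
    path_sim B p p'}"

definition covering_grp ::
    "'a set \<Rightarrow> ('a list \<Rightarrow>\<^sub>0 'k::field) set \<Rightarrow> ('a \<times> bool) list set set monoid"
  where "covering_grp X B = free_grp X Mod normal_closure (free_grp X) (sim_relators X B)"

text \<open>The class of \<open>[v\<^sub>x]\<close> in the covering group.\<close>

definition covering_gen :: "'a set \<Rightarrow> ('a list \<Rightarrow>\<^sub>0 'k::field) set \<Rightarrow> 'a \<Rightarrow> ('a \<times> bool) list set set"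
  where "covering_gen X B x =
    normal_closure (free_grp X) (sim_relators X B) #>\<^bsub>free_grp X\<^esub> free_gen X x"

definition word_eval :: "('a, 'z) monoid_scheme \<Rightarrow> ('a \<times> bool) list \<Rightarrow> 'a"
  where "word_eval G w = foldr (\<lambda>(x, e) a. (if e then x else inv\<^bsub>G\<^esub> x) \<otimes>\<^bsub>G\<^esub> a) w \<one>\<^bsub>G\<^esub>"

text \<open>The homomorphism \<open>[v\<^sub>x] \<mapsto> x\<close> from the covering group to \<open>G\<close>: an element is a coset of classes of
  words, all of which have the same value in \<open>G\<close>.\<close>

definition covering_proj :: "('a, 'z) monoid_scheme \<Rightarrow> ('a \<times> bool) list set set \<Rightarrow> 'a"
  where "covering_proj G = (\<lambda>C. the_elem ((\<lambda>A. the_elem (word_eval G ` A)) ` C))"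

definition commutator_subgroup :: "('g, 'z) monoid_scheme \<Rightarrow> 'g set \<Rightarrow> 'g set \<Rightarrow> 'g set"
  where "commutator_subgroup K N L =
    generate K {n \<otimes>\<^bsub>K\<^esub> g \<otimes>\<^bsub>K\<^esub> inv\<^bsub>K\<^esub> n \<otimes>\<^bsub>K\<^esub> inv\<^bsub>K\<^esub> g | n g. n \<in> N \<and> g \<in> L}"

end

theory Submission
  imports Defs
begin

text \<open>
  Let \<open>H\<close> be the group of a covering.  Its map \<open>r # h \<mapsto> r # f h\<close> respects products, so \<open>h\<close> acts on the
  Nichols algebra as \<open>f h\<close> does (\<open>actH_eq\<close>); it respects coproducts, so \<open>f\<close> maps the \<open>H\<close>-degree of an
  element to its \<open>G\<close>-degree (\<open>coaction_push\<close>).  The \<open>H\<close>-components of \<open>v\<^sub>x\<close> are therefore homogeneous over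
  \<open>G\<close>, and as the homogeneous parts of \<open>V\<close> are lines, \<open>v\<^sub>x\<close> itself has an \<open>H\<close>-degree \<open>deg x\<close>, which lies
  over \<open>x\<close> (\<open>degree_exists\<close>).

  The heart of the matter is that the coaction of \<open>H\<close> on the Nichols algebra multiplies the degrees of
  the letters of each path (\<open>lookup_coaction\<close>).  A single path need not lie in the Nichols algebra, so
  this cannot be derived from products of letters.  It follows instead from the coproduct, which is
  deconcatenation and \<open>H\<close>-colinear: splitting off the first letter of a path reduces the claim for the
  path to the claim for a shorter one.  Hence the \<open>H\<close>-components of an element are the partial sums over
  the paths of a given degree, and they belong to the Nichols algebra.  A minimal element has no proper
  partial sum there, so all its paths have the same \<open>H\<close>-degree (\<open>path_sim_deg\<close>).  This says that the
  relations of the universal covering group hold for the elements \<open>deg x\<close> of \<open>H\<close>, and \<open>[v\<^sub>x] \<mapsto> deg x\<close>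
  becomes a homomorphism \<open>deg_hom\<close> from the universal covering group to \<open>H\<close>.

  It is surjective.  If \<open>H'\<close> is the subgroup generated by the degrees, the elements supported on \<open>H'\<close> and
  those supported on its complement form two complementary subcoalgebras of the bosonization, and
  link-indecomposability leaves no room for the second (\<open>generate_deg\<close>).  Let \<open>M\<close> be the kernel of
  \<open>deg_hom\<close>.  Since \<open>f\<close> composed with \<open>deg_hom\<close> is the projection \<open>[v\<^sub>x] \<mapsto> x\<close>, whose kernel is \<open>N\<close>, the
  group \<open>M\<close> is contained in \<open>N\<close>.  The image of \<open>N\<close> in \<open>H\<close> is the kernel of \<open>f\<close>; it acts trivially on \<open>V\<close>, so the
  Yetter-Drinfeld condition shows that it commutes with all degrees and is central
  (\<open>kernel_f_central\<close>).  Therefore \<open>[N, Gt] \<subseteq> M\<close>.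

  What remains is to move all structure along the isomorphism of \<open>H\<close> with the quotient by \<open>M\<close>.  It
  relabels basis vectors of the bosonization, and the locales \<open>group_change\<close> and \<open>hopf_reindex\<close> show
  that every notion in the definition of a covering is invariant under such a relabelling.
\<close>

abbreviation (input) coeff :: "('b \<Rightarrow>\<^sub>0 'k::zero) \<Rightarrow> 'b \<Rightarrow> 'k"
  where "coeff \<equiv> Poly_Mapping.lookup"

abbreviation (input) supp :: "('b \<Rightarrow>\<^sub>0 'k::zero) \<Rightarrow> 'b set"
  where "supp \<equiv> Poly_Mapping.keys"

section \<open>Linear maps between spaces with a basis\<close>

lemma linext_superset:
  assumes "finite S" "supp u \<subseteq> S"
  shows "linext F u = (\<Sum>b\<in>S. scl (coeff u b) (F b))"
  unfolding linext_def
  by (rule sum.mono_neutral_left[OF assms]) (auto simp: in_keys_iff)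

lemma lookup_linext:
  "coeff (linext F u) c =
    (\<Sum>b\<in>supp u. coeff u b * coeff (F b) c)"
  by (simp add: linext_def lookup_sum lookup_scl)

lemma linext_add: "linext F (u + v) = linext F u + linext F v"
proof -
  let ?S = "supp u \<union> supp v"
  have "linext F (u + v) = (\<Sum>b\<in>?S. scl (coeff (u + v) b) (F b))"
    by (rule linext_superset) (simp_all add: keys_add)
  also have "\<dots> = linext F u + linext F v"
    by (simp add: linext_superset[of ?S] lookup_add lin.scale_left_distrib sum.distrib)
  finally show ?thesis .
qed

lemma linext_scl: "linext F (scl c u) = scl c (linext F u)"
proof -
  have "linext F (scl c u) =
      (\<Sum>b\<in>supp u. scl (coeff (scl c u) b) (F b))"
    by (rule linext_superset) (auto simp: in_keys_iff lookup_scl)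
  then show ?thesis by (simp add: linext_def lookup_scl lin.scale_sum_right)
qed

lemma linext_zero [simp]: "linext F 0 = 0"
  by (simp add: linext_def)

lemma linext_single: "linext F (Poly_Mapping.single b a) = scl a (F b)"
  by (cases "a = 0") (simp_all add: linext_def)

lemma linext_bvec [simp]: "linext F (bvec b) = F b"
  by (simp add: linext_single)

lemma linext_sum: "linext F (sum g I) = (\<Sum>i\<in>I. linext F (g i))"
  by (induction I rule: infinite_finite_induct) (simp_all add: linext_add)

lemma linext_cong:
  "(\<And>b. b \<in> supp u \<Longrightarrow> F b = F' b) \<Longrightarrow> linext F u = linext F' u"
  by (simp add: linext_def)

lemma linext_linext: "linext F (linext F' u) = linext (\<lambda>b. linext F (F' b)) u"
  unfolding linext_def[of F' u] linext_def[of _ u] by (simp add: linext_sum linext_scl)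

lemma linext_bvec_id: "linext bvec u = u"
proof (rule poly_mapping_eqI)
  fix c
  have "coeff (linext bvec u) c =
      (\<Sum>b\<in>supp u. if b = c then coeff u b else 0)"
    unfolding lookup_linext by (rule sum.cong) (auto simp: lookup_single when_def)
  then show "coeff (linext bvec u) c = coeff u c"
    by (simp add: sum.delta' in_keys_iff)
qed

lemma scl_single: "scl c (Poly_Mapping.single b a) = Poly_Mapping.single b (c * a)"
  by (rule poly_mapping_eqI) (simp add: lookup_scl lookup_single when_def)

lemma reindex_add: "reindex \<phi> (u + v) = reindex \<phi> u + reindex \<phi> v"
  and reindex_scl: "reindex \<phi> (scl c u) = scl c (reindex \<phi> u)"
  and reindex_zero [simp]: "reindex \<phi> 0 = 0"
  and reindex_bvec [simp]: "reindex \<phi> (bvec b) = bvec (\<phi> b)"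
  and reindex_sum: "reindex \<phi> (sum g I) = (\<Sum>i\<in>I. reindex \<phi> (g i))"
  by (simp_all add: reindex_def linext_add linext_scl linext_sum)

lemma reindex_cong:
  "(\<And>b. b \<in> supp u \<Longrightarrow> \<phi> b = \<chi> b) \<Longrightarrow> reindex \<phi> u = reindex \<chi> u"
  unfolding reindex_def by (rule linext_cong) simp

lemma reindex_reindex: "reindex \<phi> (reindex \<chi> u) = reindex (\<lambda>b. \<phi> (\<chi> b)) u"
  by (simp add: reindex_def linext_linext)

lemma reindex_ident:
  "(\<And>b. b \<in> supp u \<Longrightarrow> \<phi> b = b) \<Longrightarrow> reindex \<phi> u = u"
  using reindex_cong[of u \<phi> "\<lambda>b. b"] by (simp add: reindex_def linext_bvec_id)

lemma lookup_reindex: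
  "coeff (reindex \<phi> u) c =
    (\<Sum>b\<in>{b \<in> supp u. \<phi> b = c}. coeff u b)"
  by (simp add: reindex_def lookup_linext lookup_single when_def if_distrib sum.If_cases
      Int_def cong: if_cong)

lemma keys_reindex: "supp (reindex \<phi> u) \<subseteq> \<phi> ` supp u"
proof
  fix c assume "c \<in> supp (reindex \<phi> u)"
  then have "{b \<in> supp u. \<phi> b = c} \<noteq> {}"
    unfolding in_keys_iff lookup_reindex by (metis sum.empty)
  then show "c \<in> \<phi> ` supp u" by auto
qed

lemma lookup_reindex_inj:
  assumes "inj_on \<phi> S" "supp u \<subseteq> S" "b \<in> S"
  shows "coeff (reindex \<phi> u) (\<phi> b) = coeff u b"
proof (cases "b \<in> supp u")
  case True
  then have "{b' \<in> supp u. \<phi> b' = \<phi> b} = {b}"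
    using assms by (auto dest: inj_onD)
  then show ?thesis by (simp add: lookup_reindex)
next
  case False
  then have "{b' \<in> supp u. \<phi> b' = \<phi> b} = {}"
    using assms by (auto dest: inj_onD)
  with False show ?thesis by (simp only: lookup_reindex sum.empty) (simp add: in_keys_iff)
qed

lemma keys_reindex_inj:
  assumes "inj_on \<phi> (supp u)"
  shows "supp (reindex \<phi> u) = \<phi> ` supp u"
proof
  show "\<phi> ` supp u \<subseteq> supp (reindex \<phi> u)"
    using lookup_reindex_inj[OF assms subset_refl] by (auto simp: in_keys_iff)
qed (rule keys_reindex)

lemma lookup_tens [simp]:
  "coeff (tens u w) (b, c) = coeff u b * coeff w c"
proof -
  have "coeff (tens u w) (b, c) =
    (\<Sum>b'\<in>supp u. \<Sum>c'\<in>supp w.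
       if c' = c then (if b' = b then coeff u b' * coeff w c' else 0) else 0)"
    by (auto simp: tens_def lookup_sum lookup_single when_def intro!: sum.cong)
  also have "\<dots> = (\<Sum>b'\<in>supp u.
      if b' = b then (if c \<in> supp w
        then coeff u b' * coeff w c else 0) else 0)"
    by (auto simp: sum.delta' sum.delta intro!: sum.cong)
  also have "\<dots> = coeff u b * coeff w c"
    by (auto simp: sum.delta in_keys_iff)
  finally show ?thesis .
qed

lemma poly_mapping_eq2I:
  "(\<And>b c. coeff z (b, c) = coeff z' (b, c)) \<Longrightarrow> z = z'"
  by (rule poly_mapping_eqI) auto

lemma tens_add_left: "tens (u + u') w = tens u w + tens u' w"
  and tens_add_right: "tens u (w + w') = tens u w + tens u w'"
  and tens_scl_left: "tens (scl c u) w = scl c (tens u w)"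
  and tens_scl_right: "tens u (scl c w) = scl c (tens u w)"
  and tens_zero [simp]: "tens 0 w = 0" "tens u 0 = 0"
  by (rule poly_mapping_eq2I; simp add: lookup_add lookup_scl algebra_simps)+

lemma tens_sum_left: "tens (sum g I) w = (\<Sum>i\<in>I. tens (g i) w)"
  by (induction I rule: infinite_finite_induct) (simp_all add: tens_add_left)

lemma tens_sum_right: "tens u (sum g I) = (\<Sum>i\<in>I. tens u (g i))"
  by (induction I rule: infinite_finite_induct) (simp_all add: tens_add_right)

lemma tens_bvec [simp]: "tens (bvec b) (bvec c) = bvec (b, c)"
  by (rule poly_mapping_eq2I) (auto simp: lookup_single when_def)

lemma keys_tens: "supp (tens u w) = supp u \<times> supp w"
  by (auto simp: in_keys_iff)

lemma bvec_expand: "u = (\<Sum>b\<in>supp u. scl (coeff u b) (bvec b))"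
  using linext_bvec_id[of u] by (simp add: linext_def)

lemma linext_tens: "linext F (tens u w) = linext (\<lambda>b. linext (\<lambda>c. F (b, c)) w) u"
proof -
  have "linext F (tens u w) = (\<Sum>(b,c)\<in>supp u \<times> supp w.
      scl (coeff u b * coeff w c) (F (b, c)))"
    by (subst linext_superset[of "supp u \<times> supp w"])
       (auto simp: keys_tens case_prod_beta intro!: sum.cong)
  also have "\<dots> = linext (\<lambda>b. linext (\<lambda>c. F (b, c)) w) u"
    by (simp add: sum.cartesian_product[symmetric] linext_def lin.scale_sum_right)
  finally show ?thesis .
qed

lemma linext_tens_right: "tens u (linext F w) = linext (\<lambda>c. tens u (F c)) w"
  by (simp add: linext_def tens_sum_right tens_scl_right)

lemma linext_tens_left: "tens (linext F u) w = linext (\<lambda>c. tens (F c) w) u"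
  by (simp add: linext_def tens_sum_left tens_scl_left)

lemma reindex_tens:
  "reindex (\<lambda>(b, c). (\<phi> b, \<chi> c)) (tens u w) = tens (reindex \<phi> u) (reindex \<chi> w)"
proof -
  have "tens (reindex \<phi> u) (reindex \<chi> w) =
      linext (\<lambda>b. linext (\<lambda>c. tens (bvec (\<phi> b)) (bvec (\<chi> c))) w) u"
    unfolding reindex_def linext_tens_left by (simp add: linext_tens_right)
  then show ?thesis by (simp add: reindex_def linext_tens)
qed

lemma reindex_tens_bvec_left: "reindex \<phi> (tens (bvec g) w) = reindex (\<lambda>c. \<phi> (g, c)) w"
  by (simp add: reindex_def linext_tens)

lemma reindex_tens_bvec_right: "reindex \<phi> (tens u (bvec g)) = reindex (\<lambda>c. \<phi> (c, g)) u"
  by (simp add: reindex_def linext_tens)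

lemma lookup_map_key: "inj k \<Longrightarrow> coeff (Poly_Mapping.map_key k z) b = coeff z (k b)"
  by (simp add: map_key.rep_eq)

lemma lookup_rsec [simp]: "coeff (rsec z b) c = coeff z (b, c)"
  by (simp add: rsec_def lookup_map_key inj_def)

lemma lookup_lsec [simp]: "coeff (lsec z c) b = coeff z (b, c)"
  by (simp add: lsec_def lookup_map_key inj_def)

lemma rsec_add: "rsec (z + z') b = rsec z b + rsec z' b"
  and rsec_scl: "rsec (scl a z) b = scl a (rsec z b)"
  and rsec_zero [simp]: "rsec 0 b = 0"
  and lsec_add: "lsec (y + y') c = lsec y c + lsec y' c"
  and lsec_scl: "lsec (scl a y) c = scl a (lsec y c)"
  and lsec_zero [simp]: "lsec 0 c = 0"
  by (rule poly_mapping_eqI; simp add: lookup_add lookup_scl)+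

lemma rsec_tens [simp]: "rsec (tens u w) b = scl (coeff u b) w"
  and lsec_tens [simp]: "lsec (tens u w) c = scl (coeff w c) u"
  by (rule poly_mapping_eqI; simp add: lookup_scl)+

lemma rsec_eq_zero: "b \<notin> fst ` supp z \<Longrightarrow> rsec z b = 0"
  by (rule poly_mapping_eqI) (metis fst_conv image_eqI in_keys_iff lookup_rsec lookup_zero)

lemma lsec_eq_zero: "c \<notin> snd ` supp z \<Longrightarrow> lsec z c = 0"
  by (rule poly_mapping_eqI) (metis snd_conv image_eqI in_keys_iff lookup_lsec lookup_zero)

lemma rsec_expand: "z = (\<Sum>b\<in>fst ` supp z. tens (bvec b) (rsec z b))"
proof (rule poly_mapping_eq2I)
  fix b c
  have "coeff z (b, c) = (if b \<in> fst ` supp z then coeff z (b, c) else 0)"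
    by (auto simp: image_iff) (metis in_keys_iff fst_conv snd_conv)
  then show "coeff z (b, c) =
     coeff (\<Sum>b\<in>fst ` supp z. tens (bvec b) (rsec z b)) (b, c)"
    by (simp add: lookup_sum lookup_single when_def if_distrib[where f = "\<lambda>x. x * _"] sum.delta'
        cong: if_cong)
qed

lemma lsec_expand: "z = (\<Sum>c\<in>snd ` supp z. tens (lsec z c) (bvec c))"
proof (rule poly_mapping_eq2I)
  fix b c
  have "coeff z (b, c) = (if c \<in> snd ` supp z then coeff z (b, c) else 0)"
    by (auto simp: image_iff) (metis in_keys_iff fst_conv snd_conv)
  then show "coeff z (b, c) =
     coeff (\<Sum>c\<in>snd ` supp z. tens (lsec z c) (bvec c)) (b, c)"
    by (simp add: lookup_sum lookup_single when_def if_distrib[where f = "\<lambda>x. _ * x"] sum.delta'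
        cong: if_cong)
qed

text \<open>
  The rows of \<open>(id \<otimes> g) z\<close> are the images under \<open>g\<close> of the rows of \<open>z\<close>.  The defining sum omits the rows
  on which \<open>z\<close> vanishes; they are covered by \<open>g 0 = 0\<close>.  Nearly all computations with \<open>rmap\<close> and \<open>lmap\<close>
  reduce to this formula and its mirror image.
\<close>

lemma lookup_rmap:
  assumes "g 0 = 0"
  shows "coeff (rmap g z) (b, d) = coeff (g (rsec z b)) d"
proof (cases "b \<in> fst ` supp z")
  case True
  then show ?thesis
    by (simp add: rmap_def lookup_sum lookup_single when_def if_distrib[where f = "\<lambda>x. x * _"]
        sum.delta' cong: if_cong)
next
  case False
  then have "coeff (rmap g z) (b, d) = 0"
    by (force simp: rmap_def lookup_sum lookup_single when_def intro!: sum.neutral)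
  with rsec_eq_zero[OF False] assms show ?thesis by (simp del: lookup_rsec)
qed

lemma lookup_lmap:
  assumes "f 0 = 0"
  shows "coeff (lmap f z) (d, c) = coeff (f (lsec z c)) d"
proof (cases "c \<in> snd ` supp z")
  case True
  then show ?thesis
    by (simp add: lmap_def lookup_sum lookup_single when_def if_distrib[where f = "\<lambda>x. _ * x"]
        sum.delta' cong: if_cong)
next
  case False
  then have "coeff (lmap f z) (d, c) = 0"
    by (force simp: lmap_def lookup_sum lookup_single when_def intro!: sum.neutral)
  with lsec_eq_zero[OF False] assms show ?thesis by (simp del: lookup_lsec)
qed

lemma rsec_rmap: "g 0 = 0 \<Longrightarrow> rsec (rmap g z) b = g (rsec z b)"
  by (rule poly_mapping_eqI) (simp add: lookup_rmap)

lemma lsec_lmap: "f 0 = 0 \<Longrightarrow> lsec (lmap f z) c = f (lsec z c)"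
  by (rule poly_mapping_eqI) (simp add: lookup_lmap)

lemma rsec_eqI: "(\<And>b. rsec z b = rsec z' b) \<Longrightarrow> z = z'"
  by (rule poly_mapping_eq2I) (metis lookup_rsec)

lemma lsec_eqI: "(\<And>c. lsec z c = lsec z' c) \<Longrightarrow> z = z'"
  by (rule poly_mapping_eq2I) (metis lookup_lsec)

lemma rmap_cong:
  "(\<And>b. b \<in> fst ` supp z \<Longrightarrow> g (rsec z b) = g' (rsec z b)) \<Longrightarrow> rmap g z = rmap g' z"
  unfolding rmap_def by (rule sum.cong) auto

lemma lmap_cong:
  "(\<And>c. c \<in> snd ` supp z \<Longrightarrow> f (lsec z c) = f' (lsec z c)) \<Longrightarrow> lmap f z = lmap f' z"
  unfolding lmap_def by (rule sum.cong) auto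

lemma linear_on_add: "linear_on U f \<Longrightarrow> x \<in> U \<Longrightarrow> y \<in> U \<Longrightarrow> f (x + y) = f x + f y"
  and linear_on_scl: "linear_on U f \<Longrightarrow> x \<in> U \<Longrightarrow> f (scl c x) = scl c (f x)"
  by (auto simp: linear_on_def)

lemma linear_on_zero: "linear_on U f \<Longrightarrow> lin.subspace U \<Longrightarrow> f 0 = 0"
  using linear_on_scl[of U f 0 0] by (simp add: lin.subspace_0)

lemma linear_on_subset: "linear_on U f \<Longrightarrow> U' \<subseteq> U \<Longrightarrow> linear_on U' f"
  by (simp add: linear_on_def subset_iff)

lemma linear_on_comp:
  "linear_on U f \<Longrightarrow> f ` U \<subseteq> U' \<Longrightarrow> linear_on U' g \<Longrightarrow> linear_on U (\<lambda>x. g (f x))"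
  by (auto simp: linear_on_def image_subset_iff)

lemma linear_on_linext: "linear_on U (linext F)"
  by (simp add: linear_on_def linext_add linext_scl)

lemma linear_on_reindex: "linear_on U (reindex \<phi>)"
  by (simp add: linear_on_def reindex_add reindex_scl)

text \<open>
  The structure maps of a Hopf algebra are linear on subspaces only, with arbitrary values elsewhere, so
  comparing linear maps on a spanning set has to be done relative to a subspace.
\<close>

lemma linear_on_span_eq:
  assumes "linear_on U f" "linear_on U g" "lin.subspace U" "B \<subseteq> U"
    and "\<And>b. b \<in> B \<Longrightarrow> f b = g b" and "x \<in> lin.span B"
  shows "f x = g x"
proof -
  have "x \<in> U \<and> f x = g x"
    using assms(6)
  proof (induction rule: lin.span_induct_alt)
    case base
    then show ?case using assms by (simp add: linear_on_zero lin.subspace_0)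
  next
    case (step c b y)
    then have "b \<in> U" "y \<in> U" "scl c b \<in> U" using assms by (auto simp: lin.subspace_scale)
    then show ?case using step assms
      by (simp add: linear_on_add[OF assms(1)] linear_on_add[OF assms(2)]
          linear_on_scl[OF assms(1)] linear_on_scl[OF assms(2)] lin.subspace_add)
  qed
  then show ?thesis ..
qed

lemma subspace_free [simp]:
  fixes S :: "'b set"
  shows "lin.subspace (free S :: ('b \<Rightarrow>\<^sub>0 'k::field) set)"
proof (rule lin.subspaceI)
  fix x y :: "'b \<Rightarrow>\<^sub>0 'k" assume "x \<in> free S" "y \<in> free S"
  then show "x + y \<in> free S" unfolding free_def using keys_add[of x y] by blast
qed (auto simp: free_def in_keys_iff lookup_scl)

lemma bvec_in_free [simp]: "bvec b \<in> free S \<longleftrightarrow> b \<in> S"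
  by (simp add: free_def)

lemma free_eq_span:
  fixes S :: "'b set"
  shows "(free S :: ('b \<Rightarrow>\<^sub>0 'k::field) set) = lin.span (bvec ` S)" (is "?F = ?S")
proof
  show "?F \<subseteq> ?S"
  proof
    fix u assume "u \<in> ?F"
    then have "(\<Sum>b\<in>supp u. scl (coeff u b) (bvec b)) \<in> ?S"
      by (intro lin.span_sum lin.span_scale lin.span_base) (auto simp: free_def)
    then show "u \<in> ?S" by (simp only: bvec_expand[symmetric])
  qed
  show "?S \<subseteq> ?F"
    by (rule lin.span_minimal) auto
qed

lemma linear_on_free_eq:
  assumes "linear_on (free S) f" "linear_on (free S) g"
    and "\<And>b. b \<in> S \<Longrightarrow> f (bvec b) = g (bvec b)" and "x \<in> free S"
  shows "f x = g x"
  by (rule linear_on_span_eq[of "free S" f g "bvec ` S"])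
     (use assms in \<open>auto simp: free_eq_span[symmetric]\<close>)

lemma subspace_tensor [simp]: "lin.subspace (tensor U W)"
  by (simp add: tensor_def)

lemma tens_in_tensor: "u \<in> U \<Longrightarrow> w \<in> W \<Longrightarrow> tens u w \<in> tensor U W"
  unfolding tensor_def by (rule lin.span_base) auto

lemma tensor_mono: "U \<subseteq> U' \<Longrightarrow> W \<subseteq> W' \<Longrightarrow> tensor U W \<subseteq> tensor U' W'"
  unfolding tensor_def by (rule lin.span_mono) auto

lemma tensor_least:
  assumes "lin.subspace Z" "\<And>u w. u \<in> U \<Longrightarrow> w \<in> W \<Longrightarrow> tens u w \<in> Z"
  shows "tensor U W \<subseteq> Z"
  unfolding tensor_def by (rule lin.span_minimal) (use assms in auto)

lemma subspace_rsec: "lin.subspace W \<Longrightarrow> lin.subspace {z. \<forall>b. rsec z b \<in> W}"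
  by (rule lin.subspaceI) (auto simp: rsec_add rsec_scl lin.subspace_add lin.subspace_scale lin.subspace_0)

lemma subspace_lsec: "lin.subspace U \<Longrightarrow> lin.subspace {z. \<forall>c. lsec z c \<in> U}"
  by (rule lin.subspaceI) (auto simp: lsec_add lsec_scl lin.subspace_add lin.subspace_scale lin.subspace_0)

lemma rsec_in: "z \<in> tensor U W \<Longrightarrow> lin.subspace W \<Longrightarrow> rsec z b \<in> W"
  using tensor_least[of "{z. \<forall>b. rsec z b \<in> W}" U W]
  by (auto simp: subspace_rsec lin.subspace_scale)

lemma lsec_in: "z \<in> tensor U W \<Longrightarrow> lin.subspace U \<Longrightarrow> lsec z c \<in> U"
  using tensor_least[of "{z. \<forall>c. lsec z c \<in> U}" U W]
  by (auto simp: subspace_lsec lin.subspace_scale)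

text \<open>
  When one factor is spanned by basis vectors, \<open>z\<close> is the sum of the \<open>lsec z c \<otimes> c\<close>, so its columns
  decide whether it lies in the tensor product.
\<close>

lemma tensor_free_right_iff:
  assumes "lin.subspace U"
  shows "z \<in> tensor U (free S) \<longleftrightarrow> snd ` supp z \<subseteq> S \<and> (\<forall>c. lsec z c \<in> U)"
proof safe
  assume z: "z \<in> tensor U (free S)"
  show "lsec z c \<in> U" for c using lsec_in[OF z assms] .
  fix b c assume "(b, c) \<in> supp z"
  then have "c \<in> supp (rsec z b)" by (simp add: in_keys_iff)
  then show "snd (b, c) \<in> S" using rsec_in[OF z subspace_free, of b] by (auto simp: free_def)
next
  assume "snd ` supp z \<subseteq> S" "\<forall>c. lsec z c \<in> U"
  then have "(\<Sum>c\<in>snd ` supp z. tens (lsec z c) (bvec c)) \<in> tensor U (free S)"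
    by (intro lin.subspace_sum subspace_tensor tens_in_tensor) auto
  then show "z \<in> tensor U (free S)" by (simp only: lsec_expand[symmetric])
qed

lemma tensor_free_left_iff:
  assumes "lin.subspace W"
  shows "z \<in> tensor (free S) W \<longleftrightarrow> fst ` supp z \<subseteq> S \<and> (\<forall>b. rsec z b \<in> W)"
proof safe
  assume z: "z \<in> tensor (free S) W"
  show "rsec z b \<in> W" for b using rsec_in[OF z assms] .
  fix b c assume "(b, c) \<in> supp z"
  then have "b \<in> supp (lsec z c)" by (simp add: in_keys_iff)
  then show "fst (b, c) \<in> S" using lsec_in[OF z subspace_free, of c] by (auto simp: free_def)
next
  assume "fst ` supp z \<subseteq> S" "\<forall>b. rsec z b \<in> W"
  then have "(\<Sum>b\<in>fst ` supp z. tens (bvec b) (rsec z b)) \<in> tensor (free S) W"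
    by (intro lin.subspace_sum subspace_tensor tens_in_tensor) auto
  then show "z \<in> tensor (free S) W" by (simp only: rsec_expand[symmetric])
qed

lemma linear_on_tensor_eq:
  assumes "linear_on (tensor U W) f" "linear_on (tensor U W) g"
    and "\<And>u w. u \<in> U \<Longrightarrow> w \<in> W \<Longrightarrow> f (tens u w) = g (tens u w)" and "z \<in> tensor U W"
  shows "f z = g z"
  by (rule linear_on_span_eq[OF assms(1,2) subspace_tensor, of "{tens u w |u w. u \<in> U \<and> w \<in> W}"])
     (use assms(3,4) in \<open>auto simp: tensor_def[symmetric] intro: tens_in_tensor\<close>)

lemma linear_on_tensor_image:
  assumes "linear_on (tensor U W) f" "lin.subspace Z"
    and "\<And>u w. u \<in> U \<Longrightarrow> w \<in> W \<Longrightarrow> f (tens u w) \<in> Z"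
  shows "f ` tensor U W \<subseteq> Z"
proof -
  have "lin.subspace {z \<in> tensor U W. f z \<in> Z}"
    using assms(2) linear_on_zero[OF assms(1) subspace_tensor]
    by (intro lin.subspaceI)
      (auto simp: linear_on_add[OF assms(1)] linear_on_scl[OF assms(1)] lin.subspace_add
        lin.subspace_scale lin.subspace_0)
  then have "tensor U W \<subseteq> {z \<in> tensor U W. f z \<in> Z}"
    by (rule tensor_least) (use assms(3) tens_in_tensor in auto)
  then show ?thesis by auto
qed

lemma rmap_tens: "linear_on W g \<Longrightarrow> lin.subspace W \<Longrightarrow> w \<in> W \<Longrightarrow> rmap g (tens u w) = tens u (g w)"
  by (rule rsec_eqI) (simp add: rsec_rmap linear_on_zero linear_on_scl[of W])

lemma lmap_tens: "linear_on U f \<Longrightarrow> lin.subspace U \<Longrightarrow> u \<in> U \<Longrightarrow> lmap f (tens u w) = tens (f u) w"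
  by (rule lsec_eqI) (simp add: lsec_lmap linear_on_zero linear_on_scl[of U])

lemma linear_on_rmap:
  assumes "linear_on W g" "lin.subspace W"
  shows "linear_on (tensor U W) (rmap g)"
proof -
  note 0 = linear_on_zero[OF assms]
  show ?thesis unfolding linear_on_def
    by (auto intro!: rsec_eqI simp: rsec_rmap 0 rsec_add rsec_scl linear_on_add[OF assms(1)]
        linear_on_scl[OF assms(1)] rsec_in[OF _ assms(2)])
qed

lemma linear_on_lmap:
  assumes "linear_on U f" "lin.subspace U"
  shows "linear_on (tensor U W) (lmap f)"
proof -
  note 0 = linear_on_zero[OF assms]
  show ?thesis unfolding linear_on_def
    by (auto intro!: lsec_eqI simp: lsec_lmap 0 lsec_add lsec_scl linear_on_add[OF assms(1)]
        linear_on_scl[OF assms(1)] lsec_in[OF _ assms(2)])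
qed

lemma rmap_in:
  assumes "linear_on W g" "lin.subspace W" "g ` W \<subseteq> W'" "z \<in> tensor U W"
  shows "rmap g z \<in> tensor U W'"
  using linear_on_tensor_image[OF linear_on_rmap[OF assms(1,2)], of "tensor U W'" U] assms
  by (fastforce simp: rmap_tens[OF assms(1,2)] intro: tens_in_tensor)

lemma lmap_in:
  assumes "linear_on U f" "lin.subspace U" "f ` U \<subseteq> U'" "z \<in> tensor U W"
  shows "lmap f z \<in> tensor U' W"
  using linear_on_tensor_image[OF linear_on_lmap[OF assms(1,2)], of "tensor U' W" W] assms
  by (fastforce simp: lmap_tens[OF assms(1,2)] intro: tens_in_tensor)

lemma linear_on_tmap:
  assumes "linear_on U f" "lin.subspace U" "linear_on W g" "lin.subspace W"
  shows "linear_on (tensor U W) (tmap f g)"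
  unfolding tmap_def
  by (rule linear_on_comp[OF linear_on_rmap[OF assms(3,4)] _ linear_on_lmap[OF assms(1,2)]])
     (use rmap_in[OF assms(3,4) subset_UNIV] in auto)

lemma tmap_tens:
  assumes "linear_on U f" "lin.subspace U" "linear_on W g" "lin.subspace W" "u \<in> U" "w \<in> W"
  shows "tmap f g (tens u w) = tens (f u) (g w)"
  using assms by (simp add: tmap_def rmap_tens[of W] lmap_tens[of U])

lemma tmap_in:
  assumes "linear_on U f" "lin.subspace U" "linear_on W g" "lin.subspace W"
    and "f ` U \<subseteq> U'" "g ` W \<subseteq> W'" "z \<in> tensor U W"
  shows "tmap f g z \<in> tensor U' W'"
  unfolding tmap_def by (intro lmap_in[OF assms(1,2,5)] rmap_in[OF assms(3,4,6,7)])

text \<open>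
  The map \<open>f\<close> is applied to columns of \<open>(id \<otimes> g) z\<close> rather than of \<open>z\<close>; these still lie in \<open>U\<close> because
  \<open>id \<otimes> g\<close> does not touch the first factor.
\<close>

lemma tmap_cong:
  assumes "z \<in> tensor U W" "lin.subspace U" "lin.subspace W" "linear_on W g" "linear_on U f"
    and "\<And>u. u \<in> U \<Longrightarrow> f u = f' u" "\<And>w. w \<in> W \<Longrightarrow> g w = g' w"
  shows "tmap f g z = tmap f' g' z"
proof -
  have "rmap g z = rmap g' z" by (rule rmap_cong) (rule assms(7)[OF rsec_in[OF assms(1,3)]])
  moreover have "lmap f (rmap g z) = lmap f' (rmap g z)"
  proof (rule lmap_cong)
    fix c
    have "rmap g z \<in> tensor U UNIV" by (rule rmap_in[OF assms(4,3)]) (use assms(1) in auto)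
    then show "f (lsec (rmap g z) c) = f' (lsec (rmap g z) c)" by (intro assms(6) lsec_in[OF _ assms(2)])
  qed
  ultimately show ?thesis by (simp add: tmap_def)
qed

text \<open>
  A relabelling is linear everywhere, so here, and in \<open>lmap_reindex\<close>, both sides may be compared on all
  basis vectors without keeping track of subspaces.
\<close>

lemma rmap_reindex:
  fixes z :: "('a \<times> 'b) \<Rightarrow>\<^sub>0 'k::field" and \<phi> :: "'b \<Rightarrow> 'c"
  shows "rmap (reindex \<phi>) z = reindex (\<lambda>(b, c). (b, \<phi> c)) z"
proof (rule linear_on_free_eq[where S = UNIV and f = "rmap (reindex \<phi>)" and x = z])
  show "linear_on (free UNIV) (rmap (reindex \<phi>) :: (('a \<times> 'b) \<Rightarrow>\<^sub>0 'k) \<Rightarrow> (('a \<times> 'c) \<Rightarrow>\<^sub>0 'k))"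
    using linear_on_zero[OF linear_on_reindex, of UNIV \<phi>]
    unfolding linear_on_def by (auto intro!: rsec_eqI simp: rsec_rmap rsec_add rsec_scl reindex_add reindex_scl)
  show "(rmap (reindex \<phi>) :: (('a \<times> 'b) \<Rightarrow>\<^sub>0 'k) \<Rightarrow> (('a \<times> 'c) \<Rightarrow>\<^sub>0 'k)) (bvec b) = reindex (\<lambda>(b, c). (b, \<phi> c)) (bvec b)" for b
    using rmap_tens[OF linear_on_reindex, of UNIV "bvec (snd b)" \<phi> "bvec (fst b)"]
    by (simp add: case_prod_beta)
qed (simp_all add: linear_on_reindex free_def)

lemma lmap_reindex:
  fixes z :: "('a \<times> 'b) \<Rightarrow>\<^sub>0 'k::field" and \<phi> :: "'a \<Rightarrow> 'c"
  shows "lmap (reindex \<phi>) z = reindex (\<lambda>(b, c). (\<phi> b, c)) z"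
proof (rule linear_on_free_eq[where S = UNIV and f = "lmap (reindex \<phi>)" and x = z])
  show "linear_on (free UNIV) (lmap (reindex \<phi>) :: (('a \<times> 'b) \<Rightarrow>\<^sub>0 'k) \<Rightarrow> (('c \<times> 'b) \<Rightarrow>\<^sub>0 'k))"
    using linear_on_zero[OF linear_on_reindex, of UNIV \<phi>]
    unfolding linear_on_def by (auto intro!: lsec_eqI simp: lsec_lmap lsec_add lsec_scl reindex_add reindex_scl)
  show "(lmap (reindex \<phi>) :: (('a \<times> 'b) \<Rightarrow>\<^sub>0 'k) \<Rightarrow> (('c \<times> 'b) \<Rightarrow>\<^sub>0 'k)) (bvec b) = reindex (\<lambda>(b, c). (\<phi> b, c)) (bvec b)" for b
    using lmap_tens[OF linear_on_reindex, of UNIV "bvec (fst b)" \<phi> "bvec (snd b)"]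
    by (simp add: case_prod_beta)
qed (simp_all add: linear_on_reindex free_def)

lemma tmap_reindex: "tmap (reindex \<phi>) (reindex \<chi>) z = reindex (\<lambda>(b, c). (\<phi> b, \<chi> c)) z"
  by (simp add: tmap_def rmap_reindex lmap_reindex reindex_reindex case_prod_beta')

lemma module_hom_reindex: "module_hom scl scl (reindex \<phi>)"
  by unfold_locales (simp_all add: reindex_add reindex_scl)

lemma span_reindex_image: "lin.span (reindex \<phi> ` S) = reindex \<phi> ` lin.span S"
  by (rule module_hom.span_image[OF module_hom_reindex])

lemma subspace_reindex_image: "lin.subspace S \<Longrightarrow> lin.subspace (reindex \<phi> ` S)"
  by (rule module_hom.subspace_image[OF module_hom_reindex])

lemma tensor_reindex_image:
  "tensor (reindex \<phi> ` U) (reindex \<chi> ` W) = reindex (\<lambda>(b, c). (\<phi> b, \<chi> c)) ` tensor U W"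
proof -
  have pure: "{tens u w |u w. u \<in> A \<and> w \<in> B} = (\<lambda>(u, w). tens u w) ` (A \<times> B)" for A B
    by auto
  have "(\<lambda>(u, w). tens u w) ` (reindex \<phi> ` U \<times> reindex \<chi> ` W) =
      reindex (\<lambda>(b, c). (\<phi> b, \<chi> c)) ` (\<lambda>(u, w). tens u w) ` (U \<times> W)"
    by (simp add: image_image reindex_tens[unfolded case_prod_beta'] case_prod_beta' map_prod_surj_on[OF refl refl, symmetric]
        image_paired_Times[symmetric])
  then show ?thesis by (simp add: tensor_def pure span_reindex_image)
qed

section \<open>Path lengths in Nichols algebras\<close>

lemma linext_in:
  "lin.subspace Z \<Longrightarrow> (\<And>b. b \<in> S \<Longrightarrow> F b \<in> Z) \<Longrightarrow> u \<in> free S \<Longrightarrow> linext F u \<in> Z"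
  unfolding linext_def by (rule lin.subspace_sum) (auto simp: free_def lin.subspace_scale)

lemma reindex_in_free: "(\<And>b. b \<in> S \<Longrightarrow> \<phi> b \<in> S') \<Longrightarrow> u \<in> free S \<Longrightarrow> reindex \<phi> u \<in> free S'"
  unfolding reindex_def by (rule linext_in) auto

lemma tens_in_free: "u \<in> free S \<Longrightarrow> w \<in> free S' \<Longrightarrow> tens u w \<in> free (S \<times> S')"
  by (auto simp: free_def keys_tens)

text \<open>
  The permutation that a word expresses in the definition of \<open>reduced_word\<close>.
\<close>

definition transpose_word :: "nat list \<Rightarrow> nat \<Rightarrow> nat"
  where "transpose_word is = foldr (\<lambda>i \<tau>. transpose i (i + 1) \<circ> \<tau>) is id"

lemma transpose_word_append: "transpose_word (is @ js) = transpose_word is \<circ> transpose_word js"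
  by (induction "is") (simp_all add: transpose_word_def comp_assoc)

text \<open>
  By induction on \<open>b\<close>: conjugating \<open>(a b)\<close> with \<open>(b b+1)\<close> gives \<open>(a b+1)\<close>.
\<close>

lemma transpose_is_word:
  "a < b \<Longrightarrow> b < n \<Longrightarrow> \<exists>is. (\<forall>i\<in>set is. i + 1 < n) \<and> transpose_word is = transpose a b"
proof (induction b)
  case (Suc b)
  show ?case
  proof (cases "a = b")
    case True
    then show ?thesis using Suc.prems by (intro exI[of _ "[b]"]) (simp add: transpose_word_def)
  next
    case False
    then obtain js where js: "\<forall>i\<in>set js. i + 1 < n" "transpose_word js = transpose a b"
      using Suc by auto
    have "transpose b (Suc b) \<circ> transpose a b \<circ> transpose b (Suc b) = transpose a (Suc b)"
      using False Suc.prems by (auto simp: fun_eq_iff transpose_def)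
    then have "transpose_word ([b] @ js @ [b]) = transpose a (Suc b)"
      unfolding transpose_word_append js(2) by (simp add: transpose_word_def comp_assoc)
    then show ?thesis using js(1) Suc.prems by (intro exI[of _ "[b] @ js @ [b]"]) auto
  qed
qed simp

lemma permutation_is_word:
  assumes "\<sigma> permutes {..<n::nat}"
  shows "\<exists>is. (\<forall>i\<in>set is. i + 1 < n) \<and> transpose_word is = \<sigma>"
  using assms finite_lessThan
proof (induction rule: permutes_induct)
  case id
  then show ?case by (intro exI[of _ "[]"]) (simp add: transpose_word_def)
next
  case (swap a b p)
  obtain "is" where "\<forall>i\<in>set is. i + 1 < n" "transpose_word is = transpose a b"
    using transpose_is_word[of a b n] transpose_is_word[of b a n] swap
    by (metis lessThan_iff nat_neq_iff transpose_commute)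
  moreover obtain js where "\<forall>i\<in>set js. i + 1 < n" "transpose_word js = p"
    using swap by blast
  ultimately show ?case by (intro exI[of _ "is @ js"]) (auto simp: transpose_word_append)
qed

text \<open>
  The reduced word is a shortest word for \<open>\<sigma>\<close>.  It inherits the bound on its letters only because there is
  some word for \<open>\<sigma>\<close> at all, that is, because adjacent transpositions generate the symmetric group.
\<close>

lemma reduced_word_bound:
  assumes "\<sigma> permutes {..<n}" "i \<in> set (reduced_word n \<sigma>)"
  shows "i + 1 < n"
proof -
  let ?P = "\<lambda>is. (\<forall>i\<in>set is. i + 1 < n) \<and> foldr (\<lambda>i \<tau>. transpose i (i + 1) \<circ> \<tau>) is id = \<sigma>"
  obtain "is" where "?P is" using permutation_is_word[OF assms(1)] by (auto simp: transpose_word_def)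
  then have "?P (reduced_word n \<sigma>)" unfolding reduced_word_def by (rule arg_min_natI)
  with assms(2) show ?thesis by blast
qed

lemma reduced_word_id: "reduced_word n id = []"
proof -
  let ?P = "\<lambda>is. (\<forall>i\<in>set is. i + 1 < n) \<and> foldr (\<lambda>i \<tau>. transpose i (i + 1) \<circ> \<tau>) is id = id"
  have "?P []" by simp
  then have "length (reduced_word n id) \<le> length ([] :: nat list)"
    unfolding reduced_word_def by (rule arg_min_nat_le)
  then show ?thesis by simp
qed

abbreviation paths :: "'a set \<Rightarrow> nat \<Rightarrow> 'a list set"
  where "paths X n \<equiv> {p. length p = n \<and> set p \<subseteq> X}"

text \<open>
  For \<open>i + 1 < n\<close> the letters removed by \<open>take\<close> and \<open>drop\<close> are exactly the two that are put back, so the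
  length is preserved; beyond the end of the path it would grow.
\<close>

lemma braid_at_in:
  assumes c: "\<And>x y. x \<in> X \<Longrightarrow> y \<in> X \<Longrightarrow> c (bvec (x, y)) \<in> free (X \<times> X)"
    and "i + 1 < n" "u \<in> free (paths X n)"
  shows "braid_at c i u \<in> free (paths X n)"
  unfolding braid_at_def
proof (rule linext_in[OF subspace_free _ assms(3)])
  fix p assume p: "p \<in> paths X n"
  then have "p ! i \<in> X" "p ! (i + 1) \<in> X" using assms(2) by auto
  then have "c (bvec (p ! i, p ! (i + 1))) \<in> free (X \<times> X)" by (rule c)
  then show "reindex (\<lambda>(x, y). take i p @ [x, y] @ drop (i + 2) p) (c (bvec (p ! i, p ! (i + 1))))
      \<in> free (paths X n)"
    by (rule reindex_in_free[rotated])
       (use p assms(2) in \<open>auto dest: in_set_takeD in_set_dropD\<close>)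
qed

lemma matsumoto_in:
  assumes c: "\<And>x y. x \<in> X \<Longrightarrow> y \<in> X \<Longrightarrow> c (bvec (x, y)) \<in> free (X \<times> X)"
    and "\<sigma> permutes {..<n}" "u \<in> free (paths X n)"
  shows "matsumoto c n \<sigma> u \<in> free (paths X n)"
proof -
  have "foldr (\<lambda>i T. braid_at c i \<circ> T) is id u \<in> free (paths X n)"
    if "\<forall>i\<in>set is. i + 1 < n" for "is"
    using that by (induction "is") (auto simp: assms(3) intro!: braid_at_in[where X = X and c = c, OF c])
  then show ?thesis using reduced_word_bound[OF assms(2)] by (auto simp: matsumoto_def)
qed

lemma nichols_comp_subset:
  assumes c: "\<And>x y. x \<in> X \<Longrightarrow> y \<in> X \<Longrightarrow> c (bvec (x, y)) \<in> free (X \<times> X)"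
  shows "nichols_comp c X n \<subseteq> free (paths X n)"
  by (auto simp: nichols_comp_def quantum_symmetrizer_def
      intro!: lin.subspace_sum matsumoto_in[where X = X and c = c, OF c])

lemma quantum_symmetrizer_trivial:
  assumes "n \<le> 1"
  shows "quantum_symmetrizer c n u = u"
proof -
  have "n = 0 \<or> n = 1" using assms by auto
  then have "{\<sigma>. \<sigma> permutes {..<n}} = {id}" by (auto simp: lessThan_Suc)
  then show ?thesis by (simp add: quantum_symmetrizer_def matsumoto_def reduced_word_id)
qed

text \<open>
  In degrees 0 and 1 the quantum symmetrizer is the identity, so the Nichols algebra contains the unit and
  all letters.
\<close>

lemma nichols_comp_trivial: "n \<le> 1 \<Longrightarrow> nichols_comp c X n = free (paths X n)"
  by (simp add: nichols_comp_def quantum_symmetrizer_trivial)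

lemma yd_braiding_bvec:
  assumes "linear_on (free X) d" "\<And>x. x \<in> X \<Longrightarrow> d (bvec x) = bvec (x, x)"
    and "\<And>x. x \<in> X \<Longrightarrow> linear_on (free X) (act x)" and "x \<in> X" "y \<in> X"
  shows "yd_braiding act d (bvec (x, y)) = tens (act x (bvec y)) (bvec x)"
proof -
  have 1: "lmap d (bvec (x, y)) = bvec ((x, x), y)"
    using lmap_tens[OF assms(1) subspace_free, of "bvec x" "bvec y"] assms by simp
  have inj: "inj (\<lambda>(b, c). ((x, b), c))" by (auto simp: inj_def)
  have 2: "Poly_Mapping.map_key (\<lambda>(b, c). ((x, b), c)) (bvec ((x, x), y)) = bvec (x, y)"
    by (rule poly_mapping_eq2I) (simp add: lookup_map_key[OF inj] lookup_single when_def)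
  have 3: "rmap (act x) (bvec (x, y)) = tens (bvec x) (act x (bvec y))"
    using rmap_tens[OF assms(3) subspace_free, of x "bvec y" "bvec x"] assms by simp
  show ?thesis
    by (simp add: yd_braiding_def 1 2 3 flip_def reindex_tens_bvec_left)
       (simp add: reindex_def linext_bvec_id linext_tens_left[symmetric]
         flip: tens_bvec)
qed

section \<open>Free groups and homomorphisms out of the covering group\<close>

lemma words_append [simp]: "u @ w \<in> words X \<longleftrightarrow> u \<in> words X \<and> w \<in> words X"
  by (auto simp: words_def)

lemma words_Nil [simp]: "[] \<in> words X"
  and words_Cons [simp]: "(x, e) # w \<in> words X \<longleftrightarrow> x \<in> X \<and> w \<in> words X"
  by (auto simp: words_def)

lemma equiv_word_rel: "equiv (words X) (word_rel X)"
proof (rule equivI)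
  show "word_rel X \<subseteq> words X \<times> words X" by (auto simp: word_rel_def)
  show "refl_on (words X) (word_rel X)" by (auto simp: refl_on_def word_rel_def)
  show "sym (word_rel X)"
    unfolding word_rel_def by (intro sym_Int sym_rtrancl sym_Un_converse) (auto simp: sym_def)
  show "trans (word_rel X)"
    unfolding word_rel_def by (intro trans_Int trans_rtrancl) (auto simp: trans_def)
qed

lemma word_rel_induct [consumes 1, case_names refl cancel]:
  assumes "(u, w) \<in> word_rel X" "\<And>u. P u u"
    and "\<And>u w. (u, w) \<in> cancel1 X \<Longrightarrow> P u w \<and> P w u"
    and "\<And>u v w. P u v \<Longrightarrow> P v w \<Longrightarrow> P u w"
  shows "P u w"
proof -
  have "(u, w) \<in> (cancel1 X \<union> (cancel1 X)\<inverse>)\<^sup>*" using assms(1) by (simp add: word_rel_def)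
  then show ?thesis
    by (induction rule: rtrancl_induct) (use assms in blast)+
qed

lemma cancel1_append:
  assumes "(u, w) \<in> cancel1 X" "s \<in> words X" "t \<in> words X"
  shows "(s @ u @ t, s @ w @ t) \<in> cancel1 X"
proof -
  obtain a b x e where "u = a @ [(x, e), (x, \<not> e)] @ b" "w = a @ b"
    "a \<in> words X" "b \<in> words X" "x \<in> X"
    using assms(1) by (auto simp: cancel1_def)
  then have "s @ u @ t = (s @ a) @ [(x, e), (x, \<not> e)] @ (b @ t) \<and> s @ w @ t = (s @ a) @ (b @ t) \<and>
      s @ a \<in> words X \<and> b @ t \<in> words X \<and> x \<in> X"
    using assms by simp
  then show ?thesis unfolding cancel1_def by blast
qed

lemma word_rel_append:
  assumes "(u, u') \<in> word_rel X" "(w, w') \<in> word_rel X"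
  shows "(u @ w, u' @ w') \<in> word_rel X"
proof -
  let ?R = "(cancel1 X \<union> (cancel1 X)\<inverse>)\<^sup>*"
  have W: "u \<in> words X" "u' \<in> words X" "w \<in> words X" "w' \<in> words X"
    using assms by (auto simp: word_rel_def)
  have main: "(s @ a @ t, s @ b @ t) \<in> ?R"
    if "(a, b) \<in> ?R" and s: "s \<in> words X" and t: "t \<in> words X" for a b s t
    using that(1)
  proof (induction rule: rtrancl_induct)
    case (step y z)
    then have "(s @ y @ t, s @ z @ t) \<in> cancel1 X \<union> (cancel1 X)\<inverse>"
      using cancel1_append[OF _ s t] by auto
    with step show ?case by (meson rtrancl.rtrancl_into_rtrancl)
  qed simp
  have "(u @ w, u' @ w) \<in> ?R" using main[of u u' "[]" w] assms(1) W by (auto simp: word_rel_def)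
  moreover have "(u' @ w, u' @ w') \<in> ?R" using main[of w w' u' "[]"] assms(2) W by (auto simp: word_rel_def)
  ultimately show ?thesis using W by (auto simp: word_rel_def)
qed

text \<open>
  The elements of the free group are named by representatives, so that its product becomes concatenation
  (\<open>mult_free_grp\<close>).
\<close>

definition word_class :: "'a set \<Rightarrow> ('a \<times> bool) list \<Rightarrow> ('a \<times> bool) list set"
  where "word_class X w = word_rel X `` {w}"

lemma carrier_free_grp: "carrier (free_grp X) = word_class X ` words X"
  by (auto simp: free_grp_def word_class_def quotient_def)

lemma one_free_grp: "\<one>\<^bsub>free_grp X\<^esub> = word_class X []"
  by (simp add: free_grp_def word_class_def)

lemma free_gen_class: "free_gen X x = word_class X [(x, True)]"
  by (simp add: free_gen_def word_class_def)

lemma mult_free_grp: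
  assumes "u \<in> words X" "w \<in> words X"
  shows "word_class X u \<otimes>\<^bsub>free_grp X\<^esub> word_class X w = word_class X (u @ w)"
proof -
  have "congruent2 (word_rel X) (word_rel X) (\<lambda>u w. word_rel X `` {u @ w})"
    by (auto simp: congruent2_def intro!: equiv_class_eq[OF equiv_word_rel] word_rel_append)
  then show ?thesis
    using UN_equiv_class2[OF equiv_word_rel equiv_word_rel _ assms]
    by (simp add: free_grp_def word_class_def)
qed

lemma word_class_cancel:
  assumes "x \<in> X" "w \<in> words X"
  shows "word_class X ((x, e) # (x, \<not> e) # w) = word_class X w"
proof -
  have "((x, e) # (x, \<not> e) # w, w) \<in> cancel1 X"
    unfolding cancel1_def using assms words_Nil by fastforce
  then have "((x, e) # (x, \<not> e) # w, w) \<in> word_rel X" using assms by (auto simp: word_rel_def)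
  then show ?thesis unfolding word_class_def by (rule equiv_class_eq[OF equiv_word_rel])
qed

definition word_inverse :: "('a \<times> bool) list \<Rightarrow> ('a \<times> bool) list"
  where "word_inverse w = rev (map (\<lambda>(x, e). (x, \<not> e)) w)"

lemma word_inverse_words [simp]: "word_inverse w \<in> words X \<longleftrightarrow> w \<in> words X"
  by (force simp: word_inverse_def words_def)

lemma word_class_inverse:
  "w \<in> words X \<Longrightarrow> word_class X (word_inverse w @ w) = word_class X []"
proof (induction w)
  case (Cons a w)
  obtain x e where a: "a = (x, e)" by (cases a)
  have x: "x \<in> X" and w: "w \<in> words X" using Cons.prems by (auto simp: a)
  have "word_class X (word_inverse (a # w) @ a # w) =
      word_class X (word_inverse w) \<otimes>\<^bsub>free_grp X\<^esub> word_class X ((x, \<not> e) # (x, \<not> \<not> e) # w)"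
    using x w by (simp add: mult_free_grp a) (simp add: word_inverse_def)
  also have "\<dots> = word_class X (word_inverse w @ w)"
    using x w by (simp add: word_class_cancel mult_free_grp del: not_not)
  finally show ?case using Cons.IH w by simp
qed (simp add: word_inverse_def)

lemma group_free_grp: "group (free_grp X)"
proof (rule groupI)
  fix a assume "a \<in> carrier (free_grp X)"
  then obtain w where w: "a = word_class X w" "w \<in> words X" by (auto simp: carrier_free_grp)
  then have "word_class X (word_inverse w) \<otimes>\<^bsub>free_grp X\<^esub> a = \<one>\<^bsub>free_grp X\<^esub>"
    by (simp add: mult_free_grp one_free_grp word_class_inverse)
  then show "\<exists>y\<in>carrier (free_grp X). y \<otimes>\<^bsub>free_grp X\<^esub> a = \<one>\<^bsub>free_grp X\<^esub>"
    using w by (intro bexI[of _ "word_class X (word_inverse w)"]) (auto simp: carrier_free_grp)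
qed (auto simp: carrier_free_grp mult_free_grp one_free_grp)

text \<open>
  The value of a word under \<open>x \<mapsto> \<eta> x\<close>.  Since it is \<open>word_eval\<close> after relabelling the letters, the
  functions \<open>class_value\<close> and \<open>covering_value\<close> built on it specialise for \<open>\<eta> x = x\<close> to the projection
  \<open>covering_proj\<close> of the universal covering group (\<open>covering_proj_value\<close>).
\<close>

definition word_value :: "('h, 'z) monoid_scheme \<Rightarrow> ('a \<Rightarrow> 'h) \<Rightarrow> ('a \<times> bool) list \<Rightarrow> 'h"
  where "word_value L \<eta> w = word_eval L (map (\<lambda>(x, e). (\<eta> x, e)) w)"

definition class_value :: "('h, 'z) monoid_scheme \<Rightarrow> ('a \<Rightarrow> 'h) \<Rightarrow> ('a \<times> bool) list set \<Rightarrow> 'h"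
  where "class_value L \<eta> A = the_elem (word_value L \<eta> ` A)"

definition covering_value :: "('h, 'z) monoid_scheme \<Rightarrow> ('a \<Rightarrow> 'h) \<Rightarrow> ('a \<times> bool) list set set \<Rightarrow> 'h"
  where "covering_value L \<eta> C = the_elem (class_value L \<eta> ` C)"

definition path_value :: "('h, 'z) monoid_scheme \<Rightarrow> ('a \<Rightarrow> 'h) \<Rightarrow> 'a list \<Rightarrow> 'h"
  where "path_value L \<eta> p = foldr (\<lambda>x a. \<eta> x \<otimes>\<^bsub>L\<^esub> a) p \<one>\<^bsub>L\<^esub>"

lemma path_value_simps [simp]:
  "path_value L \<eta> [] = \<one>\<^bsub>L\<^esub>"
  "path_value L \<eta> (x # p) = \<eta> x \<otimes>\<^bsub>L\<^esub> path_value L \<eta> p"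
  by (simp_all add: path_value_def)

lemma covering_proj_value: "covering_proj G = covering_value G (\<lambda>x. x)"
proof -
  have "map (\<lambda>(x, e). (x, e)) w = w" for w :: "('a \<times> bool) list"
    by (simp add: case_prod_beta')
  then show ?thesis
    by (simp add: covering_proj_def covering_value_def class_value_def word_value_def fun_eq_iff)
qed

lemma word_value_simps [simp]:
  "word_value L \<eta> [] = \<one>\<^bsub>L\<^esub>"
  "word_value L \<eta> ((x, e) # w) = (if e then \<eta> x else inv\<^bsub>L\<^esub> \<eta> x) \<otimes>\<^bsub>L\<^esub> word_value L \<eta> w"
  by (simp_all add: word_value_def word_eval_def)

context
  fixes L :: "('h, 'z) monoid_scheme" (structure) and \<eta> :: "'a \<Rightarrow> 'h" and X :: "'a set"
  assumes L: "group L" and \<eta>: "\<And>x. x \<in> X \<Longrightarrow> \<eta> x \<in> carrier L"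
begin

interpretation L: group L by (rule L)

lemma path_value_closed: "set p \<subseteq> X \<Longrightarrow> path_value L \<eta> p \<in> carrier L"
  by (induction p) (auto simp: \<eta>)

lemma word_value_closed [simp]: "w \<in> words X \<Longrightarrow> word_value L \<eta> w \<in> carrier L"
proof (induction w)
  case (Cons a w)
  then show ?case by (cases a) (auto simp: \<eta>)
qed simp

lemma word_value_append:
  "u \<in> words X \<Longrightarrow> w \<in> words X \<Longrightarrow> word_value L \<eta> (u @ w) = word_value L \<eta> u \<otimes> word_value L \<eta> w"
proof (induction u)
  case (Cons a u)
  then show ?case by (cases a) (auto simp: \<eta> L.m_assoc)
qed simp

text \<open>
  Two related words differ by a chain of cancellations, and each of them removes a factor
  \<open>\<eta> x (\<eta> x)\<inverse>\<close> or \<open>(\<eta> x)\<inverse> \<eta> x\<close>.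
\<close>

lemma word_value_cong:
  assumes "(u, w) \<in> word_rel X"
  shows "word_value L \<eta> u = word_value L \<eta> w"
  using assms
proof (induction rule: word_rel_induct)
  case (cancel u w)
  then obtain a b x e where uw: "u = a @ [(x, e), (x, \<not> e)] @ b" "w = a @ b"
    "a \<in> words X" "b \<in> words X" "x \<in> X"
    unfolding cancel1_def by blast
  have "word_value L \<eta> ([(x, e), (x, \<not> e)] @ b) = word_value L \<eta> b"
    using uw \<eta> by (cases e) (simp_all add: L.m_assoc[symmetric])
  moreover have "word_value L \<eta> u = word_value L \<eta> a \<otimes> word_value L \<eta> ([(x, e), (x, \<not> e)] @ b)"
    unfolding uw(1) by (rule word_value_append) (use uw in auto)
  moreover have "word_value L \<eta> w = word_value L \<eta> a \<otimes> word_value L \<eta> b"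
    unfolding uw(2) by (rule word_value_append) (use uw in auto)
  ultimately have "word_value L \<eta> u = word_value L \<eta> w" by simp
  then show ?case by simp
qed auto

lemma class_value_class:
  assumes "w \<in> words X"
  shows "class_value L \<eta> (word_class X w) = word_value L \<eta> w"
proof -
  have "word_value L \<eta> ` word_class X w = {word_value L \<eta> w}"
  proof
    show "word_value L \<eta> ` word_class X w \<subseteq> {word_value L \<eta> w}"
      unfolding word_class_def using word_value_cong by fastforce
    show "{word_value L \<eta> w} \<subseteq> word_value L \<eta> ` word_class X w"
      using equiv_class_self[OF equiv_word_rel assms] by (simp add: word_class_def)
  qed
  then show ?thesis by (simp add: class_value_def)
qed

lemma group_hom_class_value: "group_hom (free_grp X) L (class_value L \<eta>)"
  by (intro group_hom.intro group_hom_axioms.intro group_free_grp L homI)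
     (auto simp: carrier_free_grp class_value_class mult_free_grp word_value_append)

lemma class_value_path:
  assumes "set p \<subseteq> X"
  shows "path_class X p \<in> carrier (free_grp X)" "class_value L \<eta> (path_class X p) = path_value L \<eta> p"
proof -
  let ?w = "map (\<lambda>x. (x, True)) p"
  have "path_class X p = word_class X ?w \<and> ?w \<in> words X \<and> word_value L \<eta> ?w = path_value L \<eta> p"
    using assms by (induction p) (auto simp: path_class_def one_free_grp free_gen_class mult_free_grp)
  then show "path_class X p \<in> carrier (free_grp X)"
    "class_value L \<eta> (path_class X p) = path_value L \<eta> p"
    by (auto simp: carrier_free_grp class_value_class)
qed

end

lemma normal_normal_closure:
  assumes "group K" "S \<subseteq> carrier K"
  shows "normal_closure K S \<lhd> K"
proof -
  interpret group K by fact
  show ?thesis unfolding normal_closure_def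
  proof (rule normal_generateI)
    show "{g \<otimes>\<^bsub>K\<^esub> s \<otimes>\<^bsub>K\<^esub> inv\<^bsub>K\<^esub> g |g s. g \<in> carrier K \<and> s \<in> S} \<subseteq> carrier K"
      using assms(2) by auto
    fix h a
    assume "h \<in> {g \<otimes>\<^bsub>K\<^esub> s \<otimes>\<^bsub>K\<^esub> inv\<^bsub>K\<^esub> g |g s. g \<in> carrier K \<and> s \<in> S}" and a: "a \<in> carrier K"
    then obtain g s where h: "h = g \<otimes>\<^bsub>K\<^esub> s \<otimes>\<^bsub>K\<^esub> inv\<^bsub>K\<^esub> g" and g: "g \<in> carrier K" and s: "s \<in> S"
      by auto
    then have "a \<otimes>\<^bsub>K\<^esub> h \<otimes>\<^bsub>K\<^esub> inv\<^bsub>K\<^esub> a = (a \<otimes>\<^bsub>K\<^esub> g) \<otimes>\<^bsub>K\<^esub> s \<otimes>\<^bsub>K\<^esub> inv\<^bsub>K\<^esub> (a \<otimes>\<^bsub>K\<^esub> g)"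
      using a assms(2) by (auto simp: inv_mult_group m_assoc subset_iff)
    then show "a \<otimes>\<^bsub>K\<^esub> h \<otimes>\<^bsub>K\<^esub> inv\<^bsub>K\<^esub> a \<in> {g \<otimes>\<^bsub>K\<^esub> s \<otimes>\<^bsub>K\<^esub> inv\<^bsub>K\<^esub> g |g s. g \<in> carrier K \<and> s \<in> S}"
      using a g s by blast
  qed
qed

lemma normal_closure_subset:
  assumes "group K" "N \<lhd> K" "S \<subseteq> N"
  shows "normal_closure K S \<subseteq> N"
proof -
  interpret group K by fact
  interpret N: normal N K by fact
  have "g \<otimes>\<^bsub>K\<^esub> s \<otimes>\<^bsub>K\<^esub> inv\<^bsub>K\<^esub> g \<in> N" if "g \<in> carrier K" "s \<in> S" for g s
    using that assms(3) N.inv_op_closed2 by blast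
  then show ?thesis unfolding normal_closure_def
    by (intro generate_subgroup_incl N.subgroup_axioms) auto
qed

text \<open>
  The universal property of a quotient group, for the map that picks the common value of \<open>h\<close> on a coset.
  The projection of the covering group and its extensions to quotients are defined by this formula.
\<close>

lemma factor_value:
  assumes "group_hom K L h" "N \<lhd> K" "N \<subseteq> kernel K L h"
  shows "g \<in> carrier K \<Longrightarrow> the_elem (h ` (N #>\<^bsub>K\<^esub> g)) = h g"
    and "(\<lambda>C. the_elem (h ` C)) \<in> hom (K Mod N) L"
proof -
  interpret h: group_hom K L h by fact
  interpret N: normal N K by fact
  have *: "the_elem (h ` (N #>\<^bsub>K\<^esub> g)) = h g" if g: "g \<in> carrier K" for g
  proof -
    have "h (n \<otimes>\<^bsub>K\<^esub> g) = h g" if "n \<in> N" for n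
      using that assms(3) g by (auto simp: kernel_def subset_iff)
    moreover have "\<one>\<^bsub>K\<^esub> \<otimes>\<^bsub>K\<^esub> g = g" using g by simp
    moreover have "N \<noteq> {}" using subgroup.one_closed[OF N.subgroup_axioms] by blast
    ultimately have "h ` (N #>\<^bsub>K\<^esub> g) = {h g}" by (auto simp: r_coset_def image_UN)
    then show ?thesis by simp
  qed
  show "g \<in> carrier K \<Longrightarrow> the_elem (h ` (N #>\<^bsub>K\<^esub> g)) = h g" by (rule *)
  show "(\<lambda>C. the_elem (h ` C)) \<in> hom (K Mod N) L"
  proof (rule homI)
    fix C D assume "C \<in> carrier (K Mod N)" "D \<in> carrier (K Mod N)"
    then obtain a b where ab: "C = N #>\<^bsub>K\<^esub> a" "D = N #>\<^bsub>K\<^esub> b" "a \<in> carrier K" "b \<in> carrier K"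
      by (auto simp: FactGroup_def RCOSETS_def)
    then have "C \<otimes>\<^bsub>K Mod N\<^esub> D = N #>\<^bsub>K\<^esub> (a \<otimes>\<^bsub>K\<^esub> b)" by (simp add: FactGroup_def N.rcos_sum)
    then show "the_elem (h ` (C \<otimes>\<^bsub>K Mod N\<^esub> D)) = the_elem (h ` C) \<otimes>\<^bsub>L\<^esub> the_elem (h ` D)"
      using ab by (simp add: *)
  qed (auto simp: FactGroup_def RCOSETS_def *)
qed

lemma path_sim_in_lists: "path_sim B p p' \<Longrightarrow> B \<subseteq> free (lists X) \<Longrightarrow> set p \<subseteq> X \<and> set p' \<subseteq> X"
  by (auto simp: path_sim_def minimal_element_def free_def subset_iff)

lemma path_class_carrier: "set p \<subseteq> X \<Longrightarrow> path_class X p \<in> carrier (free_grp X)"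
  by (rule class_value_path(1)[where L = "free_grp X" and \<eta> = "free_gen X"])
     (auto simp: group_free_grp free_gen_class carrier_free_grp)

lemma sim_relators_carrier:
  assumes "B \<subseteq> free (lists X)"
  shows "sim_relators X B \<subseteq> carrier (free_grp X)"
proof -
  interpret group "free_grp X" by (rule group_free_grp)
  have "set p \<subseteq> X \<and> set p' \<subseteq> X" if "path_sim B p p'" for p p'
    by (rule path_sim_in_lists[OF that assms])
  then show ?thesis by (auto simp: sim_relators_def path_class_carrier)
qed

lemma group_covering_grp: "B \<subseteq> free (lists X) \<Longrightarrow> group (covering_grp X B)"
  unfolding covering_grp_def
  by (intro normal.factorgroup_is_group normal_normal_closure group_free_grp sim_relators_carrier)

context
  fixes L :: "('h, 'z) monoid_scheme" (structure) and \<eta> :: "'a \<Rightarrow> 'h" and X :: "'a set"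
    and B :: "('a list \<Rightarrow>\<^sub>0 'k::field) set"
  assumes L: "group L" and \<eta>: "\<And>x. x \<in> X \<Longrightarrow> \<eta> x \<in> carrier L"
    and B: "B \<subseteq> free (lists X)"
    and sim: "\<And>p p'. path_sim B p p' \<Longrightarrow> path_value L \<eta> p = path_value L \<eta> p'"
begin

interpretation L: group L by (rule L)

interpretation ev: group_hom "free_grp X" L "class_value L \<eta>"
  by (rule group_hom_class_value[OF L \<eta>])

lemma normal_closure_relators_kernel:
  "normal_closure (free_grp X) (sim_relators X B) \<subseteq> kernel (free_grp X) L (class_value L \<eta>)"
proof (rule normal_closure_subset[OF group_free_grp ev.normal_kernel])
  show "sim_relators X B \<subseteq> kernel (free_grp X) L (class_value L \<eta>)"
  proof
    fix r assume "r \<in> sim_relators X B"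
    then obtain p p' where r: "r = inv\<^bsub>free_grp X\<^esub> path_class X p \<otimes>\<^bsub>free_grp X\<^esub> path_class X p'"
      and s: "path_sim B p p'" by (auto simp: sim_relators_def)
    note p = path_sim_in_lists[OF s B]
    then have "class_value L \<eta> r = \<one>"
      using sim[OF s] path_value_closed[where X = X and \<eta> = \<eta> and p = p', OF L \<eta>]
      by (simp add: r path_class_carrier class_value_path(2)[OF L \<eta>])
    then show "r \<in> kernel (free_grp X) L (class_value L \<eta>)"
      using p by (simp add: kernel_def r path_class_carrier)
  qed
qed

text \<open>
  The universal property of the covering group: an assignment \<open>\<eta>\<close> extends to it as soon as similar paths
  have the same product of values.
\<close>

lemma covering_value_hom: "covering_value L \<eta> \<in> hom (covering_grp X B) L"
  using factor_value(2)[OF ev.group_hom_axioms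
      normal_normal_closure[OF group_free_grp sim_relators_carrier[OF B]]
      normal_closure_relators_kernel]
  by (simp add: covering_grp_def covering_value_def[abs_def])

lemma covering_value_coset:
  "w \<in> words X \<Longrightarrow>
    covering_value L \<eta> (normal_closure (free_grp X) (sim_relators X B) #>\<^bsub>free_grp X\<^esub> word_class X w)
      = word_value L \<eta> w"
  using factor_value(1)[OF ev.group_hom_axioms
      normal_normal_closure[OF group_free_grp sim_relators_carrier[OF B]]
      normal_closure_relators_kernel]
  by (simp add: covering_value_def carrier_free_grp class_value_class[OF L \<eta>])

lemma covering_value_gen: "x \<in> X \<Longrightarrow> covering_value L \<eta> (covering_gen X B x) = \<eta> x"
  by (simp add: covering_gen_def free_gen_class covering_value_coset \<eta>)

end

lemma carrier_covering_grp:
  "carrier (covering_grp X B) =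
    (\<lambda>w. normal_closure (free_grp X) (sim_relators X B) #>\<^bsub>free_grp X\<^esub> word_class X w) ` words X"
  by (auto simp: covering_grp_def FactGroup_def RCOSETS_def carrier_free_grp)

lemma covering_gen_carrier: "x \<in> X \<Longrightarrow> covering_gen X B x \<in> carrier (covering_grp X B)"
  by (auto simp: carrier_covering_grp covering_gen_def free_gen_class)

lemma word_value_hom:
  assumes "group_hom L L' f" "\<And>x. x \<in> X \<Longrightarrow> \<eta> x \<in> carrier L" "w \<in> words X"
  shows "f (word_value L \<eta> w) = word_value L' (\<lambda>x. f (\<eta> x)) w"
proof -
  interpret f: group_hom L L' f by fact
  show ?thesis using assms(3)
  proof (induction w)
    case (Cons a w)
    then show ?case
      by (cases a) (auto simp: assms(2) word_value_closed[OF f.G.is_group assms(2)])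
  qed simp
qed

lemma word_value_eta_cong:
  "(\<And>x. x \<in> X \<Longrightarrow> \<eta> x = \<eta>' x) \<Longrightarrow> w \<in> words X \<Longrightarrow> word_value L \<eta> w = word_value L \<eta>' w"
proof (induction w)
  case (Cons a w)
  then show ?case by (cases a) auto
qed simp

lemma path_value_hom:
  assumes "group_hom L L' f" "\<And>x. x \<in> X \<Longrightarrow> \<eta> x \<in> carrier L" "set p \<subseteq> X"
  shows "f (path_value L \<eta> p) = path_value L' (\<lambda>x. f (\<eta> x)) p"
proof -
  interpret f: group_hom L L' f by fact
  show ?thesis using assms(3)
    by (induction p) (auto simp: assms(2) path_value_closed[OF f.G.is_group assms(2)])
qed

lemma path_value_eta_cong:
  "(\<And>x. x \<in> X \<Longrightarrow> \<eta> x = \<eta>' x) \<Longrightarrow> set p \<subseteq> X \<Longrightarrow> path_value L \<eta> p = path_value L \<eta>' p"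
  by (induction p) auto

section \<open>Naturality under relabelling of basis vectors\<close>

lemma lookup_lcontract:
  assumes "e 0 = 0"
  shows "coeff (lcontract e z) c = e (lsec z c)"
proof -
  have "coeff (lcontract e z) c =
      (\<Sum>c'\<in>snd ` supp z. if c' = c then e (lsec z c') else 0)"
    by (auto simp: lcontract_def lookup_sum lookup_single when_def intro!: sum.cong)
  then show ?thesis using lsec_eq_zero[of c z] assms by (auto simp: sum.delta' simp del: lookup_lsec)
qed

lemma lookup_rcontract:
  assumes "e 0 = 0"
  shows "coeff (rcontract e z) b = e (rsec z b)"
proof -
  have "coeff (rcontract e z) b =
      (\<Sum>b'\<in>fst ` supp z. if b' = b then e (rsec z b') else 0)"
    by (auto simp: rcontract_def lookup_sum lookup_single when_def intro!: sum.cong)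
  then show ?thesis using rsec_eq_zero[of b z] assms by (auto simp: sum.delta' simp del: lookup_rsec)
qed

lemma linear_form_on_add: "linear_form_on U f \<Longrightarrow> x \<in> U \<Longrightarrow> y \<in> U \<Longrightarrow> f (x + y) = f x + f y"
  and linear_form_on_scl: "linear_form_on U f \<Longrightarrow> x \<in> U \<Longrightarrow> f (scl c x) = c * f x"
  by (auto simp: linear_form_on_def)

lemma linear_form_on_zero: "linear_form_on U f \<Longrightarrow> lin.subspace U \<Longrightarrow> f 0 = 0"
  using linear_form_on_scl[of U f 0 0] by (simp add: lin.subspace_0)

lemma linear_on_lcontract:
  assumes "linear_form_on U e" "lin.subspace U"
  shows "linear_on (tensor U W) (lcontract e)"
  unfolding linear_on_def
  by (auto intro!: poly_mapping_eqI simp: lookup_lcontract linear_form_on_zero[OF assms] lookup_add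
      lookup_scl lsec_add lsec_scl linear_form_on_add[OF assms(1)] linear_form_on_scl[OF assms(1)]
      lsec_in[OF _ assms(2)])

lemma linear_on_rcontract:
  assumes "linear_form_on W e" "lin.subspace W"
  shows "linear_on (tensor U W) (rcontract e)"
  unfolding linear_on_def
  by (auto intro!: poly_mapping_eqI simp: lookup_rcontract linear_form_on_zero[OF assms] lookup_add
      lookup_scl rsec_add rsec_scl linear_form_on_add[OF assms(1)] linear_form_on_scl[OF assms(1)]
      rsec_in[OF _ assms(2)])

lemma lcontract_tens:
  assumes "linear_form_on U e" "lin.subspace U" "u \<in> U"
  shows "lcontract e (tens u w) = scl (e u) w"
  by (rule poly_mapping_eqI)
     (simp add: lookup_lcontract linear_form_on_zero[OF assms(1,2)] linear_form_on_scl[OF assms(1,3)] lookup_scl)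

lemma rcontract_tens:
  assumes "linear_form_on W e" "lin.subspace W" "w \<in> W"
  shows "rcontract e (tens u w) = scl (e w) u"
  by (rule poly_mapping_eqI)
     (simp add: lookup_rcontract linear_form_on_zero[OF assms(1,2)] linear_form_on_scl[OF assms(1,3)] lookup_scl)

abbreviation (input) rtens :: "('b \<Rightarrow> 'd) \<Rightarrow> ('c \<Rightarrow> 'e) \<Rightarrow> (('b \<times> 'c) \<Rightarrow>\<^sub>0 'k::field) \<Rightarrow> (('d \<times> 'e) \<Rightarrow>\<^sub>0 'k)"
  where "rtens \<phi> \<chi> \<equiv> reindex (\<lambda>(b, c). (\<phi> b, \<chi> c))"

lemma linear_on_transport:
  assumes "linear_on U f" "lin.subspace U" "\<And>x. x \<in> U \<Longrightarrow> g (reindex \<phi> x) = reindex \<chi> (f x)"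
  shows "linear_on (reindex \<phi> ` U) g"
proof -
  have "g (reindex \<phi> x + reindex \<phi> y) = g (reindex \<phi> x) + g (reindex \<phi> y)" if "x \<in> U" "y \<in> U" for x y
    using assms(3)[of "x + y"] assms that
    by (simp add: reindex_add linear_on_add[OF assms(1)] lin.subspace_add)
  moreover have "g (scl c (reindex \<phi> x)) = scl c (g (reindex \<phi> x))" if "x \<in> U" for c x
    using assms(3)[of "scl c x"] assms that
    by (simp add: reindex_scl linear_on_scl[OF assms(1)] lin.subspace_scale)
  ultimately show ?thesis by (auto simp: linear_on_def)
qed

lemma linear_form_on_transport:
  assumes "linear_form_on U f" "lin.subspace U" "\<And>x. x \<in> U \<Longrightarrow> g (reindex \<phi> x) = f x"
  shows "linear_form_on (reindex \<phi> ` U) g"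
proof -
  have "g (reindex \<phi> x + reindex \<phi> y) = g (reindex \<phi> x) + g (reindex \<phi> y)" if "x \<in> U" "y \<in> U" for x y
    using assms(3)[of "x + y"] assms that
    by (simp add: reindex_add linear_form_on_add[OF assms(1)] lin.subspace_add)
  moreover have "g (scl c (reindex \<phi> x)) = c * (g (reindex \<phi> x))" if "x \<in> U" for c x
    using assms(3)[of "scl c x"] assms that
    by (simp add: reindex_scl linear_form_on_scl[OF assms(1)] lin.subspace_scale)
  ultimately show ?thesis by (auto simp: linear_form_on_def)
qed

lemma tensor_transport:
  assumes "linear_on (tensor (reindex \<phi> ` U) (reindex \<psi> ` W)) g" "linear_on (tensor U W) f"
    and "\<And>u w. u \<in> U \<Longrightarrow> w \<in> W \<Longrightarrow>
      g (tens (reindex \<phi> u) (reindex \<psi> w)) = reindex \<chi> (f (tens u w))"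
    and "z \<in> tensor U W"
  shows "g (rtens \<phi> \<psi> z) = reindex \<chi> (f z)"
proof (rule linear_on_tensor_eq[where f = "\<lambda>z. g (rtens \<phi> \<psi> z)", OF _ _ _ assms(4)])
  show "linear_on (tensor U W) (\<lambda>z. g (rtens \<phi> \<psi> z))"
    by (rule linear_on_comp[OF linear_on_reindex _ assms(1)]) (simp add: tensor_reindex_image)
  show "linear_on (tensor U W) (\<lambda>z. reindex \<chi> (f z))"
    by (rule linear_on_comp[OF assms(2) subset_UNIV linear_on_reindex])
qed (simp add: reindex_tens assms(3))

text \<open>
  The maps \<open>g\<close> and \<open>f\<close> need to correspond to each other on \<open>U\<close> only; this makes \<open>g\<close> linear on the
  relabelled subspace (\<open>linear_on_transport\<close>).  The other transport lemmas below are variants for the second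
  factor, for both factors, and for contractions.
\<close>

lemma lmap_transport:
  assumes "linear_on U f" "lin.subspace U" "\<And>x. x \<in> U \<Longrightarrow> g (reindex \<phi> x) = reindex \<chi> (f x)"
    and "z \<in> tensor U W"
  shows "lmap g (rtens \<phi> \<psi> z) = rtens \<chi> \<psi> (lmap f z)"
proof -
  have g: "linear_on (reindex \<phi> ` U) g"
    by (rule linear_on_transport[OF assms(1,2)]) (rule assms(3))
  note g = this subspace_reindex_image[OF assms(2), of \<phi>]
  show ?thesis
    by (rule tensor_transport[OF linear_on_lmap[OF g] linear_on_lmap[OF assms(1,2)] _ assms(4)])
       (simp add: reindex_tens lmap_tens[OF g] lmap_tens[OF assms(1,2)] assms(3))
qed

lemma rmap_transport:
  assumes "linear_on W f" "lin.subspace W" "\<And>x. x \<in> W \<Longrightarrow> g (reindex \<phi> x) = reindex \<chi> (f x)"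
    and "z \<in> tensor U W"
  shows "rmap g (rtens \<psi> \<phi> z) = rtens \<psi> \<chi> (rmap f z)"
proof -
  have g: "linear_on (reindex \<phi> ` W) g"
    by (rule linear_on_transport[OF assms(1,2)]) (rule assms(3))
  note g = this subspace_reindex_image[OF assms(2), of \<phi>]
  show ?thesis
    by (rule tensor_transport[OF linear_on_rmap[OF g] linear_on_rmap[OF assms(1,2)] _ assms(4)])
       (simp add: reindex_tens rmap_tens[OF g] rmap_tens[OF assms(1,2)] assms(3))
qed

lemma tmap_transport:
  assumes "linear_on U f" "lin.subspace U" "\<And>x. x \<in> U \<Longrightarrow> g (reindex \<phi> x) = reindex \<chi> (f x)"
    and "linear_on W f'" "lin.subspace W" "\<And>x. x \<in> W \<Longrightarrow> g' (reindex \<phi>' x) = reindex \<chi>' (f' x)"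
    and "z \<in> tensor U W"
  shows "tmap g g' (rtens \<phi> \<phi>' z) = rtens \<chi> \<chi>' (tmap f f' z)"
proof -
  have "rmap g' (rtens \<phi> \<phi>' z) = rtens \<phi> \<chi>' (rmap f' z)"
    by (rule rmap_transport[OF assms(4,5) _ assms(7)]) (rule assms(6))
  moreover have "lmap g (rtens \<phi> \<chi>' (rmap f' z)) = rtens \<chi> \<chi>' (lmap f (rmap f' z))"
    by (rule lmap_transport[OF assms(1,2) _ rmap_in[OF assms(4,5) subset_UNIV assms(7)]])
       (rule assms(3))
  ultimately show ?thesis by (simp add: tmap_def)
qed

lemma lcontract_transport:
  assumes "linear_form_on U f" "lin.subspace U" "\<And>x. x \<in> U \<Longrightarrow> g (reindex \<phi> x) = f x"
    and "z \<in> tensor U W"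
  shows "lcontract g (rtens \<phi> \<psi> z) = reindex \<psi> (lcontract f z)"
proof -
  have g: "linear_form_on (reindex \<phi> ` U) g"
    by (rule linear_form_on_transport[OF assms(1,2)]) (rule assms(3))
  note g = this subspace_reindex_image[OF assms(2), of \<phi>]
  show ?thesis
    by (rule tensor_transport[OF linear_on_lcontract[OF g] linear_on_lcontract[OF assms(1,2)] _ assms(4)])
       (simp add: reindex_scl lcontract_tens[OF g] lcontract_tens[OF assms(1,2)] assms(3))
qed

lemma rcontract_transport:
  assumes "linear_form_on W f" "lin.subspace W" "\<And>x. x \<in> W \<Longrightarrow> g (reindex \<phi> x) = f x"
    and "z \<in> tensor U W"
  shows "rcontract g (rtens \<psi> \<phi> z) = reindex \<psi> (rcontract f z)"
proof -
  have g: "linear_form_on (reindex \<phi> ` W) g"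
    by (rule linear_form_on_transport[OF assms(1,2)]) (rule assms(3))
  note g = this subspace_reindex_image[OF assms(2), of \<phi>]
  show ?thesis
    by (rule tensor_transport[OF linear_on_rcontract[OF g] linear_on_rcontract[OF assms(1,2)] _ assms(4)])
       (simp add: reindex_scl rcontract_tens[OF g] rcontract_tens[OF assms(1,2)] assms(3))
qed

lemma rtens_image:
  "(\<And>u. u \<in> U \<Longrightarrow> reindex \<phi> u \<in> U') \<Longrightarrow> (\<And>w. w \<in> W \<Longrightarrow> reindex \<chi> w \<in> W') \<Longrightarrow> z \<in> tensor U W
    \<Longrightarrow> rtens \<phi> \<chi> z \<in> tensor U' W'"
  using tensor_mono[of "reindex \<phi> ` U" U' "reindex \<chi> ` W" W'] tensor_reindex_image[of \<phi> U \<chi> W] by auto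

lemma rtens_inverse:
  assumes "lin.subspace U" "lin.subspace W" "\<And>u. u \<in> U \<Longrightarrow> reindex \<phi>' (reindex \<phi> u) = u"
    "\<And>w. w \<in> W \<Longrightarrow> reindex \<chi>' (reindex \<chi> w) = w" "z \<in> tensor U W"
  shows "rtens \<phi>' \<chi>' (rtens \<phi> \<chi> z) = z"
  by (rule linear_on_tensor_eq[where f = "\<lambda>z. rtens \<phi>' \<chi>' (rtens \<phi> \<chi> z)" and g = "\<lambda>z. z", OF _ _ _ assms(5)])
     (use assms(3,4) in \<open>auto simp: linear_on_def reindex_tens reindex_add reindex_scl\<close>)

lemma middle_flip:
  fixes z :: "(('b \<times> 'b) \<times> ('b \<times> 'b)) \<Rightarrow>\<^sub>0 'k::field"
  shows "middle flip z = reindex (\<lambda>((x, y), (y', w)). ((x, y'), (y, w))) z"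
proof -
  have "(lmap flip :: ((('b \<times> 'b) \<times> 'b) \<Rightarrow>\<^sub>0 'k) \<Rightarrow> _) = reindex (\<lambda>((b, c), d). ((c, b), d))"
    unfolding flip_def by (rule ext) (simp add: lmap_reindex case_prod_beta')
  then show ?thesis
    by (simp add: middle_def rmap_reindex reindex_reindex case_prod_beta')
qed

text \<open>
  A linear condition on a tensor product of tensor products may be checked on tensors of pure tensors, by
  treating one factor at a time.
\<close>

lemma bilinear_tensor_image:
  assumes "lin.subspace Z"
    and "\<And>a b c d. a \<in> U \<Longrightarrow> b \<in> W \<Longrightarrow> c \<in> U' \<Longrightarrow> d \<in> W' \<Longrightarrow>
      reindex \<phi> (tens (tens a b) (tens c d)) \<in> Z"
    and "z \<in> tensor (tensor U W) (tensor U' W')"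
  shows "reindex \<phi> z \<in> Z"
proof -
  have 1: "reindex \<phi> (tens u (tens c d)) \<in> Z" if "u \<in> tensor U W" "c \<in> U'" "d \<in> W'" for u c d
    using linear_on_tensor_image[of U W "\<lambda>u. reindex \<phi> (tens u (tens c d))" Z] assms(1,2) that
    by (auto simp: linear_on_def tens_add_left tens_scl_left reindex_add reindex_scl)
  have 2: "reindex \<phi> (tens u w) \<in> Z" if "u \<in> tensor U W" "w \<in> tensor U' W'" for u w
    using linear_on_tensor_image[of U' W' "\<lambda>w. reindex \<phi> (tens u w)" Z] assms(1) 1 that
    by (auto simp: linear_on_def tens_add_right tens_scl_right reindex_add reindex_scl)
  show ?thesis
    using linear_on_tensor_image[OF linear_on_reindex assms(1), of "tensor U W" "tensor U' W'" \<phi>] 2 assms(3)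
    by auto
qed

lemma middle_flip_in:
  assumes "z \<in> tensor (tensor U U) (tensor U U)"
  shows "middle flip z \<in> tensor (tensor U U) (tensor U U)"
  unfolding middle_flip
proof (rule bilinear_tensor_image[OF _ _ assms])
  fix a b c d assume "a \<in> U" "b \<in> U" "c \<in> U" "d \<in> U"
  moreover have "reindex (\<lambda>((x, y), (y', w)). ((x, y'), (y, w))) (tens (tens a b) (tens c d)) =
      tens (tens a c) (tens b d)"
  proof -
    let ?s = "\<lambda>((x, y), (y', w)). ((x, y'), (y, w))"
    have inj: "inj ?s" by (auto simp: inj_def)
    have "coeff (reindex ?s z) ((x, y), (y', w)) = coeff z ((x, y'), (y, w))"
      for z :: "(('a \<times> 'a) \<times> ('a \<times> 'a)) \<Rightarrow>\<^sub>0 'b" and x y y' w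
      using lookup_reindex_inj[OF inj subset_UNIV, of "((x, y'), (y, w))" z] by simp
    then show ?thesis by (intro poly_mapping_eqI) (auto simp: ac_simps)
  qed
  ultimately show "reindex (\<lambda>((x, y), (y', w)). ((x, y'), (y, w))) (tens (tens a b) (tens c d))
      \<in> tensor (tensor U U) (tensor U U)"
    by (simp add: tens_in_tensor)
qed simp

section \<open>Isomorphisms of Hopf algebras given by relabelling\<close>

text \<open>
  A spanning vector, unlike a dimension, is visibly carried along by an injective linear map.
\<close>

lemma dim_eq_1_iff:
  assumes "lin.subspace D"
  shows "lin.dim D = 1 \<longleftrightarrow> (\<exists>v. v \<noteq> 0 \<and> D = lin.span {v})"
proof
  assume d: "lin.dim D = 1"
  obtain Bs where Bs: "Bs \<subseteq> D" "lin.independent Bs" "D \<subseteq> lin.span Bs" "card Bs = lin.dim D"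
    using lin.basis_exists by blast
  then obtain v where v: "Bs = {v}" using d by (auto simp: card_1_singleton_iff)
  then have "v \<noteq> 0" using Bs(2) lin.dependent_zero by blast
  moreover have "lin.span {v} \<subseteq> D" using Bs v assms by (intro lin.span_minimal) auto
  then have "D = lin.span {v}" using Bs v by auto
  ultimately show "\<exists>v. v \<noteq> 0 \<and> D = lin.span {v}" by blast
next
  assume "\<exists>v. v \<noteq> 0 \<and> D = lin.span {v}"
  then obtain v where v: "v \<noteq> 0" "D = lin.span {v}" by blast
  then have "lin.independent {v}" by simp
  then show "lin.dim D = 1" using lin.dim_eq_card_independent[of "{v}"] by (simp add: v(2))
qed

text \<open>
  The relabelling \<open>\<phi>\<close> of basis vectors carries the structure of \<open>A\<close> to that of \<open>B\<close> and is undone by \<open>\<phi>'\<close> on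
  the space of \<open>A\<close>.  The first assumptions, which hold in every graded Hopf algebra, only say that
  the operations of \<open>A\<close> stay in \<open>A\<close>; they make the situation symmetric in \<open>A\<close> and \<open>B\<close> (\<open>converse\<close>), so that
  properties of all subcoalgebras of \<open>B\<close> can be tested in \<open>A\<close>.
\<close>

locale hopf_reindex =
  fixes A :: "('b, 'k::field) hopf_data" and B :: "('c, 'k) hopf_data"
    and \<phi> :: "'b \<Rightarrow> 'c" and \<phi>' :: "'c \<Rightarrow> 'b"
  assumes subspace_A: "lin.subspace (hspace A)"
    and mult_A: "hmult A ` tensor (hspace A) (hspace A) \<subseteq> hspace A"
    and one_A: "hone A \<in> hspace A"
    and comult_A: "hcomult A ` hspace A \<subseteq> tensor (hspace A) (hspace A)"
    and grad_A: "hgrad A n \<subseteq> hspace A"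
    and inverse: "x \<in> hspace A \<Longrightarrow> reindex \<phi>' (reindex \<phi> x) = x"
    and space_B: "hspace B = reindex \<phi> ` hspace A"
    and mult_B: "z \<in> tensor (hspace A) (hspace A) \<Longrightarrow>
      hmult B (rtens \<phi> \<phi> z) = reindex \<phi> (hmult A z)"
    and one_B: "hone B = reindex \<phi> (hone A)"
    and comult_B: "x \<in> hspace A \<Longrightarrow> hcomult B (reindex \<phi> x) = rtens \<phi> \<phi> (hcomult A x)"
    and counit_B: "x \<in> hspace A \<Longrightarrow> hcounit B (reindex \<phi> x) = hcounit A x"
    and grad_B: "hgrad B n = reindex \<phi> ` hgrad A n"
begin

abbreviation "VA \<equiv> hspace A"
abbreviation "VB \<equiv> hspace B"
abbreviation "AA \<equiv> tensor VA VA"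
abbreviation "\<Phi> \<equiv> reindex \<phi>"
abbreviation "\<Phi>' \<equiv> reindex \<phi>'"
abbreviation "T \<equiv> rtens \<phi> \<phi>"
abbreviation "T' \<equiv> rtens \<phi>' \<phi>'"

lemma T_inverse: "z \<in> AA \<Longrightarrow> T' (T z) = z"
  by (rule rtens_inverse[OF subspace_A subspace_A inverse inverse])

lemma tensor_B: "tensor VB VB = T ` AA"
  by (simp add: space_B tensor_reindex_image)

lemma subspace_B: "lin.subspace VB"
  by (simp add: space_B subspace_reindex_image subspace_A)

lemma inj_\<Phi>: "inj_on \<Phi> VA"
  by (rule inj_on_inverseI) (rule inverse)

lemma hprod_B: "x \<in> VA \<Longrightarrow> y \<in> VA \<Longrightarrow> hprod B (\<Phi> x) (\<Phi> y) = \<Phi> (hprod A x y)"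
  using mult_B[of "tens x y"] by (simp add: reindex_tens tens_in_tensor)

lemma hprod_A_in: "x \<in> VA \<Longrightarrow> y \<in> VA \<Longrightarrow> hprod A x y \<in> VA"
  using mult_A by (auto simp: tens_in_tensor)

lemma converse: "hopf_reindex B A \<phi>' \<phi>"
proof
  show "hmult A (T' z) = \<Phi>' (hmult B z)" if "z \<in> tensor VB VB" for z
  proof -
    obtain y where y: "z = T y" "y \<in> AA" using \<open>z \<in> tensor VB VB\<close> by (auto simp: tensor_B)
    then show ?thesis using mult_A by (auto simp: T_inverse mult_B inverse)
  qed
  show "hcomult A (\<Phi>' x) = T' (hcomult B x)" if "x \<in> VB" for x
  proof -
    obtain y where y: "x = \<Phi> y" "y \<in> VA" using \<open>x \<in> VB\<close> by (auto simp: space_B)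
    then show ?thesis using comult_A by (auto simp: T_inverse comult_B inverse)
  qed
  show "hgrad B n \<subseteq> VB" for n
    unfolding grad_B space_B by (rule image_mono[OF grad_A])
  show "hgrad A n = \<Phi>' ` hgrad B n" for n
    using grad_A[of n] by (force simp: grad_B image_image inverse subset_iff)
qed (use mult_A one_A comult_A grad_A in
    \<open>auto simp: subspace_reindex_image[OF subspace_A] space_B tensor_reindex_image image_image mult_B one_B comult_B counit_B
      grad_B inverse\<close>)

lemma algebra_B:
  assumes "is_algebra A"
  shows "is_algebra B"
proof -
  have lin: "linear_on AA (hmult A)" using assms by (simp add: is_algebra_def)
  have "linear_on (tensor VB VB) (hmult B)"
    unfolding tensor_B by (rule linear_on_transport[OF lin subspace_tensor mult_B])
  moreover have "hmult B ` tensor VB VB \<subseteq> VB"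
    using mult_A by (auto simp: tensor_B mult_B) (auto simp: space_B)
  moreover have "hprod B (hprod B x y) z = hprod B x (hprod B y z)"
    if "x \<in> VB" "y \<in> VB" "z \<in> VB" for x y z
    using that assms by (auto simp: space_B hprod_B hprod_A_in is_algebra_def)
  moreover have "hprod B (hone B) x = x \<and> hprod B x (hone B) = x" if "x \<in> VB" for x
    using that assms by (auto simp: space_B one_B hprod_B is_algebra_def)
  ultimately show ?thesis using one_A subspace_B by (auto simp: is_algebra_def one_B space_B)
qed

lemma coalgebra_B:
  assumes "is_coalgebra A"
  shows "is_coalgebra B"
proof -
  have lin: "linear_on VA (hcomult A)" and linf: "linear_form_on VA (hcounit A)"
    using assms by (simp_all add: is_coalgebra_def)
  have "linear_on VB (hcomult B)"
    unfolding space_B by (rule linear_on_transport[OF lin subspace_A comult_B])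
  moreover have "hcomult B ` VB \<subseteq> tensor VB VB"
    using comult_A unfolding tensor_B by (auto simp: space_B comult_B)
  moreover have "linear_form_on VB (hcounit B)"
    unfolding space_B by (rule linear_form_on_transport[OF linf subspace_A counit_B])
  moreover have "reindex (\<lambda>((a, b), c). (a, b, c)) (lmap (hcomult B) (hcomult B x)) =
      rmap (hcomult B) (hcomult B x)" if "x \<in> VB" for x
  proof -
    obtain y where y: "x = \<Phi> y" "y \<in> VA" using \<open>x \<in> VB\<close> by (auto simp: space_B)
    then have z: "hcomult A y \<in> AA" using comult_A by auto
    have "lmap (hcomult B) (T (hcomult A y)) =
        rtens (\<lambda>(b, c). (\<phi> b, \<phi> c)) \<phi> (lmap (hcomult A) (hcomult A y))"
      by (rule lmap_transport[OF lin subspace_A comult_B z])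
    moreover have "rmap (hcomult B) (T (hcomult A y)) =
        rtens \<phi> (\<lambda>(b, c). (\<phi> b, \<phi> c)) (rmap (hcomult A) (hcomult A y))"
      by (rule rmap_transport[OF lin subspace_A comult_B z])
    moreover have "rmap (hcomult A) (hcomult A y) =
        reindex (\<lambda>((a, b), c). (a, b, c)) (lmap (hcomult A) (hcomult A y))"
      using assms y by (simp add: is_coalgebra_def)
    ultimately show ?thesis using y by (simp add: comult_B reindex_reindex case_prod_beta')
  qed
  moreover have "lcontract (hcounit B) (hcomult B x) = x \<and> rcontract (hcounit B) (hcomult B x) = x"
    if "x \<in> VB" for x
  proof -
    obtain y where y: "x = \<Phi> y" "y \<in> VA" using \<open>x \<in> VB\<close> by (auto simp: space_B)
    then have z: "hcomult A y \<in> AA" using comult_A by auto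
    have "lcontract (hcounit B) (T (hcomult A y)) = \<Phi> (lcontract (hcounit A) (hcomult A y))"
      by (rule lcontract_transport[OF linf subspace_A counit_B z])
    moreover have "rcontract (hcounit B) (T (hcomult A y)) = \<Phi> (rcontract (hcounit A) (hcomult A y))"
      by (rule rcontract_transport[OF linf subspace_A counit_B z])
    ultimately show ?thesis using y assms by (simp add: comult_B is_coalgebra_def)
  qed
  ultimately show ?thesis by (auto simp: is_coalgebra_def subspace_B)
qed

text \<open>
  Every axiom of \<open>B\<close> at \<open>\<Phi> x\<close> is the image of the axiom of \<open>A\<close> at \<open>x\<close>; an antipode of \<open>B\<close> is obtained by
  conjugating one of \<open>A\<close>.
\<close>

lemma hopf_algebra_B:
  assumes "hopf_algebra A"
  shows "hopf_algebra B"
proof -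
  note H = assms[unfolded hopf_algebra_def hopf_axioms_wrt_def]
  have alg: "is_algebra A" and coalg: "is_coalgebra A" using H by auto
  have lin: "linear_on AA (hmult A)" using alg by (simp add: is_algebra_def)
  have "hcomult B (hprod B x y) =
      tmap (hmult B) (hmult B) (middle flip (tens (hcomult B x) (hcomult B y)))"
    if "x \<in> VB" "y \<in> VB" for x y
  proof -
    obtain a b where ab: "x = \<Phi> a" "a \<in> VA" "y = \<Phi> b" "b \<in> VA"
      using \<open>x \<in> VB\<close> \<open>y \<in> VB\<close> by (auto simp: space_B)
    then have "tens (hcomult A a) (hcomult A b) \<in> tensor AA AA"
      using comult_A by (intro tens_in_tensor) auto
    then have z: "middle flip (tens (hcomult A a) (hcomult A b)) \<in> tensor AA AA"
      by (rule middle_flip_in)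
    have "middle flip (tens (T (hcomult A a)) (T (hcomult A b))) =
        rtens (\<lambda>(b, c). (\<phi> b, \<phi> c)) (\<lambda>(b, c). (\<phi> b, \<phi> c)) (middle flip (tens (hcomult A a) (hcomult A b)))"
      by (simp add: middle_flip reindex_tens[symmetric] reindex_reindex case_prod_beta')
    moreover have "tmap (hmult B) (hmult B)
        (rtens (\<lambda>(b, c). (\<phi> b, \<phi> c)) (\<lambda>(b, c). (\<phi> b, \<phi> c)) (middle flip (tens (hcomult A a) (hcomult A b)))) =
        T (tmap (hmult A) (hmult A) (middle flip (tens (hcomult A a) (hcomult A b))))"
      by (rule tmap_transport[OF lin subspace_tensor mult_B lin subspace_tensor mult_B z])
    moreover have "hcomult A (hprod A a b) =
        tmap (hmult A) (hmult A) (middle flip (tens (hcomult A a) (hcomult A b)))"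
      using H ab by blast
    ultimately show ?thesis using ab by (simp add: comult_B hprod_B hprod_A_in)
  qed
  moreover have "hcomult B (hone B) = tens (hone B) (hone B)"
    using H one_A by (simp add: one_B comult_B reindex_tens)
  moreover have "hcounit B (hprod B x y) = hcounit B x * hcounit B y" if "x \<in> VB" "y \<in> VB" for x y
    using that H by (auto simp: space_B hprod_B hprod_A_in counit_B)
  moreover have "hcounit B (hone B) = 1" using H one_A by (simp add: one_B counit_B)
  moreover have "\<exists>S. linear_on VA S \<and> S ` VA \<subseteq> VA \<and>
      (\<forall>x\<in>VA. hmult A (lmap S (hcomult A x)) = scl (hcounit A x) (hone A) \<and>
        hmult A (rmap S (hcomult A x)) = scl (hcounit A x) (hone A))"
    using H by (elim conjE)
  then obtain S where S: "linear_on VA S" "S ` VA \<subseteq> VA"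
      and S3: "\<forall>x\<in>VA. hmult A (lmap S (hcomult A x)) = scl (hcounit A x) (hone A) \<and>
        hmult A (rmap S (hcomult A x)) = scl (hcounit A x) (hone A)"
    by (elim exE conjE)
  define S' where "S' = (\<lambda>x. \<Phi> (S (\<Phi>' x)))"
  have SB: "S' (\<Phi> x) = \<Phi> (S x)" if "x \<in> VA" for x using that by (simp add: S'_def inverse)
  have "linear_on VB S'" unfolding space_B by (rule linear_on_transport[OF S(1) subspace_A SB])
  moreover have "S' ` VB \<subseteq> VB" using S(2) by (auto simp: space_B SB)
  moreover have "hmult B (lmap S' (hcomult B x)) = scl (hcounit B x) (hone B) \<and>
      hmult B (rmap S' (hcomult B x)) = scl (hcounit B x) (hone B)" if "x \<in> VB" for x
  proof -
    obtain y where y: "x = \<Phi> y" "y \<in> VA" using \<open>x \<in> VB\<close> by (auto simp: space_B)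
    then have z: "hcomult A y \<in> AA" using comult_A by auto
    have "lmap S' (T (hcomult A y)) = T (lmap S (hcomult A y))"
      by (rule lmap_transport[OF S(1) subspace_A SB z])
    moreover have "rmap S' (T (hcomult A y)) = T (rmap S (hcomult A y))"
      by (rule rmap_transport[OF S(1) subspace_A SB z])
    ultimately show ?thesis
      using y S3 lmap_in[OF S(1) subspace_A S(2) z] rmap_in[OF S(1) subspace_A S(2) z]
      by (simp add: comult_B mult_B counit_B one_B reindex_scl)
  qed
  ultimately have "hopf_axioms_wrt flip B"
    unfolding hopf_axioms_wrt_def using algebra_B[OF alg] coalgebra_B[OF coalg]
    by (intro conjI exI[of _ S']) blast+
  then show ?thesis by (simp add: hopf_algebra_def)
qed

lemma compatible_grading_B:
  assumes "compatible_grading A"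
  shows "compatible_grading B"
proof -
  note H = assms[unfolded compatible_grading_def]
  have a1: "lin.subspace (hgrad B n)" for n using H by (simp add: grad_B subspace_reindex_image)
  have a2: "lin.span (\<Union>n. hgrad B n) = VB"
    using H by (simp add: grad_B image_UN[symmetric] span_reindex_image space_B)
  have a3: "f n = 0"
    if "finite I" "\<forall>n\<in>I. f n \<in> hgrad B n" "(\<Sum>n\<in>I. f n) = 0" "n \<in> I" for I f and n :: nat
  proof -
    have g: "\<Phi>' (f i) \<in> hgrad A i" "\<Phi> (\<Phi>' (f i)) = f i" if "i \<in> I" for i
      using \<open>\<forall>n\<in>I. f n \<in> hgrad B n\<close> that grad_A by (auto simp: grad_B inverse subset_iff)
    have "(\<Sum>n\<in>I. \<Phi>' (f n)) = 0" using that(3) by (simp flip: reindex_sum)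
    then have "\<Phi>' (f n) = 0" using H[THEN conjunct2, THEN conjunct2, THEN conjunct1, rule_format, of I "\<lambda>n. \<Phi>' (f n)" n] g(1) that(1,4)
      by simp
    then show ?thesis using g(2)[OF \<open>n \<in> I\<close>] by simp
  qed
  have a4: "hmult B ` tensor (hgrad B m) (hgrad B n) \<subseteq> hgrad B (m + n)" for m n
  proof -
    have "tensor (hgrad A m) (hgrad A n) \<subseteq> AA" by (intro tensor_mono grad_A)
    then have "hmult B ` T ` tensor (hgrad A m) (hgrad A n) = \<Phi> ` hmult A ` tensor (hgrad A m) (hgrad A n)"
      unfolding image_image by (intro image_cong refl mult_B) auto
    also have "\<dots> \<subseteq> \<Phi> ` hgrad A (m + n)" using H by (intro image_mono) blast
    finally show ?thesis by (simp add: grad_B tensor_reindex_image)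
  qed
  have a5: "hone B \<in> hgrad B 0" using H by (simp add: one_B grad_B)
  have a6: "hcomult B ` hgrad B n \<subseteq> lin.span (\<Union>i\<le>n. tensor (hgrad B i) (hgrad B (n - i)))" for n
  proof -
    have "hcomult B ` \<Phi> ` hgrad A n = T ` hcomult A ` hgrad A n"
      unfolding image_image by (intro image_cong refl comult_B) (use grad_A in auto)
    also have "\<dots> \<subseteq> T ` lin.span (\<Union>i\<le>n. tensor (hgrad A i) (hgrad A (n - i)))"
      using H by (intro image_mono) blast
    finally show ?thesis by (simp add: grad_B tensor_reindex_image image_UN[symmetric] span_reindex_image)
  qed
  have a7: "hcounit B x = 0" if "n > 0" "x \<in> hgrad B n" for n x
    using that H grad_A by (auto simp: grad_B counit_B subset_iff)
  show ?thesis unfolding compatible_grading_def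
  proof (intro conjI allI impI ballI)
    show "f n = 0" if "finite I \<and> (\<forall>n\<in>I. f n \<in> hgrad B n) \<and> sum f I = 0" "n \<in> I"
      for I f and n :: nat
      using that by (intro a3[of I f n]) auto
  qed (rule a1 a2 a4 a5 a6 a7; assumption?)+
qed

lemma subcoalgebra_image:
  assumes "subcoalgebra A D"
  shows "subcoalgebra B (\<Phi> ` D)"
proof -
  have "hcomult B ` \<Phi> ` D = T ` hcomult A ` D"
    unfolding image_image by (intro image_cong refl comult_B) (use assms in \<open>auto simp: subcoalgebra_def\<close>)
  then show ?thesis using assms
    by (auto simp: subcoalgebra_def subspace_reindex_image tensor_reindex_image space_B)
qed

lemma inverse_image: "D \<subseteq> VA \<Longrightarrow> \<Phi>' ` \<Phi> ` D = D"
  by (force simp: image_image inverse subset_iff)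

text \<open>
  A subcoalgebra of \<open>B\<close> inside \<open>\<Phi> D\<close> comes from one of \<open>A\<close> inside \<open>D\<close>, by the inverse relabelling.
\<close>

lemma simple_image:
  assumes "simple_subcoalgebra A D"
  shows "simple_subcoalgebra B (\<Phi> ` D)"
proof -
  interpret BA: hopf_reindex B A \<phi>' \<phi> by (rule converse)
  note D = assms[unfolded simple_subcoalgebra_def]
  have DA: "D \<subseteq> VA" using D by (simp add: subcoalgebra_def)
  have "\<Phi> ` D \<noteq> {0}" using D inverse_image[OF DA] by (metis image_empty image_insert reindex_zero)
  moreover have "E = {0} \<or> E = \<Phi> ` D" if E: "subcoalgebra B E" "E \<subseteq> \<Phi> ` D" for E
  proof -
    have "subcoalgebra A (\<Phi>' ` E)" by (rule BA.subcoalgebra_image[OF E(1)])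
    moreover have "\<Phi>' ` E \<subseteq> D" using E(2) inverse_image[OF DA] by blast
    ultimately have "\<Phi>' ` E = {0} \<or> \<Phi>' ` E = D" using D by blast
    moreover have "\<Phi> ` \<Phi>' ` E = E"
      using E(1) by (intro BA.inverse_image) (simp add: subcoalgebra_def)
    ultimately show ?thesis by auto
  qed
  ultimately show ?thesis using subcoalgebra_image D by (simp add: simple_subcoalgebra_def)
qed

lemma simple_B: "{D. simple_subcoalgebra B D} = (`) \<Phi> ` {D. simple_subcoalgebra A D}"
proof -
  interpret BA: hopf_reindex B A \<phi>' \<phi> by (rule converse)
  have "D \<in> (`) \<Phi> ` {D. simple_subcoalgebra A D}" if "simple_subcoalgebra B D" for D
  proof
    show "D = \<Phi> ` \<Phi>' ` D"
      by (rule BA.inverse_image[symmetric]) (use that in \<open>simp add: simple_subcoalgebra_def subcoalgebra_def\<close>)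
    show "\<Phi>' ` D \<in> {D. simple_subcoalgebra A D}" using BA.simple_image[OF that] by simp
  qed
  then show ?thesis using simple_image by auto
qed

lemma pointed_B:
  assumes "pointed A"
  shows "pointed B"
  unfolding pointed_def
proof (intro allI impI)
  fix E assume "simple_subcoalgebra B E"
  then obtain D where D: "simple_subcoalgebra A D" "E = \<Phi> ` D" using simple_B by blast
  then have DA: "lin.subspace D" "D \<subseteq> VA" by (auto simp: simple_subcoalgebra_def subcoalgebra_def)
  obtain v where v: "v \<noteq> 0" "D = lin.span {v}"
    using assms D(1) dim_eq_1_iff[OF DA(1)] by (auto simp: pointed_def)
  have "v \<in> VA" using v DA lin.span_base by blast
  then have "\<Phi> v \<noteq> 0" using v(1) inverse[of v] by auto
  moreover have "E = lin.span {\<Phi> v}" using span_reindex_image[of \<phi> "{v}"] by (simp add: D(2) v(2))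
  ultimately show "lin.dim E = 1"
    using dim_eq_1_iff[of E] DA(1) by (auto simp: D(2) subspace_reindex_image)
qed

text \<open>
  The relabelling is injective on the tensor square, so the membership condition on \<open>\<Delta> x\<close> that defines the
  next layer holds for \<open>\<Phi> x\<close> in \<open>B\<close> exactly when it holds for \<open>x\<close> in \<open>A\<close>.
\<close>

lemma coradical_filtration_B: "coradical_filtration B n = \<Phi> ` coradical_filtration A n"
proof -
  let ?C = "lin.span (\<Union>{D. simple_subcoalgebra A D})"
  have C: "lin.span (\<Union>{D. simple_subcoalgebra B D}) = \<Phi> ` ?C"
    by (simp add: simple_B image_UN[symmetric] span_reindex_image)
  have CA: "?C \<subseteq> VA"
    by (rule lin.span_minimal) (auto simp: simple_subcoalgebra_def subcoalgebra_def subspace_A)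
  have "coradical_filtration B n = \<Phi> ` coradical_filtration A n \<and> coradical_filtration A n \<subseteq> VA"
  proof (induction n)
    case 0
    then show ?case using C CA by simp
  next
    case (Suc n)
    let ?Z = "lin.span (tensor VA (coradical_filtration A n) \<union> tensor ?C VA)"
    have Z: "?Z \<subseteq> AA"
      by (rule lin.span_minimal[OF Un_least[OF tensor_mono tensor_mono] subspace_tensor])
         (use Suc CA in auto)
    have e1: "lin.span (tensor VB (coradical_filtration B n) \<union>
          tensor (lin.span (\<Union>{D. simple_subcoalgebra B D})) VB) = T ` ?Z"
      unfolding C using Suc
      by (simp add: space_B tensor_reindex_image image_Un[symmetric] span_reindex_image)
    have e2: "T (hcomult A x) \<in> T ` ?Z \<longleftrightarrow> hcomult A x \<in> ?Z" if "x \<in> VA" for x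
    proof
      assume "T (hcomult A x) \<in> T ` ?Z"
      then obtain z where z: "z \<in> ?Z" "T (hcomult A x) = T z" by (elim imageE)
      have "hcomult A x \<in> AA" using comult_A that by auto
      then have "hcomult A x = T' (T z)" by (simp add: T_inverse flip: z(2))
      also have "T' (T z) = z" using z(1) Z by (intro T_inverse) auto
      finally show "hcomult A x \<in> ?Z" using z(1) by simp
    qed (rule imageI)
    have "{y \<in> VB. hcomult B y \<in> T ` ?Z} = \<Phi> ` {x \<in> VA. hcomult A x \<in> ?Z}"
      unfolding space_B Compr_image_eq
      by (intro arg_cong[where f = "(`) \<Phi>"] Collect_cong conj_cong refl) (simp only: comult_B e2)
    then show ?case by (simp only: coradical_filtration.simps e1) blast
  qed
  then show ?thesis ..
qed

lemma coradically_graded_B: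
  assumes "coradically_graded A"
  shows "coradically_graded B"
  using assms
  by (simp add: coradically_graded_def compatible_grading_B coradical_filtration_B grad_B
      image_UN[symmetric] span_reindex_image)

lemma link_indecomposable_B:
  assumes "link_indecomposable A"
  shows "link_indecomposable B"
  unfolding link_indecomposable_def
proof (intro notI, elim exE conjE)
  interpret BA: hopf_reindex B A \<phi>' \<phi> by (rule converse)
  fix D E assume D: "subcoalgebra B D" "D \<noteq> {0}" and E: "subcoalgebra B E" "E \<noteq> {0}"
    and DE: "D \<inter> E = {0}" "lin.span (D \<union> E) = VB"
  have sub: "D \<subseteq> VB" "E \<subseteq> VB" using D E by (auto simp: subcoalgebra_def)
  have "\<Phi>' ` D \<noteq> {0}" "\<Phi>' ` E \<noteq> {0}"
    using D(2) E(2) sub BA.inverse_image by (metis image_empty image_insert reindex_zero)+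
  moreover have "\<Phi>' ` D \<inter> \<Phi>' ` E = {0}"
    using inj_on_image_Int[OF BA.inj_\<Phi> sub] DE(1) by simp
  moreover have "lin.span (\<Phi>' ` D \<union> \<Phi>' ` E) = VA"
    using DE(2) by (simp add: image_Un[symmetric] span_reindex_image BA.space_B)
  moreover have "subcoalgebra A (\<Phi>' ` D)" "subcoalgebra A (\<Phi>' ` E)"
    using BA.subcoalgebra_image D(1) E(1) by auto
  ultimately show False using assms unfolding link_indecomposable_def by blast
qed

lemma hopf_iso_\<Phi>: "hopf_iso A B \<Phi>"
proof -
  have "hcomult B (\<Phi> x) = tmap \<Phi> \<Phi> (hcomult A x)" if "x \<in> VA" for x
    using that by (simp add: comult_B tmap_reindex)
  then show ?thesis
    by (simp add: hopf_iso_def hopf_map_def linear_on_reindex hprod_B one_B counit_B bij_betw_def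
        inj_\<Phi> space_B)
qed

text \<open>
  A Hopf algebra map on \<open>A\<close> induces one on \<open>B\<close>, because \<open>\<Phi>\<close> is surjective and respects all operations.
\<close>

lemma hopf_map_factor:
  assumes "hopf_map A C F" "\<And>x. x \<in> VA \<Longrightarrow> F' (\<Phi> x) = F x"
  shows "hopf_map B C F'"
proof -
  note F = assms(1)[unfolded hopf_map_def]
  have lin: "linear_on VA F" using F by blast
  have lin': "linear_on VB F'"
    unfolding space_B by (rule linear_on_transport[where \<chi> = "\<lambda>x. x", OF lin subspace_A])
       (simp add: assms(2) reindex_ident)
  have "hcomult C (F' (\<Phi> x)) = tmap F' F' (hcomult B (\<Phi> x))" if "x \<in> VA" for x
  proof -
    have z: "hcomult A x \<in> AA" using comult_A that by blast
    have F': "F' (\<Phi> y) = reindex (\<lambda>x. x) (F y)" if "y \<in> VA" for y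
      using that by (simp add: assms(2) reindex_ident)
    have "tmap F' F' (T (hcomult A x)) = rtens (\<lambda>x. x) (\<lambda>x. x) (tmap F F (hcomult A x))"
      by (rule tmap_transport[OF lin subspace_A F' lin subspace_A F' z])
    then show ?thesis using F that by (simp add: comult_B assms(2) reindex_ident)
  qed
  then show ?thesis
    using F lin' one_A unfolding hopf_map_def
    by (auto simp: space_B assms(2) hprod_B hprod_A_in one_B counit_B image_subset_iff)
qed

end

section \<open>Replacing the group of a bosonization by an isomorphic one\<close>

lemma reindex_id [simp]: "reindex (\<lambda>b. b) u = u"
  by (simp add: reindex_ident)

lemma free_UNIV [simp]: "free UNIV = UNIV"
  by (simp add: free_def)

lemma free_image: "reindex \<phi> ` free S = free (\<phi> ` S)"
  by (simp add: free_eq_span span_reindex_image[symmetric] image_image)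

lemma tensor_free_subset: "tensor (free S) (free S') \<subseteq> free (S \<times> S')"
  by (rule tensor_least) (simp_all add: tens_in_free)

lemma tensor_subset_free:
  assumes "U \<subseteq> free S" "W \<subseteq> free S'"
  shows "tensor U W \<subseteq> free (S \<times> S')"
  using tensor_mono[OF assms] tensor_free_subset[of S S'] by blast

lemma keys_inner_leg: "y \<in> tensor U (tensor (free S) W) \<Longrightarrow> supp y \<subseteq> UNIV \<times> (S \<times> UNIV)"
  using tensor_subset_free[OF _ tensor_subset_free[OF subset_refl], of U UNIV W UNIV S]
  by (auto simp: free_def)

lemma linear_on_cong: "(\<And>x. x \<in> U \<Longrightarrow> f x = g x) \<Longrightarrow> lin.subspace U \<Longrightarrow> linear_on U f \<longleftrightarrow> linear_on U g"
  by (simp add: linear_on_def lin.subspace_add lin.subspace_scale)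

lemma braided_graded_hopfD:
  assumes "braided_graded_hopf K R act d"
  shows "yd_module K (hspace R) act d" "is_algebra R" "is_coalgebra R" "compatible_grading R"
    "lin.subspace (hspace R)"
    "\<And>g. g \<in> carrier K \<Longrightarrow> linear_on (hspace R) (act g)"
    "\<And>g r. g \<in> carrier K \<Longrightarrow> r \<in> hspace R \<Longrightarrow> act g r \<in> hspace R"
    "linear_on (hspace R) d"
    "\<And>r. r \<in> hspace R \<Longrightarrow> d r \<in> tensor (free (carrier K)) (hspace R)"
    "linear_on (tensor (hspace R) (hspace R)) (hmult R)"
    "\<And>z. z \<in> tensor (hspace R) (hspace R) \<Longrightarrow> hmult R z \<in> hspace R"
    "hone R \<in> hspace R"
    "linear_on (hspace R) (hcomult R)"
    "\<And>r. r \<in> hspace R \<Longrightarrow> hcomult R r \<in> tensor (hspace R) (hspace R)"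
    "linear_form_on (hspace R) (hcounit R)"
    "\<And>n. hgrad R n \<subseteq> hspace R"
    "\<And>n. lin.subspace (hgrad R n)"
proof -
  show 1: "yd_module K (hspace R) act d" and 2: "is_algebra R" and 3: "is_coalgebra R"
    and 4: "compatible_grading R"
    using assms by (simp_all add: braided_graded_hopf_def hopf_axioms_wrt_def)
  show "hgrad R n \<subseteq> hspace R" for n
    using 4 lin.span_base[of _ "\<Union>n. hgrad R n"] by (auto simp: compatible_grading_def)
  show "lin.subspace (hspace R)" "\<And>g. g \<in> carrier K \<Longrightarrow> linear_on (hspace R) (act g)"
    "\<And>g r. g \<in> carrier K \<Longrightarrow> r \<in> hspace R \<Longrightarrow> act g r \<in> hspace R"
    "linear_on (hspace R) d"
    "\<And>r. r \<in> hspace R \<Longrightarrow> d r \<in> tensor (free (carrier K)) (hspace R)"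
    using 1 by (auto simp: yd_module_def)
  show "linear_on (tensor (hspace R) (hspace R)) (hmult R)"
    "\<And>z. z \<in> tensor (hspace R) (hspace R) \<Longrightarrow> hmult R z \<in> hspace R"
    "hone R \<in> hspace R"
    using 2 by (auto simp: is_algebra_def)
  show "linear_on (hspace R) (hcomult R)"
    "\<And>r. r \<in> hspace R \<Longrightarrow> hcomult R r \<in> tensor (hspace R) (hspace R)"
    "linear_form_on (hspace R) (hcounit R)"
    using 3 by (auto simp: is_coalgebra_def)
  show "\<And>n. lin.subspace (hgrad R n)" using 4 by (auto simp: compatible_grading_def)
qed

text \<open>
  Isomorphic groups \<open>H\<close> and \<open>K\<close> that act and coact on the same \<open>R\<close> in the same way.  The actions and
  coactions are compared on \<open>R\<close> only, since nothing is known about them elsewhere.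
\<close>

locale group_change =
  fixes H :: "'h monoid" and K :: "'g monoid" and \<phi> :: "'h \<Rightarrow> 'g" and \<phi>' :: "'g \<Rightarrow> 'h"
    and R :: "('b, 'k::field) hopf_data"
    and actH :: "'h \<Rightarrow> ('b \<Rightarrow>\<^sub>0 'k) \<Rightarrow> ('b \<Rightarrow>\<^sub>0 'k)" and dH :: "('b \<Rightarrow>\<^sub>0 'k) \<Rightarrow> (('h \<times> 'b) \<Rightarrow>\<^sub>0 'k)"
    and actK :: "'g \<Rightarrow> ('b \<Rightarrow>\<^sub>0 'k) \<Rightarrow> ('b \<Rightarrow>\<^sub>0 'k)" and dK :: "('b \<Rightarrow>\<^sub>0 'k) \<Rightarrow> (('g \<times> 'b) \<Rightarrow>\<^sub>0 'k)"
  assumes group_H: "group H" and group_K: "group K"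
    and iso: "\<phi> \<in> iso H K" and \<phi>': "\<And>h. h \<in> carrier H \<Longrightarrow> \<phi>' (\<phi> h) = h"
    and braided_H: "braided_graded_hopf H R actH dH"
    and actK: "\<And>h r. h \<in> carrier H \<Longrightarrow> r \<in> hspace R \<Longrightarrow> actK (\<phi> h) r = actH h r"
    and dK: "\<And>r. r \<in> hspace R \<Longrightarrow> dK r = rtens \<phi> (\<lambda>b. b) (dH r)"
begin

interpretation H: group H by (rule group_H)
interpretation K: group K by (rule group_K)
interpretation \<phi>: group_hom H K \<phi>
  using iso by unfold_locales (simp add: iso_def)

lemmas R = braided_graded_hopfD[OF braided_H]

abbreviation "V \<equiv> hspace R"
abbreviation "P \<equiv> rtens \<phi> (\<lambda>b. b)"

lemma carrier_K: "carrier K = \<phi> ` carrier H"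
  using iso by (auto simp: iso_def bij_betw_def)

lemma inj_\<phi>: "inj_on \<phi> (carrier H)"
  by (rule inj_on_inverseI) (rule \<phi>')

lemma P_in: "z \<in> tensor (free (carrier H)) W \<Longrightarrow> P z \<in> tensor (free (carrier K)) W"
  by (rule rtens_image[where U = "free (carrier H)" and W = W])
     (auto simp: carrier_K free_image[symmetric])

text \<open>
  Each condition at \<open>\<phi> h\<close> is the one at \<open>h\<close> after relabelling the group elements in the coaction; for the
  Yetter-Drinfeld condition this uses that \<open>\<phi>\<close> respects conjugation.
\<close>

lemma yd_module_K:
  assumes "yd_module H W actH dH" "W \<subseteq> V"
  shows "yd_module K W actK dK"
proof -
  note Y = assms(1)[unfolded yd_module_def]
  have sW: "lin.subspace W" and dlin: "linear_on W dH" using Y by auto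
  have aK: "actK (\<phi> h) w = actH h w" if "h \<in> carrier H" "w \<in> W" for h w
    using actK that assms(2) by auto
  have dKW: "dK w = P (dH w)" if "w \<in> W" for w using dK that assms(2) by auto
  have dHin: "dH w \<in> tensor (free (carrier H)) W" if "w \<in> W" for w using Y that by auto
  have "linear_on W (actK g) \<and> actK g ` W \<subseteq> W" if "g \<in> carrier K" for g
  proof -
    obtain h where h: "g = \<phi> h" "h \<in> carrier H" using \<open>g \<in> carrier K\<close> by (auto simp: carrier_K)
    then have "linear_on W (actK g) \<longleftrightarrow> linear_on W (actH h)"
      by (intro linear_on_cong sW) (simp add: aK)
    moreover have "actK g ` W = actH h ` W" using h by (intro image_cong refl) (simp add: aK)
    ultimately show ?thesis using Y h(2) by simp
  qed
  moreover have "actK \<one>\<^bsub>K\<^esub> w = w" if "w \<in> W" for w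
    using aK[of "\<one>\<^bsub>H\<^esub>" w] Y that by simp
  moreover have "actK (g \<otimes>\<^bsub>K\<^esub> g') w = actK g (actK g' w)"
    if "g \<in> carrier K" "g' \<in> carrier K" "w \<in> W" for g g' w
  proof -
    obtain h h' where h: "g = \<phi> h" "h \<in> carrier H" "g' = \<phi> h'" "h' \<in> carrier H"
      using \<open>g \<in> carrier K\<close> \<open>g' \<in> carrier K\<close> by (auto simp: carrier_K)
    moreover have "actH h' w \<in> W" using Y h that(3) by auto
    ultimately show ?thesis
      using Y that(3) aK[of "h \<otimes>\<^bsub>H\<^esub> h'" w] by (simp add: aK)
  qed
  moreover have "linear_on W dK"
    using linear_on_comp[OF dlin subset_UNIV linear_on_reindex, of "\<lambda>(b, c). (\<phi> b, c)"]
    by (subst linear_on_cong[OF _ sW]) (auto simp: dKW)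
  moreover have "dK ` W \<subseteq> tensor (free (carrier K)) W"
    using P_in[OF dHin] by (auto simp: dKW)
  moreover have "rmap dK (dK w) = reindex (\<lambda>(g, b). (g, g, b)) (dK w)" if "w \<in> W" for w
  proof -
    have "rmap dK (P (dH w)) = rtens \<phi> (\<lambda>(b, c). (\<phi> b, c)) (rmap dH (dH w))"
      by (rule rmap_transport[OF dlin sW _ dHin[OF that]]) (simp add: dKW)
    moreover have "rmap dH (dH w) = reindex (\<lambda>(g, b). (g, g, b)) (dH w)" using Y that by auto
    ultimately show ?thesis using that by (simp add: dKW reindex_reindex case_prod_beta')
  qed
  moreover have "reindex snd (dK w) = w" if "w \<in> W" for w
    using Y that by (simp add: dKW reindex_reindex case_prod_beta')
  moreover have "dK (actK g w) = tmap (reindex (\<lambda>h. g \<otimes>\<^bsub>K\<^esub> h \<otimes>\<^bsub>K\<^esub> inv\<^bsub>K\<^esub> g)) (actK g) (dK w)"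
    if "g \<in> carrier K" "w \<in> W" for g w
  proof -
    obtain h where h: "g = \<phi> h" "h \<in> carrier H" using \<open>g \<in> carrier K\<close> by (auto simp: carrier_K)
    have lin: "linear_on W (actH h)" and "actH h w \<in> W" using Y h(2) that(2) by auto
    have "tmap (reindex (\<lambda>h. g \<otimes>\<^bsub>K\<^esub> h \<otimes>\<^bsub>K\<^esub> inv\<^bsub>K\<^esub> g)) (actK g) (P (dH w)) =
        P (tmap (reindex (\<lambda>h'. h \<otimes>\<^bsub>H\<^esub> h' \<otimes>\<^bsub>H\<^esub> inv\<^bsub>H\<^esub> h)) (actH h) (dH w))"
    proof (rule tmap_transport[OF linear_on_reindex subspace_free _ lin sW _ dHin[OF that(2)]])
      fix x :: "'h \<Rightarrow>\<^sub>0 'k" assume "x \<in> free (carrier H)"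
      then show "reindex (\<lambda>h. g \<otimes>\<^bsub>K\<^esub> h \<otimes>\<^bsub>K\<^esub> inv\<^bsub>K\<^esub> g) (reindex \<phi> x) =
          reindex \<phi> (reindex (\<lambda>h'. h \<otimes>\<^bsub>H\<^esub> h' \<otimes>\<^bsub>H\<^esub> inv\<^bsub>H\<^esub> h) x)"
        unfolding reindex_reindex using h by (intro reindex_cong) (auto simp: free_def)
    qed (use h in \<open>simp add: aK\<close>)
    moreover have "dH (actH h w) =
        tmap (reindex (\<lambda>h'. h \<otimes>\<^bsub>H\<^esub> h' \<otimes>\<^bsub>H\<^esub> inv\<^bsub>H\<^esub> h)) (actH h) (dH w)"
      using Y h(2) that(2) by blast
    ultimately show ?thesis
      using h that \<open>actH h w \<in> W\<close> by (simp add: aK dKW)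
  qed
  ultimately show ?thesis unfolding yd_module_def using sW by (intro conjI ballI) auto
qed

text \<open>
  The braiding \<open>u \<otimes> w \<mapsto> u\<^sub>(\<^sub>-\<^sub>1\<^sub>).w \<otimes> u\<^sub>(\<^sub>0\<^sub>)\<close> sees the group only through the action of the degree of \<open>u\<close> on
  \<open>w\<close>, so it is the same for \<open>H\<close> and \<open>K\<close>.
\<close>

lemma yd_braiding_K:
  assumes z: "z \<in> tensor V V"
  shows "yd_braiding actK dK z = yd_braiding actH dH z"
proof -
  define y where "y = lmap dH z"
  let ?\<sigma> = "\<lambda>((h, b), c). ((\<phi> h, b), c)"
  let ?S = "(carrier H \<times> UNIV) \<times> UNIV"
  have y: "y \<in> tensor (tensor (free (carrier H)) V) V"
    unfolding y_def by (rule lmap_in[OF R(8,5) _ z]) (use R(9) in auto)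
  have yfree: "y \<in> free ?S"
    by (rule tensor_subset_free[OF tensor_subset_free[OF subset_refl], THEN subsetD, OF _ _ y]) auto
  have inj: "inj_on ?\<sigma> ?S" using inj_\<phi> by (auto simp: inj_on_def)
  have "lmap dK (rtens (\<lambda>b. b) (\<lambda>b. b) z) = rtens (\<lambda>(h, b). (\<phi> h, b)) (\<lambda>b. b) y"
    unfolding y_def by (rule lmap_transport[OF R(8,5) _ z]) (simp add: dK)
  then have yK: "lmap dK z = reindex ?\<sigma> y" by (simp add: case_prod_beta')
  have keys: "supp (reindex ?\<sigma> y) = ?\<sigma> ` supp y"
    by (rule keys_reindex_inj) (use inj yfree in \<open>auto simp: free_def intro: inj_on_subset\<close>)
  let ?I = "(fst \<circ> fst) ` supp y"
  have I: "?I \<subseteq> carrier H" using yfree by (auto simp: free_def)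
  have "(fst \<circ> fst) ` supp (lmap dK z) = \<phi> ` ?I"
    by (force simp: yK keys)
  then have "yd_braiding actK dK z = (\<Sum>g\<in>\<phi> ` ?I.
      flip (rmap (actK g) (Poly_Mapping.map_key (\<lambda>(b, c). ((g, b), c)) (reindex ?\<sigma> y))))"
    by (simp add: yd_braiding_def yK)
  also have "\<dots> = (\<Sum>h\<in>?I.
      flip (rmap (actK (\<phi> h)) (Poly_Mapping.map_key (\<lambda>(b, c). ((\<phi> h, b), c)) (reindex ?\<sigma> y))))"
    using inj_on_subset[OF inj_\<phi> I] by (simp add: sum.reindex)
  also have "\<dots> = (\<Sum>h\<in>?I. flip (rmap (actH h) (Poly_Mapping.map_key (\<lambda>(b, c). ((h, b), c)) y)))"
  proof (intro sum.cong refl arg_cong[where f = flip])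
    fix h assume "h \<in> ?I"
    then have h: "h \<in> carrier H" using I by auto
    let ?u = "Poly_Mapping.map_key (\<lambda>(b, c). ((h, b), c)) y"
    have ij: "inj (\<lambda>(b, c). ((g, b), c))" for g :: 'x by (auto simp: inj_def)
    have lu: "coeff ?u (b, c) = coeff y ((h, b), c)" for b c
      by (simp add: map_key.rep_eq[OF ij])
    have "Poly_Mapping.map_key (\<lambda>(b, c). ((\<phi> h, b), c)) (reindex ?\<sigma> y) = ?u"
    proof (rule poly_mapping_eq2I)
      fix b c
      have ij': "inj (\<lambda>(b, c). ((\<phi> h, b), c))" by (auto simp: inj_def)
      show "coeff (Poly_Mapping.map_key (\<lambda>(b, c). ((\<phi> h, b), c)) (reindex ?\<sigma> y)) (b, c) =
          coeff ?u (b, c)"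
        using lookup_reindex_inj[OF inj _, of y "((h, b), c)"] h yfree
        by (simp add: map_key.rep_eq[OF ij'] lu free_def)
    qed
    moreover have "rmap (actK (\<phi> h)) ?u = rmap (actH h) ?u"
    proof (rule rmap_cong)
      fix b
      have "rsec ?u b = rsec y (h, b)" by (rule poly_mapping_eqI) (simp add: lu)
      then have "rsec ?u b \<in> V" using rsec_in[OF y R(5)] by simp
      then show "actK (\<phi> h) (rsec ?u b) = actH h (rsec ?u b)" using h by (rule actK[rotated])
    qed
    ultimately show "rmap (actK (\<phi> h)) (Poly_Mapping.map_key (\<lambda>(b, c). ((\<phi> h, b), c)) (reindex ?\<sigma> y)) =
        rmap (actH h) ?u" by simp
  qed
  finally show ?thesis by (simp add: yd_braiding_def y_def)
qed

lemma middle_braiding_K: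
  assumes z: "z \<in> tensor (tensor V V) (tensor V V)"
  shows "middle (yd_braiding actK dK) z = middle (yd_braiding actH dH) z"
proof -
  let ?y = "reindex (\<lambda>((x, y), (y', w)). (x, (y, y'), w)) z"
  have y: "?y \<in> tensor V (tensor (tensor V V) V)"
  proof (rule bilinear_tensor_image[OF _ _ z])
    fix a b c d assume V: "a \<in> V" "b \<in> V" "c \<in> V" "d \<in> V"
    let ?s = "\<lambda>((x, y), (y', w)). (x, (y, y'), w)"
    have inj: "inj ?s" by (auto simp: inj_def)
    have "coeff (reindex ?s z) (x, (y, y'), w) = coeff z ((x, y), (y', w))"
      for z :: "(('b \<times> 'b) \<times> ('b \<times> 'b)) \<Rightarrow>\<^sub>0 'k" and x y y' w
      using lookup_reindex_inj[OF inj subset_UNIV, of "((x, y), (y', w))" z] by simp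
    then have "reindex ?s (tens (tens a b) (tens c d)) = tens a (tens (tens b c) d)"
      by (intro poly_mapping_eqI) (auto simp: ac_simps)
    then show "reindex ?s (tens (tens a b) (tens c d)) \<in> tensor V (tensor (tensor V V) V)"
      using V by (simp add: tens_in_tensor)
  qed simp
  have "rmap (lmap (yd_braiding actK dK)) ?y = rmap (lmap (yd_braiding actH dH)) ?y"
  proof (intro rmap_cong lmap_cong yd_braiding_K)
    fix b c
    show "lsec (rsec ?y b) c \<in> tensor V V"
      by (rule lsec_in[OF rsec_in[OF y subspace_tensor] subspace_tensor])
  qed
  then show ?thesis by (simp add: middle_def)
qed

lemma codiagonal_K:
  assumes z: "z \<in> tensor V V"
  shows "codiagonal K dK z = P (codiagonal H dH z)"
    and "codiagonal H dH z \<in> tensor (free (carrier H)) (tensor V V)"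
proof -
  let ?m = "\<lambda>M ((g, b), (h, c)). (g \<otimes>\<^bsub>M\<^esub> h, b, c)"
  have dHV: "dH ` V \<subseteq> tensor (free (carrier H)) V" using R(9) by auto
  have y: "tmap dH dH z \<in> tensor (tensor (free (carrier H)) V) (tensor (free (carrier H)) V)"
    by (rule tmap_in[OF R(8,5,8,5) dHV dHV z])
  then have keys: "supp (tmap dH dH z) \<subseteq> (carrier H \<times> UNIV) \<times> (carrier H \<times> UNIV)"
    using tensor_subset_free[OF tensor_subset_free[OF subset_refl] tensor_subset_free[OF subset_refl],
        of V UNIV V UNIV "carrier H" "carrier H"]
    by (auto simp: free_def)
  have "tmap dK dK (rtens (\<lambda>b. b) (\<lambda>b. b) z) =
      rtens (\<lambda>(h, b). (\<phi> h, b)) (\<lambda>(h, b). (\<phi> h, b)) (tmap dH dH z)"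
    by (rule tmap_transport[OF R(8,5) _ R(8,5) _ z]) (simp_all add: dK)
  then have "tmap dK dK z = rtens (\<lambda>(h, b). (\<phi> h, b)) (\<lambda>(h, b). (\<phi> h, b)) (tmap dH dH z)"
    by (simp add: case_prod_beta')
  then have "codiagonal K dK z = reindex (\<lambda>((g, b), (h, c)). (\<phi> g \<otimes>\<^bsub>K\<^esub> \<phi> h, b, c)) (tmap dH dH z)"
    by (simp add: codiagonal_def reindex_reindex case_prod_beta')
  also have "\<dots> = reindex (\<lambda>((g, b), (h, c)). (\<phi> (g \<otimes>\<^bsub>H\<^esub> h), b, c)) (tmap dH dH z)"
    using keys by (intro reindex_cong) auto
  finally show "codiagonal K dK z = P (codiagonal H dH z)"
    by (simp add: codiagonal_def reindex_reindex case_prod_beta')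
  show "codiagonal H dH z \<in> tensor (free (carrier H)) (tensor V V)"
    unfolding codiagonal_def
  proof (rule linear_on_tensor_image[OF linear_on_reindex subspace_tensor, THEN subsetD, OF _ imageI, OF _ y])
    fix u w assume u: "u \<in> tensor (free (carrier H)) V" and w: "w \<in> tensor (free (carrier H)) V"
    have 1: "reindex (?m H) (tens (tens (bvec g) a) (tens (bvec h) b)) =
        tens (bvec (g \<otimes>\<^bsub>H\<^esub> h)) (tens a b)" for g h and a b :: "'b \<Rightarrow>\<^sub>0 'k"
    proof -
      have "tens (tens (bvec g) a) (tens (bvec h) b) =
        reindex (\<lambda>(b, c). ((g, b), (h, c))) (tens a b)"
        using reindex_tens[of "Pair g" "Pair h" a b]
        by (simp add: reindex_tens_bvec_left[symmetric])
           (simp add: reindex_def linext_bvec_id linext_tens_left[symmetric] linext_tens_right[symmetric] flip: tens_bvec)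
      moreover have "tens (bvec (g \<otimes>\<^bsub>H\<^esub> h)) (tens a b) = reindex (\<lambda>p. (g \<otimes>\<^bsub>H\<^esub> h, p)) (tens a b)"
        by (simp add: reindex_def linext_bvec_id linext_tens_right[symmetric] flip: tens_bvec)
      ultimately show ?thesis by (simp add: reindex_reindex case_prod_beta')
    qed
    show "reindex (?m H) (tens u w) \<in> tensor (free (carrier H)) (tensor V V)"
      apply (subst rsec_expand[of u], subst rsec_expand[of w])
      unfolding tens_sum_left tens_sum_right reindex_sum 1
      using u w
      by (intro lin.subspace_sum subspace_tensor tens_in_tensor)
         (auto simp: tensor_free_left_iff[OF R(5)] image_subset_iff intro!: H.m_closed)
  qed
qed

lemma braided_K: "braided_graded_hopf K R actK dK"
proof -
  note B = braided_H[unfolded braided_graded_hopf_def]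
  have hopf: "hopf_axioms_wrt (yd_braiding actH dH) R" using B by blast
  have "middle (yd_braiding actK dK) (tens (hcomult R x) (hcomult R y)) =
      middle (yd_braiding actH dH) (tens (hcomult R x) (hcomult R y))" if "x \<in> V" "y \<in> V" for x y
    by (intro middle_braiding_K tens_in_tensor R(14) that)
  then have "hopf_axioms_wrt (yd_braiding actK dK) R"
    using hopf unfolding hopf_axioms_wrt_def by simp
  moreover have "(\<forall>x\<in>V. \<forall>y\<in>V. actK g (hprod R x y) = hprod R (actK g x) (actK g y)) \<and>
      actK g (hone R) = hone R \<and>
      (\<forall>x\<in>V. hcomult R (actK g x) = tmap (actK g) (actK g) (hcomult R x)) \<and>
      (\<forall>x\<in>V. hcounit R (actK g x) = hcounit R x)" if "g \<in> carrier K" for g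
  proof -
    obtain h where h: "g = \<phi> h" "h \<in> carrier H" using \<open>g \<in> carrier K\<close> by (auto simp: carrier_K)
    have "tmap (actH h) (actH h) (hcomult R x) = tmap (actK g) (actK g) (hcomult R x)" if "x \<in> V" for x
      by (rule tmap_cong[OF R(14)[OF that] R(5,5) R(6)[OF h(2)] R(6)[OF h(2)]])
         (simp_all add: h actK)
    then show ?thesis using B h R(7,11,12) by (simp add: actK tens_in_tensor)
  qed
  moreover have "dK (hmult R z) = rmap (hmult R) (codiagonal K dK z)" if z: "z \<in> tensor V V" for z
  proof -
    have "rmap (hmult R) (P (codiagonal H dH z)) = P (rmap (hmult R) (codiagonal H dH z))"
      by (rule rmap_transport[OF R(10) subspace_tensor _ codiagonal_K(2)[OF z]])
         (simp add: case_prod_beta')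
    then show ?thesis using B z by (simp add: dK R(11) codiagonal_K)
  qed
  moreover have "dK (hone R) = tens (bvec \<one>\<^bsub>K\<^esub>) (hone R)"
    using B by (simp add: dK R(12) reindex_tens)
  moreover have "rmap (hcomult R) (dK x) = codiagonal K dK (hcomult R x)" if x: "x \<in> V" for x
  proof -
    have "rmap (hcomult R) (P (dH x)) = rtens \<phi> (\<lambda>b. b) (rmap (hcomult R) (dH x))"
      by (rule rmap_transport[OF R(13,5) _ R(9)[OF x]]) simp
    then show ?thesis using B x by (simp add: dK R(14) codiagonal_K)
  qed
  moreover have "rcontract (hcounit R) (dK x) = Poly_Mapping.single \<one>\<^bsub>K\<^esub> (hcounit R x)"
    if x: "x \<in> V" for x
  proof -
    have "rcontract (hcounit R) (P (dH x)) = reindex \<phi> (rcontract (hcounit R) (dH x))"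
      by (rule rcontract_transport[OF R(15,5) _ R(9)[OF x]]) simp
    then show ?thesis using B x by (simp add: dK reindex_def linext_single scl_single)
  qed
  moreover have "actK g ` hgrad R n \<subseteq> hgrad R n" if "g \<in> carrier K" for g n
  proof -
    obtain h where h: "g = \<phi> h" "h \<in> carrier H" using \<open>g \<in> carrier K\<close> by (auto simp: carrier_K)
    have "actK g ` hgrad R n = actH h ` hgrad R n"
      using h R(16) by (intro image_cong refl) (auto simp: actK subset_iff)
    then show ?thesis using B h by simp
  qed
  moreover have "dK ` hgrad R n \<subseteq> tensor (free (carrier K)) (hgrad R n)" for n
  proof -
    have "dK x \<in> tensor (free (carrier K)) (hgrad R n)" if "x \<in> hgrad R n" for x
      using P_in[of "dH x" "hgrad R n"] B that R(16) by (auto simp: dK subset_iff image_subset_iff)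
    then show ?thesis by auto
  qed
  ultimately show ?thesis
    unfolding braided_graded_hopf_def using yd_module_K[OF R(1) subset_refl] R(4)
    by (intro conjI ballI allI) simp_all
qed

abbreviation "bosH \<equiv> bosonization H R actH dH"
abbreviation "bosK \<equiv> bosonization K R actK dK"

lemma space_bosonization: "hspace (bosonization M R act d) = tensor V (free (carrier M))"
  by (simp add: bosonization_def)

lemma space_bosH_keys: "z \<in> hspace bosH \<Longrightarrow> supp z \<subseteq> UNIV \<times> carrier H"
  using tensor_subset_free[of V UNIV "free (carrier H)" "carrier H"]
  by (auto simp: space_bosonization free_def)

text \<open>
  The isomorphism \<open>r # h \<mapsto> r # \<phi> h\<close>.  The operations of a bosonization are sums over the group elements
  that occur in the arguments; \<open>\<phi>\<close> is a bijection between these index sets and matches the summands.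
\<close>

lemma bosonization_transport:
  assumes "is_algebra bosH" "is_coalgebra bosH" "compatible_grading bosH"
  shows "hopf_reindex bosH bosK (\<lambda>(p, h). (p, \<phi> h)) (\<lambda>(p, g). (p, \<phi>' g))"
proof
  let ?\<psi> = "\<lambda>(p, h). (p, \<phi> h)" and ?\<psi>' = "\<lambda>(p, g). (p, \<phi>' g)"
  let ?S = "UNIV \<times> carrier H"
  have inj\<psi>: "inj_on ?\<psi> ?S" using inj_\<phi> by (auto simp: inj_on_def)
  show "lin.subspace (hspace bosH)" "hmult bosH ` tensor (hspace bosH) (hspace bosH) \<subseteq> hspace bosH"
    "hone bosH \<in> hspace bosH" "hcomult bosH ` hspace bosH \<subseteq> tensor (hspace bosH) (hspace bosH)"
    using assms(1,2) by (simp_all add: is_algebra_def is_coalgebra_def)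
  show "hgrad bosH n \<subseteq> hspace bosH" for n
    using assms(3) lin.span_base[of _ "\<Union>n. hgrad bosH n"] by (auto simp: compatible_grading_def)
  show "reindex ?\<psi>' (reindex ?\<psi> x) = x" if "x \<in> hspace bosH" for x
    unfolding reindex_reindex using space_bosH_keys[OF that]
    by (intro reindex_ident) (auto simp: \<phi>')
  have freeK: "free (carrier K) = reindex \<phi> ` free (carrier H)" by (simp add: carrier_K free_image)
  have image: "tensor W (free (carrier K)) = reindex ?\<psi> ` tensor W (free (carrier H))"
    for W :: "('b \<Rightarrow>\<^sub>0 'k) set"
    using tensor_reindex_image[of "\<lambda>b. b" W \<phi> "free (carrier H)"] by (simp add: freeK)
  show "hspace bosK = reindex ?\<psi> ` hspace bosH" by (simp add: space_bosonization image)
  show "hgrad bosK n = reindex ?\<psi> ` hgrad bosH n" for n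
    by (simp add: bosonization_def image)
  show "hone bosK = reindex ?\<psi> (hone bosH)"
    using reindex_tens[of "\<lambda>b. b" \<phi> "hone R" "bvec \<one>\<^bsub>H\<^esub>"] by (simp add: bosonization_def)
  have component: "lsec (reindex ?\<psi> x) (\<phi> g) = lsec x g"
    if "x \<in> hspace bosH" "g \<in> carrier H" for x g
  proof (rule poly_mapping_eqI)
    fix b
    show "coeff (lsec (reindex ?\<psi> x) (\<phi> g)) b = coeff (lsec x g) b"
      using lookup_reindex_inj[OF inj\<psi> space_bosH_keys[OF that(1)], of "(b, g)"] that(2) by simp
  qed
  have snd_keys: "snd ` supp (reindex ?\<psi> x) = \<phi> ` snd ` supp x"
    and inj_snd: "inj_on \<phi> (snd ` supp x)" and sndH: "snd ` supp x \<subseteq> carrier H"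
    if "x \<in> hspace bosH" for x
  proof -
    have "supp (reindex ?\<psi> x) = ?\<psi> ` supp x"
      by (rule keys_reindex_inj[OF inj_on_subset[OF inj\<psi> space_bosH_keys[OF that]]])
    then show "snd ` supp (reindex ?\<psi> x) = \<phi> ` snd ` supp x" by force
    show "snd ` supp x \<subseteq> carrier H" using space_bosH_keys[OF that] by auto
    then show "inj_on \<phi> (snd ` supp x)" by (rule inj_on_subset[OF inj_\<phi>])
  qed
  show "hcounit bosK (reindex ?\<psi> x) = hcounit bosH x" if x: "x \<in> hspace bosH" for x
  proof -
    have "hcounit bosK (reindex ?\<psi> x) =
        (\<Sum>g\<in>\<phi> ` snd ` supp x. hcounit R (lsec (reindex ?\<psi> x) g))"
      by (simp add: bosonization_def snd_keys[OF x])
    also have "\<dots> = (\<Sum>h\<in>snd ` supp x. hcounit R (lsec (reindex ?\<psi> x) (\<phi> h)))"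
      by (rule sum.reindex[OF inj_snd[OF x], unfolded o_def])
    also have "\<dots> = (\<Sum>h\<in>snd ` supp x. hcounit R (lsec x h))"
      by (intro sum.cong refl arg_cong[where f = "hcounit R"] component[OF x]) (use sndH[OF x] in auto)
    finally show ?thesis by (simp add: bosonization_def)
  qed
  show "hcomult bosK (reindex ?\<psi> x) = rtens ?\<psi> ?\<psi> (hcomult bosH x)" if x: "x \<in> hspace bosH" for x
  proof -
    let ?C = "\<lambda>M d g u. reindex (\<lambda>(b, (h, c)). ((b, h \<otimes>\<^bsub>M\<^esub> g), (c, g))) (rmap d (hcomult R u))"
    have summand: "?C K dK (\<phi> g) u = rtens ?\<psi> ?\<psi> (?C H dH g u)" if u: "u \<in> V" and g: "g \<in> carrier H" for u g
    proof -
      let ?y = "rmap dH (hcomult R u)"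
      have keys: "supp ?y \<subseteq> UNIV \<times> (carrier H \<times> UNIV)"
        by (rule keys_inner_leg, rule rmap_in[OF R(8,5) _ R(14)[OF u]]) (use R(9) in auto)
      have "rmap dK (rtens (\<lambda>b. b) (\<lambda>b. b) (hcomult R u)) = rtens (\<lambda>b. b) (\<lambda>(h, b). (\<phi> h, b)) ?y"
        by (rule rmap_transport[OF R(8,5) _ R(14)[OF u]]) (simp add: dK)
      then have "rmap dK (hcomult R u) = rtens (\<lambda>b. b) (\<lambda>(h, b). (\<phi> h, b)) ?y"
        by (simp add: case_prod_beta')
      then have "?C K dK (\<phi> g) u = reindex (\<lambda>(b, (h, c)). ((b, \<phi> h \<otimes>\<^bsub>K\<^esub> \<phi> g), (c, \<phi> g))) ?y"
        by (simp add: reindex_reindex case_prod_beta')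
      also have "\<dots> = reindex (\<lambda>(b, (h, c)). ((b, \<phi> (h \<otimes>\<^bsub>H\<^esub> g)), (c, \<phi> g))) ?y"
        using keys g by (intro reindex_cong) auto
      finally show ?thesis by (simp add: reindex_reindex case_prod_beta')
    qed
    have "hcomult bosK (reindex ?\<psi> x) =
        (\<Sum>g\<in>\<phi> ` snd ` supp x. ?C K dK g (lsec (reindex ?\<psi> x) g))"
      by (simp add: bosonization_def snd_keys[OF x])
    also have "\<dots> = (\<Sum>h\<in>snd ` supp x. ?C K dK (\<phi> h) (lsec (reindex ?\<psi> x) (\<phi> h)))"
      by (rule sum.reindex[OF inj_snd[OF x], unfolded o_def])
    also have "\<dots> = (\<Sum>h\<in>snd ` supp x. rtens ?\<psi> ?\<psi> (?C H dH h (lsec x h)))"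
    proof (rule sum.cong[OF refl])
      fix h assume "h \<in> snd ` supp x"
      then have h: "h \<in> carrier H" using sndH[OF x] by auto
      have "lsec x h \<in> V" using x lsec_in[OF _ R(5)] by (simp add: space_bosonization)
      then show "?C K dK (\<phi> h) (lsec (reindex ?\<psi> x) (\<phi> h)) = rtens ?\<psi> ?\<psi> (?C H dH h (lsec x h))"
        by (simp only: component[OF x h] summand[OF _ h])
    qed
    finally show ?thesis by (simp add: bosonization_def reindex_sum)
  qed
  show "hmult bosK (rtens ?\<psi> ?\<psi> z) = reindex ?\<psi> (hmult bosH z)"
    if z: "z \<in> tensor (hspace bosH) (hspace bosH)" for z
  proof -
    let ?w = "rtens ?\<psi> ?\<psi> z"
    let ?S2 = "?S \<times> ?S"
    let ?\<sigma> = "\<lambda>(b, c). (?\<psi> b, ?\<psi> c)"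
    let ?p = "\<lambda>((b, g), (c, h)). (g, h)"
    let ?sec = "\<lambda>y g h. Poly_Mapping.map_key (\<lambda>(b, c). ((b, g), (c, h))) y"
    have "hspace bosH \<subseteq> free ?S" using space_bosH_keys by (auto simp: free_def)
    then have "tensor (hspace bosH) (hspace bosH) \<subseteq> free ?S2" by (intro tensor_subset_free)
    then have keysz: "supp z \<subseteq> ?S2" using z by (auto simp: free_def)
    have inj: "inj_on ?\<sigma> ?S2" using inj_\<phi> by (auto simp: inj_on_def)
    have keysw: "supp ?w = ?\<sigma> ` supp z"
      by (rule keys_reindex_inj[OF inj_on_subset[OF inj keysz]])
    let ?I = "?p ` supp z"
    have I: "?I \<subseteq> carrier H \<times> carrier H" using keysz by auto
    have pw: "?p ` supp ?w = (\<lambda>(g, h). (\<phi> g, \<phi> h)) ` ?I"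
      unfolding keysw image_image by (simp add: case_prod_beta')
    have "inj_on (\<lambda>(g, h). (\<phi> g, \<phi> h)) (carrier H \<times> carrier H)"
      using inj_\<phi> by (auto simp: inj_on_def)
    then have injI: "inj_on (\<lambda>(g, h). (\<phi> g, \<phi> h)) ?I" by (rule inj_on_subset[OF _ I])
    have ij: "inj (\<lambda>(b, c). ((b, g), (c, h)))" for g :: 'x and h :: 'y by (auto simp: inj_def)
    have sec: "?sec ?w (\<phi> g) (\<phi> h) = ?sec z g h" if "g \<in> carrier H" "h \<in> carrier H" for g h
    proof (rule poly_mapping_eq2I)
      fix b c
      show "coeff (?sec ?w (\<phi> g) (\<phi> h)) (b, c) = coeff (?sec z g h) (b, c)"
        using lookup_reindex_inj[OF inj keysz, of "((b, g), (c, h))"] that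
        by (simp add: map_key.rep_eq[OF ij])
    qed
    have secV: "rsec (?sec z g h) b \<in> V" for g h b
    proof -
      have "rsec (?sec z g h) b = lsec (rsec z (b, g)) h"
        by (rule poly_mapping_eqI) (simp add: map_key.rep_eq[OF ij])
      moreover have "rsec z (b, g) \<in> tensor V (free (carrier H))"
        using rsec_in[OF z] by (simp add: space_bosonization)
      ultimately show ?thesis using lsec_in[OF _ R(5)] by simp
    qed
    have "hmult bosK ?w = (\<Sum>(g, h)\<in>(\<lambda>(g, h). (\<phi> g, \<phi> h)) ` ?I.
        tens (hmult R (rmap (actK g) (?sec ?w g h))) (bvec (g \<otimes>\<^bsub>K\<^esub> h)))"
      by (simp only: bosonization_def hopf_data.simps pw)
    also have "\<dots> = (\<Sum>(g, h)\<in>?I.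
        tens (hmult R (rmap (actK (\<phi> g)) (?sec ?w (\<phi> g) (\<phi> h)))) (bvec (\<phi> g \<otimes>\<^bsub>K\<^esub> \<phi> h)))"
      unfolding sum.reindex[OF injI] by (intro sum.cong refl) (simp add: case_prod_beta')
    also have "\<dots> = (\<Sum>(g, h)\<in>?I.
        reindex ?\<psi> (tens (hmult R (rmap (actH g) (?sec z g h))) (bvec (g \<otimes>\<^bsub>H\<^esub> h))))"
    proof (intro sum.cong refl, clarify del: imageE)
      fix g h assume "(g, h) \<in> ?I"
      then have gh: "g \<in> carrier H" "h \<in> carrier H" using I by auto
      have "rmap (actK (\<phi> g)) (?sec z g h) = rmap (actH g) (?sec z g h)"
        by (intro rmap_cong actK gh secV)
      then show "tens (hmult R (rmap (actK (\<phi> g)) (?sec ?w (\<phi> g) (\<phi> h)))) (bvec (\<phi> g \<otimes>\<^bsub>K\<^esub> \<phi> h)) =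
          reindex ?\<psi> (tens (hmult R (rmap (actH g) (?sec z g h))) (bvec (g \<otimes>\<^bsub>H\<^esub> h)))"
        using reindex_tens[of "\<lambda>b. b" \<phi> "hmult R (rmap (actH g) (?sec z g h))" "bvec (g \<otimes>\<^bsub>H\<^esub> h)"] gh
        by (simp add: sec[OF gh])
    qed
    also have "\<dots> = reindex ?\<psi> (hmult bosH z)"
      by (simp only: bosonization_def hopf_data.simps reindex_sum case_prod_beta')
    finally show ?thesis .
  qed
qed

end

section \<open>The degrees of the letters in the covering group\<close>

lemma tens_bvec_right: "tens u (bvec k) = reindex (\<lambda>b. (b, k)) u"
  using reindex_tens_bvec_right[of "\<lambda>p. p" u k] by simp

lemma tens_bvec_left: "tens (bvec k) u = reindex (\<lambda>b. (k, b)) u"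
  using reindex_tens_bvec_left[of "\<lambda>p. p" k u] by simp

lemma tens_reindex: "tens (reindex \<phi> u) (reindex \<chi> w) = reindex (\<lambda>(b, c). (\<phi> b, \<chi> c)) (tens u w)"
  by (rule reindex_tens[symmetric])

lemma tens_reindex_right: "tens u (reindex \<chi> w) = reindex (\<lambda>(b, c). (b, \<chi> c)) (tens u w)"
  using tens_reindex[of "\<lambda>b. b" u] by simp

lemma path_coaction_bvec:
  assumes "\<And>x. x \<in> X \<Longrightarrow> d (bvec x) = bvec (g x, x)" "set p \<subseteq> X"
  shows "path_coaction K d p = bvec (path_value K g p, p)"
  using assms(2) by (induction p) (simp_all add: assms(1))

text \<open>
  If the letters are homogeneous, so is every path, and its degree is the product of those of its letters.
\<close>

lemma tensor_coaction_paths: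
  assumes "\<And>x. x \<in> X \<Longrightarrow> d (bvec x) = bvec (g x, x)" "r \<in> free (lists X)"
  shows "tensor_coaction K d r = reindex (\<lambda>p. (path_value K g p, p)) r"
  unfolding tensor_coaction_def reindex_def
  by (rule linext_cong, rule path_coaction_bvec[OF assms(1)]) (use assms(2) in \<open>auto simp: free_def\<close>)

lemma tensor_action_letter: "tensor_action act g (bvec [x]) = reindex (\<lambda>y. [y]) (act g (bvec x))"
  by (simp add: tensor_action_def reindex_tens_bvec_right)

lemma bvec_nonzero [simp]: "bvec b \<noteq> (0 :: 'b \<Rightarrow>\<^sub>0 'k::field)"
  by (metis lookup_single_eq lookup_zero zero_neq_one)

lemma lookup_deconcatenation:
  fixes u :: "'a list \<Rightarrow>\<^sub>0 'k::field"
  shows "coeff (linext (\<lambda>p. \<Sum>i\<le>length p. bvec (take i p, drop i p)) u) (a, b) =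
    coeff u (a @ b)"
proof -
  have cut: "coeff (\<Sum>i\<le>length p. bvec (take i p, drop i p)) (a, b) = (if p = a @ b then 1 else 0 :: 'k)"
    for p
  proof -
    have "(take i p = a \<and> drop i p = b) \<longleftrightarrow> (p = a @ b \<and> i = length a)" if "i \<le> length p" for i
      using that by auto
    then have "coeff (\<Sum>i\<le>length p. bvec (take i p, drop i p)) (a, b) =
        (\<Sum>i\<le>length p. if i = length a then (if p = a @ b then 1 else 0 :: 'k) else 0)"
      unfolding lookup_sum by (intro sum.cong) (auto simp: lookup_single when_def)
    then show ?thesis by (auto simp: sum.delta)
  qed
  show ?thesis unfolding lookup_linext cut
    by (simp add: if_distrib sum.delta in_keys_iff cong: if_cong)
qed

text \<open>
  Both factors have to be nonzero for the group elements \<open>g\<close> and \<open>h\<close> to occur in the index set of the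
  defining sum.
\<close>

lemma bosonization_mult:
  assumes "u \<noteq> 0" "w \<noteq> 0" "w \<in> W" "linear_on W (act g)" "lin.subspace W"
  shows "hprod (bosonization K R act d) (tens u (bvec g)) (tens w (bvec h)) =
    tens (hprod R u (act g w)) (bvec (g \<otimes>\<^bsub>K\<^esub> h))"
proof -
  let ?z = "tens (tens u (bvec g)) (tens w (bvec h))"
  obtain b c where "b \<in> supp u" "c \<in> supp w"
    using assms(1,2) by (metis all_not_in_conv keys_eq_empty)
  then have 1: "(\<lambda>((b, g), (c, h)). (g, h)) ` supp ?z = {(g, h)}"
    by (force simp: keys_tens image_iff)
  have ij: "inj (\<lambda>(b, c). ((b, g), (c, h)))" by (auto simp: inj_def)
  have 2: "Poly_Mapping.map_key (\<lambda>(b, c). ((b, g), (c, h))) ?z = tens u w"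
    by (rule poly_mapping_eq2I) (simp add: map_key.rep_eq[OF ij])
  show ?thesis
    by (simp add: bosonization_def 1 2 rmap_tens[OF assms(4,5,3)])
qed

lemma bosonization_comult:
  assumes "r \<noteq> 0"
  shows "hcomult (bosonization K R act d) (tens r (bvec g)) =
    reindex (\<lambda>(b, (h, c)). ((b, h \<otimes>\<^bsub>K\<^esub> g), (c, g))) (rmap d (hcomult R r))"
proof -
  have "supp r \<noteq> {}" using assms by auto
  then have "snd ` supp (tens r (bvec g)) = {g}" by (auto simp: keys_tens)
  then show ?thesis by (simp add: bosonization_def)
qed

locale nichols_covering =
  fixes G :: "'a monoid" and X :: "'a set"
    and act :: "'a \<Rightarrow> ('a \<Rightarrow>\<^sub>0 'k::field) \<Rightarrow> ('a \<Rightarrow>\<^sub>0 'k)"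
    and d :: "('a \<Rightarrow>\<^sub>0 'k) \<Rightarrow> (('a \<times> 'a) \<Rightarrow>\<^sub>0 'k)"
    and R :: "('a list, 'k) hopf_data"
    and H :: "'h monoid"
    and actH :: "'h \<Rightarrow> ('a list \<Rightarrow>\<^sub>0 'k) \<Rightarrow> ('a list \<Rightarrow>\<^sub>0 'k)"
    and dH :: "('a list \<Rightarrow>\<^sub>0 'k) \<Rightarrow> (('h \<times> 'a list) \<Rightarrow>\<^sub>0 'k)"
    and f :: "'h \<Rightarrow> 'a"
    and F :: "(('a list \<times> 'h) \<Rightarrow>\<^sub>0 'k) \<Rightarrow> (('a list \<times> 'a) \<Rightarrow>\<^sub>0 'k)"
  assumes R_def: "R = nichols (yd_braiding act d) X"
    and X_G: "X \<subseteq> carrier G"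
    and yd: "yd_module G (free X) act d"
    and lines: "\<And>x. x \<in> X \<Longrightarrow> homogeneous (free X) d x = lin.span {bvec x}"
    and covering: "covering_hopf_algebra R H actH dH G (tensor_action act) (tensor_coaction G d) f F"
begin

abbreviation "V \<equiv> hspace R"
abbreviation "actG \<equiv> tensor_action act"
abbreviation "dG \<equiv> tensor_coaction G d"
abbreviation "bosH \<equiv> bosonization H R actH dH"
abbreviation "bosG \<equiv> bosonization G R actG dG"

lemma hopf_cov: "hopf_covering R H actH dH G actG dG f F"
  and link_H: "link_indecomposable bosH"
  using covering by (simp_all add: covering_hopf_algebra_def)

lemma group_H: "group H" and group_G: "group G"
  and braided_H: "braided_graded_hopf H R actH dH"
  and braided_G: "braided_graded_hopf G R actG dG"
  and hopf_H: "hopf_algebra bosH" and pointed_H: "pointed bosH"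
  and graded_H: "coradically_graded bosH"
  and hopf_G: "hopf_algebra bosG" and pointed_G: "pointed bosG"
  and graded_G: "coradically_graded bosG"
  and F_map: "hopf_map bosH bosG F" and f_hom: "f \<in> hom H G"
  and f_surj: "f ` carrier H = carrier G"
  and F_tens: "\<And>r h. r \<in> V \<Longrightarrow> h \<in> carrier H \<Longrightarrow> F (tens r (bvec h)) = tens r (bvec (f h))"
  using hopf_cov by (simp_all add: hopf_covering_def Let_def)

interpretation H: group H by (rule group_H)
interpretation G: group G by (rule group_G)
interpretation f: group_hom H G f by unfold_locales (rule f_hom)

lemmas RH = braided_graded_hopfD[OF braided_H]
lemmas RG = braided_graded_hopfD[OF braided_G]

lemma space_bosH: "hspace bosH = tensor V (free (carrier H))"
  by (simp add: bosonization_def)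

lemma d_letter: "x \<in> X \<Longrightarrow> d (bvec x) = bvec (x, x)"
proof -
  assume "x \<in> X"
  then have "bvec x \<in> homogeneous (free X) d x" using lines lin.span_base by auto
  then show ?thesis by (simp add: homogeneous_def)
qed

lemma act_free: "g \<in> carrier G \<Longrightarrow> linear_on (free X) (act g)"
  "g \<in> carrier G \<Longrightarrow> u \<in> free X \<Longrightarrow> act g u \<in> free X"
  using yd by (auto simp: yd_module_def)

text \<open>
  The braiding maps \<open>v\<^sub>x \<otimes> v\<^sub>y\<close> into \<open>V \<otimes> V\<close>, so the quantum symmetrizers preserve the length of paths in \<open>X\<close>.
\<close>

lemma components: "hgrad R n \<subseteq> free (paths X n)"
proof -
  have "linear_on (free X) d" using yd by (simp add: yd_module_def)
  then have "yd_braiding act d (bvec (x, y)) \<in> free (X \<times> X)" if "x \<in> X" "y \<in> X" for x y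
    using that X_G act_free
    by (subst yd_braiding_bvec[of X]) (auto simp: d_letter subset_iff intro!: tens_in_free)
  then show ?thesis using nichols_comp_subset[of X "yd_braiding act d" n]
    by (simp add: R_def nichols_def)
qed

lemma component_1: "hgrad R (Suc 0) = free (paths X (Suc 0))"
  by (simp add: R_def nichols_def nichols_comp_trivial)

lemma hone_R: "hone R = bvec []"
  by (simp add: R_def nichols_def)

lemma V_span: "V = lin.span (\<Union>n. hgrad R n)"
  by (simp add: R_def nichols_def)

lemma V_paths: "V \<subseteq> free (lists X)"
  unfolding V_span
proof (rule lin.span_minimal[OF _ subspace_free])
  have "free (paths X n) \<subseteq> free (lists X)" for n
    by (auto simp: free_def lists_eq_set)
  then show "(\<Union>n. hgrad R n) \<subseteq> free (lists X)" using components by blast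
qed

lemma path_in_X: "r \<in> V \<Longrightarrow> p \<in> supp r \<Longrightarrow> set p \<subseteq> X"
  using V_paths by (auto simp: free_def)

lemma letter_in_V: "x \<in> X \<Longrightarrow> bvec [x] \<in> hgrad R (Suc 0)" "x \<in> X \<Longrightarrow> bvec [x] \<in> V"
  using RH(16)[of "Suc 0"] by (auto simp: component_1)

lemma lookup_comult: "coeff (hcomult R u) (a, b) = coeff u (a @ b)"
  by (simp add: R_def nichols_def lookup_deconcatenation)

lemma rsec_comult_Nil: "rsec (hcomult R u) [] = u"
  by (rule poly_mapping_eqI) (simp add: lookup_comult)

lemma linear_F: "linear_on (hspace bosH) F"
  using F_map by (simp add: hopf_map_def)

text \<open>
  The covering map is given on elements \<open>r # h\<close> only; by linearity it relabels group elements throughout.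
\<close>

lemma F_reindex:
  assumes "z \<in> hspace bosH"
  shows "F z = rtens (\<lambda>p. p) f z"
proof (rule linear_on_tensor_eq[where f = F and U = V and W = "free (carrier H)"])
  show lin: "linear_on (tensor V (free (carrier H))) F" using linear_F by (simp add: space_bosH)
  show "F (tens r w) = rtens (\<lambda>p. p) f (tens r w)" if r: "r \<in> V" and w: "w \<in> free (carrier H)" for r w
  proof (rule linear_on_free_eq[where f = "\<lambda>w. F (tens r w)" and S = "carrier H"])
    show "linear_on (free (carrier H)) (\<lambda>w. F (tens r w))"
      using r by (auto simp: linear_on_def tens_add_right tens_scl_right tens_in_tensor
          linear_on_add[OF lin] linear_on_scl[OF lin])
    show "linear_on (free (carrier H)) (\<lambda>w. rtens (\<lambda>p. p) f (tens r w))"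
      by (auto simp: linear_on_def tens_add_right tens_scl_right reindex_add reindex_scl)
  qed (use r w in \<open>simp_all add: F_tens reindex_tens\<close>)
qed (use assms in \<open>simp_all add: space_bosH linear_on_reindex\<close>)

text \<open>
  In \<open>bosH\<close> one has \<open>(1 # h) (r # 1) = h.r # h\<close>.  Applying the algebra map \<open>F\<close> and computing the same
  product in \<open>bosG\<close> gives \<open>h.r # f h = (f h).r # f h\<close>.
\<close>

lemma actH_eq:
  assumes h: "h \<in> carrier H" and r: "r \<in> V"
  shows "actH h r = actG (f h) r"
proof (cases "r = 0")
  case True
  then show ?thesis
    using linear_on_zero[OF RH(6)[OF h] RH(5)] linear_on_zero[OF RG(6) RH(5), of "f h"] h by simp
next
  case False
  have one: "bvec [] \<in> V" "bvec [] \<noteq> (0 :: 'a list \<Rightarrow>\<^sub>0 'k)" using RH(12) by (auto simp: hone_R)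
  have unit: "hprod R (bvec []) u = u" if "u \<in> V" for u
    using RH(2) that by (simp add: is_algebra_def hone_R)
  have aV: "actH h r \<in> V" "actG (f h) r \<in> V" using RH(7) RG(7) h r by auto
  have H: "hprod bosH (tens (bvec []) (bvec h)) (tens r (bvec \<one>\<^bsub>H\<^esub>)) = tens (actH h r) (bvec h)"
    using bosonization_mult[where act = actH and W = V, OF one(2) False r RH(6)[OF h] RH(5)] h aV by (simp add: unit)
  have G: "hprod bosG (tens (bvec []) (bvec (f h))) (tens r (bvec \<one>\<^bsub>G\<^esub>)) = tens (actG (f h) r) (bvec (f h))"
    using bosonization_mult[where act = actG and W = V and g = "f h", OF one(2) False r RG(6) RH(5)] h aV by (simp add: unit)
  have mem: "tens (bvec []) (bvec h) \<in> hspace bosH" "tens r (bvec \<one>\<^bsub>H\<^esub>) \<in> hspace bosH"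
    using one r h by (simp_all add: space_bosH tens_in_tensor del: tens_bvec)
  have "F (hprod bosH (tens (bvec []) (bvec h)) (tens r (bvec \<one>\<^bsub>H\<^esub>))) =
      hprod bosG (F (tens (bvec []) (bvec h))) (F (tens r (bvec \<one>\<^bsub>H\<^esub>)))"
    using F_map mem by (simp add: hopf_map_def)
  then have "tens (actH h r) (bvec (f h)) = tens (actG (f h) r) (bvec (f h))"
    using one(1) r h aV by (simp only: H G F_tens f.hom_one H.one_closed)
  then have "lsec (tens (actH h r) (bvec (f h))) (f h) = lsec (tens (actG (f h) r) (bvec (f h))) (f h)"
    by simp
  then show ?thesis by simp
qed

text \<open>
  The coproduct of \<open>r # 1\<close> is \<open>r\<^sup>(\<^sup>1\<^sup>) # r\<^sup>(\<^sup>2\<^sup>)\<^sub>(\<^sub>-\<^sub>1\<^sub>) \<otimes> r\<^sup>(\<^sup>2\<^sup>)\<^sub>(\<^sub>0\<^sub>) # 1\<close>, and \<open>F\<close> respects it.  The part whose first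
  factor \<open>r\<^sup>(\<^sup>1\<^sup>)\<close> is the empty path has \<open>r\<^sup>(\<^sup>2\<^sup>) = r\<close>, so there the coactions of \<open>r\<close> are compared.
\<close>

lemma coaction_push:
  assumes r: "r \<in> V"
  shows "rtens f (\<lambda>p. p) (dH r) = dG r"
proof (cases "r = 0")
  case True
  then show ?thesis using linear_on_zero[OF RH(8) RH(5)] linear_on_zero[OF RG(8) RH(5)] by simp
next
  case False
  have mem: "tens r (bvec \<one>\<^bsub>H\<^esub>) \<in> hspace bosH"
    using r by (auto simp: space_bosH intro!: tens_in_tensor)
  have coalg: "hcomult bosH (tens r (bvec \<one>\<^bsub>H\<^esub>)) \<in> tensor (hspace bosH) (hspace bosH)"
    and sub: "lin.subspace (hspace bosH)"
    using hopf_H mem by (auto simp: hopf_algebra_def hopf_axioms_wrt_def is_coalgebra_def)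
  have Fid: "F z = rtens (\<lambda>p. p) f z" if "z \<in> hspace bosH" for z by (rule F_reindex[OF that])
  have "hcomult bosG (F (tens r (bvec \<one>\<^bsub>H\<^esub>))) = tmap F F (hcomult bosH (tens r (bvec \<one>\<^bsub>H\<^esub>)))"
    using F_map mem by (simp add: hopf_map_def)
  also have "\<dots> = tmap (rtens (\<lambda>p. p) f) (rtens (\<lambda>p. p) f) (hcomult bosH (tens r (bvec \<one>\<^bsub>H\<^esub>)))"
    by (rule tmap_cong[OF coalg sub sub linear_F linear_F Fid Fid])
  finally have eq: "hcomult bosG (tens r (bvec \<one>\<^bsub>G\<^esub>)) =
      tmap (rtens (\<lambda>p. p) f) (rtens (\<lambda>p. p) f) (hcomult bosH (tens r (bvec \<one>\<^bsub>H\<^esub>)))"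
    by (simp add: F_tens r)
  \<comment> \<open>Both coproducts have \<open>1\<close> as last group element, so deleting it loses nothing.\<close>
  let ?back = "\<lambda>((b, h), (c, g)). (b, (h, c))"
  let ?yH = "rmap dH (hcomult R r)" and ?yG = "rmap dG (hcomult R r)"
  have keysH: "supp ?yH \<subseteq> UNIV \<times> (carrier H \<times> UNIV)"
    by (rule keys_inner_leg, rule rmap_in[OF RH(8,5) _ RH(14)[OF r]]) (use RH(9) in auto)
  have keysG: "supp ?yG \<subseteq> UNIV \<times> (carrier G \<times> UNIV)"
    by (rule keys_inner_leg, rule rmap_in[OF RG(8,5) _ RH(14)[OF r]]) (use RG(9) in auto)
  have "reindex ?back (hcomult bosG (tens r (bvec \<one>\<^bsub>G\<^esub>))) = ?yG"
    unfolding bosonization_comult[OF False] reindex_reindex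
    using keysG by (intro reindex_ident) auto
  moreover have "reindex ?back (tmap (rtens (\<lambda>p. p) f) (rtens (\<lambda>p. p) f) (hcomult bosH (tens r (bvec \<one>\<^bsub>H\<^esub>)))) =
      reindex (\<lambda>(b, (h, c)). (b, (f h, c))) ?yH"
    unfolding bosonization_comult[OF False] tmap_reindex reindex_reindex
    using keysH by (intro reindex_cong) auto
  ultimately have "?yG = reindex (\<lambda>(b, (h, c)). (b, (f h, c))) ?yH" using eq by simp
  also have "\<dots> = rmap (rtens f (\<lambda>p. p)) ?yH" by (simp add: rmap_reindex case_prod_beta')
  finally have "rsec ?yG [] = rsec (rmap (rtens f (\<lambda>p. p)) ?yH) []" by simp
  then show ?thesis
    by (simp add: rsec_rmap linear_on_zero[OF RH(8) RH(5)] linear_on_zero[OF RG(8) RH(5)] rsec_comult_Nil)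
qed

lemma dG_paths: "r \<in> V \<Longrightarrow> dG r = reindex (\<lambda>p. (path_value G (\<lambda>x. x) p, p)) r"
  by (rule tensor_coaction_paths[of X]) (use V_paths d_letter in auto)

text \<open>
  The component of \<open>v\<^sub>x\<close> of degree \<open>h\<close> over \<open>H\<close> has degree \<open>f h\<close> over \<open>G\<close>, so it is a multiple of the letter
  \<open>f h\<close>.  The components add up to \<open>v\<^sub>x\<close>, hence some component with \<open>f h = x\<close> is nonzero.  It is a multiple
  of \<open>v\<^sub>x\<close>, which makes \<open>v\<^sub>x\<close> homogeneous.
\<close>

lemma degree_exists:
  assumes x: "x \<in> X"
  shows "\<exists>h\<in>carrier H. f h = x \<and> dH (bvec [x]) = tens (bvec h) (bvec [x])"
proof -
  let ?z = "dH (bvec [x])"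
  note dlin = RH(8) and sV = RH(5)
  have d0: "dH 0 = 0" by (rule linear_on_zero[OF dlin sV])
  have z: "?z \<in> tensor (free (carrier H)) (hgrad R (Suc 0))"
    using braided_H letter_in_V(1)[OF x] unfolding braided_graded_hopf_def by blast
  have sec1: "rsec ?z h \<in> hgrad R (Suc 0)" for h by (rule rsec_in[OF z RH(17)])
  then have secV: "rsec ?z h \<in> V" for h using RH(16) by blast
  have coassoc: "rmap dH ?z = reindex (\<lambda>(g, b). (g, g, b)) ?z"
    and counit: "reindex snd ?z = bvec [x]"
    using RH(1) letter_in_V(2)[OF x] by (auto simp: yd_module_def)
  have dsec: "dH (rsec ?z h) = tens (bvec h) (rsec ?z h)" for h
  proof -
    have "rsec (reindex (\<lambda>(g, b). (g, g, b)) z) h = tens (bvec h) (rsec z h)"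
      for z :: "('h \<times> 'a list) \<Rightarrow>\<^sub>0 'k"
    proof (rule linear_on_free_eq[where S = UNIV and x = z
          and f = "\<lambda>z. rsec (reindex (\<lambda>(g, b). (g, g, b)) z) h"])
      show "rsec (reindex (\<lambda>(g, b). (g, g, b)) (bvec c)) h = tens (bvec h) (rsec (bvec c) h)" for c
        by (cases c) (auto intro!: poly_mapping_eq2I simp: lookup_single when_def)
    qed (auto simp: linear_on_def reindex_add reindex_scl rsec_add rsec_scl tens_add_right tens_scl_right)
    then show ?thesis using coassoc rsec_rmap[where g = dH and z = ?z and b = h, OF d0] by simp
  qed
  \<comment> \<open>The row at \<open>h\<close> has degree \<open>f h\<close> over \<open>G\<close>, where the degree of a letter is the letter itself.\<close>
  have keys: "p = [f h]" if p: "p \<in> supp (rsec ?z h)" for p h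
  proof -
    have "tens (bvec (f h)) (rsec ?z h) = reindex (\<lambda>p. (path_value G (\<lambda>x. x) p, p)) (rsec ?z h)"
      using coaction_push[OF secV] dG_paths[OF secV] by (simp add: dsec reindex_tens)
    moreover have "(f h, p) \<in> supp (tens (bvec (f h)) (rsec ?z h))"
      using p by (simp add: keys_tens)
    ultimately have "path_value G (\<lambda>x. x) p = f h"
      using keys_reindex[of "\<lambda>p. (path_value G (\<lambda>x. x) p, p)" "rsec ?z h"] by auto
    moreover obtain y where "p = [y]" "y \<in> X"
      using sec1[of h] p by (auto simp: component_1 free_def length_Suc_conv subset_iff)
    ultimately show ?thesis using X_G by auto
  qed
  have "[x] \<in> supp (reindex snd ?z)" by (simp add: counit)
  then have "[x] \<in> snd ` supp ?z" using keys_reindex[of snd ?z] by blast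
  then obtain h where h: "(h, [x]) \<in> supp ?z" by auto
  then have xk: "[x] \<in> supp (rsec ?z h)" by (simp add: in_keys_iff)
  then have fh: "f h = x" using keys by force
  have hH: "h \<in> carrier H" using z h tensor_free_left_iff[OF RH(17)] by force
  let ?c = "coeff (rsec ?z h) [x]"
  have c: "?c \<noteq> 0" using xk by (simp add: in_keys_iff)
  have "rsec ?z h = scl ?c (bvec [x])"
    by (rule poly_mapping_eqI)
       (use keys[of _ h] fh in \<open>force simp: lookup_scl lookup_single when_def in_keys_iff\<close>)
  then have "scl ?c ?z = scl ?c (tens (bvec h) (bvec [x]))"
    using dsec[of h] linear_on_scl[OF dlin letter_in_V(2)[OF x]] by (metis tens_scl_right)
  then have "?z = tens (bvec h) (bvec [x])" using c by (metis lin.scale_cancel_left)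
  then show ?thesis using hH fh by blast
qed

definition deg :: "'a \<Rightarrow> 'h"
  where "deg x = (SOME h. h \<in> carrier H \<and> f h = x \<and> dH (bvec [x]) = tens (bvec h) (bvec [x]))"

lemma deg: "x \<in> X \<Longrightarrow> deg x \<in> carrier H" "x \<in> X \<Longrightarrow> f (deg x) = x"
  "x \<in> X \<Longrightarrow> dH (bvec [x]) = tens (bvec (deg x)) (bvec [x])"
  using degree_exists[of x] someI_ex[of "\<lambda>h. h \<in> carrier H \<and> f h = x \<and> dH (bvec [x]) = tens (bvec h) (bvec [x])"]
  unfolding deg_def by blast+

abbreviation "path_deg \<equiv> path_value H deg"

text \<open>
  The coaction respects the grading by length, so the coefficient at a one-letter path depends only on the
  part of \<open>u\<close> of length one, which is a combination of letters.
\<close>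

lemma lookup_coaction_letter:
  assumes "u \<in> V" "x \<in> X"
  shows "coeff (dH u) (g, [x]) = (if g = deg x then coeff u [x] else 0)"
proof -
  have lin: "linear_on V (\<lambda>u. lsec (dH u) [x])"
    by (auto simp: linear_on_def linear_on_add[OF RH(8)] linear_on_scl[OF RH(8)] lsec_add lsec_scl)
  have lin': "linear_on W (\<lambda>u. scl (coeff u [x]) (bvec (deg x)))" for W :: "('a list \<Rightarrow>\<^sub>0 'k) set"
    by (auto simp: linear_on_def lookup_add lookup_scl lin.scale_left_distrib)
  have "lsec (dH u) [x] = scl (coeff u [x]) (bvec (deg x))"
  proof (rule linear_on_span_eq[OF lin lin' RH(5), of "\<Union>n. hgrad R n"])
    fix b assume "b \<in> (\<Union>n. hgrad R n)"
    then obtain n where b: "b \<in> hgrad R n" by blast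
    show "lsec (dH b) [x] = scl (coeff b [x]) (bvec (deg x))"
    proof (cases "n = Suc 0")
      case True
      have sub: "free (paths X (Suc 0)) \<subseteq> V" using RH(16)[of "Suc 0"] by (simp add: component_1)
      show ?thesis
      proof (rule linear_on_free_eq[where S = "paths X (Suc 0)" and f = "\<lambda>u. lsec (dH u) [x]" and x = b,
            OF linear_on_subset[OF lin sub] lin'])
        fix p assume "p \<in> paths X (Suc 0)"
        then obtain y where y: "p = [y]" "y \<in> X" by (auto simp: length_Suc_conv)
        then show "lsec (dH (bvec p)) [x] = scl (coeff (bvec p) [x]) (bvec (deg x))"
          by (auto simp: deg(3) lookup_single when_def simp del: tens_bvec)
      qed (use b True component_1 in auto)
    next
      case False
      have "dH b \<in> tensor (free (carrier H)) (hgrad R n)"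
        using braided_H b unfolding braided_graded_hopf_def by blast
      then have "rsec (dH b) h \<in> hgrad R n" for h by (rule rsec_in[OF _ RH(17)])
      then have "rsec (dH b) h \<in> free (paths X n)" for h using components by blast
      then have "coeff (rsec (dH b) h) [x] = 0" for h
        using False by (force simp: free_def in_keys_iff)
      moreover have "coeff b [x] = 0"
        using b components[of n] False by (force simp: free_def in_keys_iff)
      ultimately show ?thesis by (intro poly_mapping_eqI) simp
    qed
  qed (use assms V_span RH(16) in auto)
  then have "coeff (lsec (dH u) [x]) g =
      coeff (scl (coeff u [x]) (bvec (deg x))) g" by simp
  then show ?thesis by (simp add: lookup_scl lookup_single when_def split: if_splits)
qed

text \<open>
  By induction on \<open>p\<close>, for all \<open>u\<close> at once.  For the empty path this is the colinearity of the counit.  For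
  \<open>p = x # q\<close>, deconcatenation turns the coefficient of \<open>u\<close> at \<open>x # q\<close> into the coefficient of \<open>\<Delta> u\<close> at
  \<open>x \<otimes> q\<close>, and colinearity of \<open>\<Delta>\<close> expresses its degree as the product of those of \<open>x\<close> and of \<open>q\<close>.  The
  latter is known from the induction hypothesis for the row of \<open>\<Delta> u\<close> at \<open>x\<close>, which is another element of
  the Nichols algebra.
\<close>

lemma lookup_coaction:
  assumes "u \<in> V" "set p \<subseteq> X"
  shows "coeff (dH u) (h, p) = (if h = path_deg p then coeff u p else 0)"
  using assms
proof (induction p arbitrary: u h)
  case Nil
  have e: "hcounit R = (\<lambda>u. coeff u [])" by (simp add: R_def nichols_def)
  have "rcontract (hcounit R) (dH u) = Poly_Mapping.single \<one>\<^bsub>H\<^esub> (hcounit R u)"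
    using braided_H Nil.prems(1) unfolding braided_graded_hopf_def by blast
  then have "coeff (rcontract (hcounit R) (dH u)) h =
      coeff (Poly_Mapping.single \<one>\<^bsub>H\<^esub> (hcounit R u)) h" by simp
  then show ?case by (simp add: lookup_rcontract e lookup_single when_def)
next
  case (Cons x q)
  note u = Cons.prems(1)
  have x: "x \<in> X" and q: "set q \<subseteq> X" using Cons.prems(2) by auto
  let ?z = "hcomult R u"
  let ?Z = "tmap dH dH ?z"
  let ?m = "\<lambda>((g, b), (h, c)). (g \<otimes>\<^bsub>H\<^esub> h, b, c)"
  have z: "?z \<in> tensor V V" by (rule RH(14)[OF u])
  have d0: "dH 0 = 0" by (rule linear_on_zero[OF RH(8,5)])
  have \<Delta>0: "hcomult R 0 = 0" by (rule linear_on_zero[OF RH(13,5)])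
  have rz: "rmap dH ?z \<in> tensor V UNIV" by (rule rmap_in[OF RH(8,5) subset_UNIV z])
  \<comment> \<open>Applying the coaction to both legs of \<open>\<Delta> u\<close>: the first leg is settled by the case of a letter, the second
    by the induction hypothesis.\<close>
  have Z: "coeff ?Z ((g, [x]), (g', q)) =
      (if g = deg x \<and> g' = path_deg q then coeff u (x # q) else 0)" for g g'
  proof -
    have "coeff ?Z ((g, [x]), (g', q)) =
        coeff (dH (lsec (rmap dH ?z) (g', q))) (g, [x])"
      by (simp add: tmap_def lookup_lmap[where f = dH, OF d0])
    also have "\<dots> = (if g = deg x then coeff (lsec (rmap dH ?z) (g', q)) [x] else 0)"
      by (rule lookup_coaction_letter[OF lsec_in[OF rz RH(5)] x])
    also have "coeff (lsec (rmap dH ?z) (g', q)) [x] =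
        coeff (dH (rsec ?z [x])) (g', q)"
      by (simp add: lookup_rmap[where g = dH, OF d0])
    also have "\<dots> = (if g' = path_deg q then coeff (rsec ?z [x]) q else 0)"
      by (rule Cons.IH[OF rsec_in[OF z RH(5)] q])
    finally show ?thesis by (simp add: lookup_comult)
  qed
  have "coeff (dH u) (h, x # q) = coeff (rmap (hcomult R) (dH u)) (h, ([x], q))"
    by (simp add: lookup_rmap[where g = "hcomult R", OF \<Delta>0] lookup_comult)
  also have "rmap (hcomult R) (dH u) = reindex ?m ?Z"
    using braided_H u unfolding braided_graded_hopf_def codiagonal_def by blast
  also have "coeff (reindex ?m ?Z) (h, ([x], q)) =
      (if h = path_deg (x # q) then coeff u (x # q) else 0)"
  proof -
    \<comment> \<open>At most one pair of degrees contributes to the coefficient, although the product of the group is not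
      injective.\<close>
    let ?S = "{b \<in> supp ?Z. ?m b = (h, ([x], q))}"
    let ?b = "((deg x, [x]), (path_deg q, q))"
    have S: "?S \<subseteq> (if h = path_deg (x # q) then {?b} else {})"
    proof
      fix b assume b: "b \<in> ?S"
      obtain g a g' a' where b': "b = ((g, a), (g', a'))" by (cases b) auto
      then have "a = [x]" "a' = q" "g \<otimes>\<^bsub>H\<^esub> g' = h" using b by auto
      moreover from this have "g = deg x" "g' = path_deg q"
        using b Z[of g g'] by (auto simp: b' in_keys_iff split: if_splits)
      ultimately show "b \<in> (if h = path_deg (x # q) then {?b} else {})" by (simp add: b')
    qed
    show ?thesis
    proof (cases "h = path_deg (x # q)")
      case True
      have "(\<Sum>b\<in>?S. coeff ?Z b) = (\<Sum>b\<in>{?b}. coeff ?Z b)"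
        using S True by (intro sum.mono_neutral_left) (auto simp: in_keys_iff)
      then show ?thesis using True by (simp add: lookup_reindex Z)
    next
      case False
      then have "?S = {}" using S by auto
      then show ?thesis using False by (simp only: lookup_reindex sum.empty if_False)
    qed
  qed
  finally show ?case .
qed

lemma dH_paths:
  assumes r: "r \<in> V"
  shows "dH r = reindex (\<lambda>p. (path_deg p, p)) r"
proof (rule poly_mapping_eq2I)
  fix h p
  have inj: "inj_on (\<lambda>p. (path_deg p, p)) UNIV" by (auto simp: inj_on_def)
  have L: "coeff (reindex (\<lambda>p. (path_deg p, p)) r) (h, p) =
      (if h = path_deg p then coeff r p else 0)"
    using lookup_reindex_inj[OF inj subset_UNIV, of p r] keys_reindex[of "\<lambda>p. (path_deg p, p)" r]
    by (force simp: in_keys_iff)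
  show "coeff (dH r) (h, p) = coeff (reindex (\<lambda>p. (path_deg p, p)) r) (h, p)"
  proof (cases "set p \<subseteq> X")
    case True
    then show ?thesis by (simp add: L lookup_coaction[OF r])
  next
    case False
    have "rsec (dH r) h \<in> V" by (rule rsec_in[OF RH(9)[OF r] RH(5)])
    then have "p \<notin> supp (rsec (dH r) h)" "p \<notin> supp r"
      using path_in_X r False by blast+
    then show ?thesis by (simp add: L in_keys_iff)
  qed
qed

text \<open>
  The component of a minimal element \<open>b\<close> in the degree of \<open>p\<close> is its partial sum over the paths of that
  degree.  It lies in the Nichols algebra, so by minimality it is all of \<open>b\<close>.
\<close>

lemma path_sim_deg:
  assumes "path_sim V p p'"
  shows "path_deg p = path_deg p'"
proof -
  obtain b where b: "minimal_element V b" and p: "p \<in> supp b" "p' \<in> supp b"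
    using assms by (auto simp: path_sim_def)
  have bV: "b \<in> V" using b by (simp add: minimal_element_def)
  let ?I = "{q \<in> supp b. path_deg q = path_deg p}"
  have "(\<Sum>q\<in>?I. Poly_Mapping.single q (coeff b q)) = rsec (dH b) (path_deg p)"
  proof (rule poly_mapping_eqI)
    fix q
    have "coeff (\<Sum>q\<in>?I. Poly_Mapping.single q (coeff b q)) q =
        (if q \<in> ?I then coeff b q else 0)"
      by (simp add: lookup_sum lookup_single when_def sum.delta)
    moreover have "coeff (dH b) (path_deg p, q) =
        (if path_deg p = path_deg q then coeff b q else 0)"
      using lookup_reindex_inj[of "\<lambda>p. (path_deg p, p)" UNIV b q]
        keys_reindex[of "\<lambda>p. (path_deg p, p)" b]
      by (force simp: dH_paths[OF bV] inj_on_def in_keys_iff)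
    ultimately show "coeff (\<Sum>q\<in>?I. Poly_Mapping.single q (coeff b q)) q =
        coeff (rsec (dH b) (path_deg p)) q"
      by (auto simp: in_keys_iff)
  qed
  also have "\<dots> \<in> V" by (rule rsec_in[OF RH(9)[OF bV] RH(5)])
  finally have I: "(\<Sum>q\<in>?I. Poly_Mapping.single q (coeff b q)) \<in> V" .
  have "\<not> (?I \<noteq> {} \<and> ?I \<subset> supp b)"
    using b[unfolded minimal_element_def, THEN conjunct2, THEN conjunct2, rule_format, of ?I] I by blast
  moreover have "p \<in> ?I" using p(1) by simp
  ultimately have "?I = supp b" by blast
  then have "p' \<in> ?I" using p(2) by blast
  then show ?thesis by simp
qed

text \<open>
  The coproduct of \<open>r # g\<close> involves the group elements \<open>g\<close> and \<open>r\<^sup>(\<^sup>2\<^sup>)\<^sub>(\<^sub>-\<^sub>1\<^sub>) g\<close> only, and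
  \<open>r\<^sup>(\<^sup>2\<^sup>)\<^sub>(\<^sub>-\<^sub>1\<^sub>)\<close> is a product of degrees of letters.  So a union of right cosets of \<open>H'\<close> spans a subcoalgebra.
\<close>

lemma subcoalgebra_cosets:
  assumes S: "S \<subseteq> carrier H" and H': "subgroup H' H" "deg ` X \<subseteq> H'"
    and closed: "\<And>h g. h \<in> H' \<Longrightarrow> g \<in> S \<Longrightarrow> h \<otimes>\<^bsub>H\<^esub> g \<in> S"
  shows "subcoalgebra bosH (tensor V (free S))"
proof -
  let ?D = "tensor V (free S)"
  have deg': "path_deg p \<in> H'" if "set p \<subseteq> X" for p
    using that H'(2) by (induction p) (auto simp: subgroup.one_closed[OF H'(1)] subgroup.m_closed[OF H'(1)])
  have d': "fst ` supp (dH w) \<subseteq> H'" if "w \<in> V" for w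
    using keys_reindex[of "\<lambda>p. (path_deg p, p)" w] path_in_X[OF that] deg' by (force simp: dH_paths[OF that])
  have "reindex (\<lambda>(b, (h, c)). ((b, h \<otimes>\<^bsub>H\<^esub> g), (c, g))) (rmap dH y) \<in> tensor ?D ?D"
    (is "reindex ?m _ \<in> _") if y: "y \<in> tensor V V" and g: "g \<in> S" for y g
  proof -
    have "reindex ?m (rmap dH (tens u w)) \<in> tensor ?D ?D" if u: "u \<in> V" and w: "w \<in> V" for u w
    proof -
      have pure: "reindex ?m (tens u (tens (bvec h) v)) = tens (tens u (bvec (h \<otimes>\<^bsub>H\<^esub> g))) (tens v (bvec g))"
        for h and v :: "'a list \<Rightarrow>\<^sub>0 'k"
      proof -
        have "reindex ?m (tens u (tens (bvec h) v)) = reindex (\<lambda>(b, c). ((b, h \<otimes>\<^bsub>H\<^esub> g), (c, g))) (tens u v)"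
          unfolding tens_bvec_left tens_reindex_right reindex_reindex by (simp add: case_prod_beta')
        then show ?thesis unfolding tens_bvec_right tens_reindex .
      qed
      have "reindex ?m (rmap dH (tens u w)) = reindex ?m (tens u (dH w))"
        by (simp add: rmap_tens[OF RH(8,5) w])
      also have "\<dots> = (\<Sum>h\<in>fst ` supp (dH w).
          tens (tens u (bvec (h \<otimes>\<^bsub>H\<^esub> g))) (tens (rsec (dH w) h) (bvec g)))"
        by (subst rsec_expand[of "dH w"]) (simp only: tens_sum_right reindex_sum pure)
      also have "\<dots> \<in> tensor ?D ?D"
        using d'[OF w] closed g u rsec_in[OF RH(9)[OF w] RH(5)]
        by (intro lin.subspace_sum subspace_tensor tens_in_tensor) auto
      finally show ?thesis .
    qed
    then have "(\<lambda>y. reindex ?m (rmap dH y)) ` tensor V V \<subseteq> tensor ?D ?D"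
      by (intro linear_on_tensor_image subspace_tensor
          linear_on_comp[OF linear_on_rmap[OF RH(8,5)] subset_UNIV linear_on_reindex])
    then show ?thesis using y by blast
  qed
  note leg = this
  have "hcomult bosH z \<in> tensor ?D ?D" if z: "z \<in> ?D" for z
  proof -
    have "lsec z g \<in> V" "snd ` supp z \<subseteq> S" for g
      using z by (simp_all add: tensor_free_right_iff[OF RH(5)])
    then show ?thesis
      by (auto simp: bosonization_def intro!: lin.subspace_sum leg RH(14))
  qed
  moreover have "?D \<subseteq> hspace bosH"
    unfolding space_bosH using S by (intro tensor_mono) (auto simp: free_def)
  ultimately show ?thesis unfolding subcoalgebra_def by auto
qed

text \<open>
  Otherwise the subgroup generated by the degrees and its complement, both unions of right cosets, would
  decompose the bosonization into two subcoalgebras.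
\<close>

lemma generate_deg: "generate H (deg ` X) = carrier H"
proof (rule ccontr)
  let ?H' = "generate H (deg ` X)"
  assume ne: "?H' \<noteq> carrier H"
  have incl: "deg ` X \<subseteq> carrier H" using deg by auto
  note sub = H.generate_is_subgroup[OF incl]
  have H'H: "?H' \<subseteq> carrier H" by (rule H.generate_incl[OF incl])
  have gens: "deg ` X \<subseteq> ?H'" by (auto intro: generate.incl)
  let ?S = "carrier H - ?H'"
  let ?D = "tensor V (free ?H')" and ?E = "tensor V (free ?S)"
  have "subcoalgebra bosH ?D"
    by (rule subcoalgebra_cosets[OF H'H sub gens]) (rule subgroup.m_closed[OF sub])
  moreover have "subcoalgebra bosH ?E"
  proof (rule subcoalgebra_cosets[OF _ sub gens])
    fix h g assume h: "h \<in> ?H'" and g: "g \<in> ?S"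
    then have c: "h \<in> carrier H" "g \<in> carrier H" using H'H by auto
    have "h \<otimes>\<^bsub>H\<^esub> g \<notin> ?H'"
    proof
      assume "h \<otimes>\<^bsub>H\<^esub> g \<in> ?H'"
      then have "inv\<^bsub>H\<^esub> h \<otimes>\<^bsub>H\<^esub> (h \<otimes>\<^bsub>H\<^esub> g) \<in> ?H'"
        by (rule subgroup.m_closed[OF sub subgroup.m_inv_closed[OF sub h]])
      then show False using c g by (simp add: H.m_assoc[symmetric])
    qed
    then show "h \<otimes>\<^bsub>H\<^esub> g \<in> ?S" using c by simp
  qed blast
  moreover have pure: "tens (bvec []) (bvec h) \<in> tensor V (free S)" if "h \<in> S" for h :: 'h and S
    using RH(12) that by (intro tens_in_tensor) (simp_all add: hone_R)
  have nz: "tensor V (free S) \<noteq> {0}" if "h \<in> S" for h :: 'h and S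
  proof
    assume "tensor V (free S) = {0}"
    then have "bvec ([], h) = (0 :: ('a list \<times> 'h) \<Rightarrow>\<^sub>0 'k)" using pure[OF that] by simp
    then show False by simp
  qed
  have "?D \<noteq> {0}" by (rule nz[of "\<one>\<^bsub>H\<^esub>"]) (rule generate.one)
  moreover obtain h where "h \<in> ?S" using ne H'H by blast
  then have "?E \<noteq> {0}" by (rule nz)
  moreover have "?D \<inter> ?E = {0}"
  proof -
    have "z = 0" if "z \<in> ?D" "z \<in> ?E" for z
    proof -
      have "snd ` supp z \<subseteq> ?H'" "snd ` supp z \<subseteq> ?S"
        using that by (simp_all only: tensor_free_right_iff[OF RH(5)])
      then have "supp z = {}" by blast
      then show ?thesis by simp
    qed
    moreover have "0 \<in> ?D" "0 \<in> ?E" by (simp_all add: lin.subspace_0)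
    ultimately show ?thesis by blast
  qed
  moreover have "lin.span (?D \<union> ?E) = hspace bosH"
  proof
    have "?D \<subseteq> hspace bosH" "?E \<subseteq> hspace bosH"
      unfolding space_bosH using H'H by (intro tensor_mono; auto simp: free_def)+
    then show "lin.span (?D \<union> ?E) \<subseteq> hspace bosH"
      by (intro lin.span_minimal) (simp_all add: space_bosH)
    show "hspace bosH \<subseteq> lin.span (?D \<union> ?E)"
    proof
      fix z assume "z \<in> hspace bosH"
      then have z: "lsec z c \<in> V" "snd ` supp z \<subseteq> carrier H" for c
        by (simp_all add: space_bosH tensor_free_right_iff[OF RH(5)])
      have "tens (lsec z c) (bvec c) \<in> lin.span (?D \<union> ?E)" if "c \<in> snd ` supp z" for c
      proof -
        have "c \<in> ?H' \<or> c \<in> ?S" using that z(2) by blast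
        then have "tens (lsec z c) (bvec c) \<in> ?D \<union> ?E"
          using tens_in_tensor[OF z(1)[of c], of "bvec c" "free ?H'"]
            tens_in_tensor[OF z(1)[of c], of "bvec c" "free ?S"] by auto
        then show ?thesis by (rule lin.span_base)
      qed
      then have "(\<Sum>c\<in>snd ` supp z. tens (lsec z c) (bvec c)) \<in> lin.span (?D \<union> ?E)"
        by (rule lin.span_sum)
      then show "z \<in> lin.span (?D \<union> ?E)" by (simp only: lsec_expand[symmetric])
    qed
  qed
  ultimately show False using link_H unfolding link_indecomposable_def by blast
qed

text \<open>
  This is the Yetter-Drinfeld condition over \<open>H\<close> at \<open>v\<^sub>x\<close>, read through the action of \<open>H\<close> by way of \<open>G\<close>.
\<close>

lemma deg_conjugate:
  assumes h: "h \<in> carrier H" and x: "x \<in> X" and y: "y \<in> supp (act (f h) (bvec x))"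
  shows "deg y = h \<otimes>\<^bsub>H\<^esub> deg x \<otimes>\<^bsub>H\<^esub> inv\<^bsub>H\<^esub> h"
proof -
  let ?w = "actH h (bvec [x])"
  let ?k = "h \<otimes>\<^bsub>H\<^esub> deg x \<otimes>\<^bsub>H\<^esub> inv\<^bsub>H\<^esub> h"
  have wV: "?w \<in> V" by (rule RH(7)[OF h letter_in_V(2)[OF x]])
  have w: "?w = reindex (\<lambda>y. [y]) (act (f h) (bvec x))"
    by (simp add: actH_eq[OF h letter_in_V(2)[OF x]] tensor_action_letter)
  have "dH ?w = tmap (reindex (\<lambda>h'. h \<otimes>\<^bsub>H\<^esub> h' \<otimes>\<^bsub>H\<^esub> inv\<^bsub>H\<^esub> h)) (actH h) (dH (bvec [x]))"
    using RH(1) h letter_in_V(2)[OF x] unfolding yd_module_def by blast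
  also have "\<dots> = tens (bvec ?k) ?w"
    unfolding deg(3)[OF x]
    using tmap_tens[OF linear_on_reindex subspace_free[of UNIV] RH(6)[OF h] RH(5) _ letter_in_V(2)[OF x],
        of "bvec (deg x)" "\<lambda>h'. h \<otimes>\<^bsub>H\<^esub> h' \<otimes>\<^bsub>H\<^esub> inv\<^bsub>H\<^esub> h"]
    by simp
  finally have eq: "reindex (\<lambda>p. (path_deg p, p)) ?w = tens (bvec ?k) ?w" by (simp add: dH_paths[OF wV])
  have "[y] \<in> supp ?w"
    using y keys_reindex_inj[of "\<lambda>y. [y]" "act (f h) (bvec x)"] by (simp add: w inj_on_def)
  then have "(?k, [y]) \<in> supp (reindex (\<lambda>p. (path_deg p, p)) ?w)"
    by (simp add: eq keys_tens)
  then have "?k = path_deg [y]" using keys_reindex[of "\<lambda>p. (path_deg p, p)" ?w] by auto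
  moreover have "y \<in> X" using act_free(2)[of "f h" "bvec x"] x y h by (auto simp: free_def)
  ultimately show ?thesis using deg(1) by simp
qed

text \<open>
  An element of the kernel of \<open>f\<close> fixes all letters, so by \<open>deg_conjugate\<close> it commutes with their degrees,
  and these generate \<open>H\<close>.
\<close>

lemma kernel_f_central:
  assumes k: "k \<in> carrier H" "f k = \<one>\<^bsub>G\<^esub>" and h: "h \<in> carrier H"
  shows "k \<otimes>\<^bsub>H\<^esub> h = h \<otimes>\<^bsub>H\<^esub> k"
proof -
  let ?C = "{h \<in> carrier H. k \<otimes>\<^bsub>H\<^esub> h = h \<otimes>\<^bsub>H\<^esub> k}"
  have "subgroup ?C H"
  proof (rule H.subgroupI)
    fix a assume a: "a \<in> ?C"
    have "inv\<^bsub>H\<^esub> a \<otimes>\<^bsub>H\<^esub> k = inv\<^bsub>H\<^esub> a \<otimes>\<^bsub>H\<^esub> (k \<otimes>\<^bsub>H\<^esub> a) \<otimes>\<^bsub>H\<^esub> inv\<^bsub>H\<^esub> a"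
    proof -
      have "a \<in> carrier H" using a by simp
      then show ?thesis using k(1) by (simp add: H.m_assoc)
    qed
    also have "\<dots> = inv\<^bsub>H\<^esub> a \<otimes>\<^bsub>H\<^esub> (a \<otimes>\<^bsub>H\<^esub> k) \<otimes>\<^bsub>H\<^esub> inv\<^bsub>H\<^esub> a" using a by simp
    also have "\<dots> = k \<otimes>\<^bsub>H\<^esub> inv\<^bsub>H\<^esub> a"
    proof -
      have "a \<in> carrier H" using a by simp
      then show ?thesis using k(1) by (simp add: H.m_assoc[symmetric])
    qed
    finally show "inv\<^bsub>H\<^esub> a \<in> ?C" using a by simp
    fix b assume b: "b \<in> ?C"
    have "k \<otimes>\<^bsub>H\<^esub> (a \<otimes>\<^bsub>H\<^esub> b) = a \<otimes>\<^bsub>H\<^esub> k \<otimes>\<^bsub>H\<^esub> b" using a b k by (simp add: H.m_assoc[symmetric])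
    also have "\<dots> = a \<otimes>\<^bsub>H\<^esub> b \<otimes>\<^bsub>H\<^esub> k" using a b k by (simp add: H.m_assoc)
    finally show "a \<otimes>\<^bsub>H\<^esub> b \<in> ?C" using a b by simp
  qed (use k in auto)
  moreover have "deg ` X \<subseteq> ?C"
  proof clarify
    fix x assume x: "x \<in> X"
    have "act (f k) (bvec x) = bvec x" using yd x by (simp add: k(2) yd_module_def)
    then have "deg x = k \<otimes>\<^bsub>H\<^esub> deg x \<otimes>\<^bsub>H\<^esub> inv\<^bsub>H\<^esub> k" using deg_conjugate[OF k(1) x, of x] by simp
    then have "deg x \<otimes>\<^bsub>H\<^esub> k = k \<otimes>\<^bsub>H\<^esub> deg x \<otimes>\<^bsub>H\<^esub> inv\<^bsub>H\<^esub> k \<otimes>\<^bsub>H\<^esub> k" by simp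
    then show "deg x \<in> carrier H \<and> k \<otimes>\<^bsub>H\<^esub> deg x = deg x \<otimes>\<^bsub>H\<^esub> k"
      using deg(1)[OF x] k(1) by (simp add: H.m_assoc)
  qed
  ultimately have "generate H (deg ` X) \<subseteq> ?C" by (intro H.generate_subgroup_incl)
  then show ?thesis using h by (auto simp: generate_deg)
qed

end

section \<open>The covering group as a quotient of the universal one\<close>

context nichols_covering
begin

interpretation H: group H by (rule group_H)
interpretation G: group G by (rule group_G)
interpretation f: group_hom H G f by unfold_locales (rule f_hom)

abbreviation "Gt \<equiv> covering_grp X V"
abbreviation "gen \<equiv> covering_gen X V"

definition deg_hom :: "('a \<times> bool) list set set \<Rightarrow> 'h"
  where "deg_hom = covering_value H deg"

lemma group_Gt: "group Gt"
  by (rule group_covering_grp[OF V_paths])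

lemma deg_hom: "group_hom Gt H deg_hom"
  unfolding deg_hom_def
  by (intro group_hom.intro group_hom_axioms.intro group_Gt group_H
      covering_value_hom[OF group_H deg(1) V_paths path_sim_deg])

interpretation deg_hom: group_hom Gt H deg_hom by (rule deg_hom)

lemma deg_hom_gen: "x \<in> X \<Longrightarrow> deg_hom (gen x) = deg x"
  unfolding deg_hom_def by (rule covering_value_gen[OF group_H deg(1) V_paths path_sim_deg])

lemma deg_hom_surj: "deg_hom ` carrier Gt = carrier H"
proof
  have "deg ` X \<subseteq> deg_hom ` carrier Gt"
    using covering_gen_carrier by (force simp: deg_hom_gen[symmetric])
  then show "carrier H \<subseteq> deg_hom ` carrier Gt"
    using H.generate_subgroup_incl[OF _ deg_hom.img_is_subgroup, of "deg ` X"]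
    by (simp add: generate_deg)
qed auto

lemma path_value_f_deg:
  assumes "set p \<subseteq> X"
  shows "f (path_deg p) = path_value G (\<lambda>x. x) p"
proof -
  have "f (path_deg p) = path_value G (\<lambda>x. f (deg x)) p"
    by (rule path_value_hom[OF f.group_hom_axioms deg(1) assms])
  also have "\<dots> = path_value G (\<lambda>x. x) p"
    by (rule path_value_eta_cong[of X]) (simp_all add: deg(2) assms)
  finally show ?thesis .
qed

text \<open>
  Similar paths have the same degree in \<open>H\<close>, hence also in \<open>G\<close>.  So the relations of the covering group hold
  in \<open>G\<close>, and \<open>covering_proj\<close> is a well-defined homomorphism.
\<close>

lemma path_sim_value: "path_sim V p p' \<Longrightarrow> path_value G (\<lambda>x. x) p = path_value G (\<lambda>x. x) p'"
  using path_sim_deg[of p p'] path_sim_in_lists[OF _ V_paths, of p p']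
  by (simp flip: path_value_f_deg)

lemma covering_proj_hom: "group_hom Gt G (covering_proj G)"
  unfolding covering_proj_value
  by (intro group_hom.intro group_hom_axioms.intro group_Gt group_G
      covering_value_hom[OF group_G _ V_paths path_sim_value]) (use X_G in auto)

lemma covering_proj_factor:
  assumes "C \<in> carrier Gt"
  shows "covering_proj G C = f (deg_hom C)"
proof -
  obtain w where w: "w \<in> words X"
    and C: "C = normal_closure (free_grp X) (sim_relators X V) #>\<^bsub>free_grp X\<^esub> word_class X w"
    using assms unfolding carrier_covering_grp by blast
  have "deg_hom C = word_value H deg w"
    unfolding C deg_hom_def by (rule covering_value_coset[OF group_H deg(1) V_paths path_sim_deg w])
  moreover have "covering_proj G C = word_value G (\<lambda>x. x) w"
    unfolding C covering_proj_value
    by (rule covering_value_coset[OF group_G _ V_paths path_sim_value w]) (use X_G in auto)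
  moreover have "f (word_value H deg w) = word_value G (\<lambda>x. f (deg x)) w"
    by (rule word_value_hom[OF f.group_hom_axioms deg(1) w])
  moreover have "word_value G (\<lambda>x. f (deg x)) w = word_value G (\<lambda>x. x) w"
    by (rule word_value_eta_cong[of X]) (simp_all add: deg(2) w)
  ultimately show ?thesis by simp
qed

definition M :: "('a \<times> bool) list set set set"
  where "M = kernel Gt H deg_hom"

lemma normal_M: "M \<lhd> Gt"
  unfolding M_def by (rule deg_hom.normal_kernel)

lemma M_subset_kernel: "M \<subseteq> kernel Gt G (covering_proj G)"
  by (auto simp: M_def kernel_def covering_proj_factor)

text \<open>
  The homomorphism \<open>deg_hom\<close> maps the kernel of the projection to the kernel of \<open>f\<close>, which is central in \<open>H\<close>, so it
  kills the commutators.
\<close>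

lemma commutator_subset_M:
  "commutator_subgroup Gt (kernel Gt G (covering_proj G)) (carrier Gt) \<subseteq> M"
  unfolding commutator_subgroup_def
proof (rule deg_hom.G.generate_subgroup_incl)
  show "subgroup M Gt" by (rule normal_imp_subgroup[OF normal_M])
  have "n \<otimes>\<^bsub>Gt\<^esub> g \<otimes>\<^bsub>Gt\<^esub> inv\<^bsub>Gt\<^esub> n \<otimes>\<^bsub>Gt\<^esub> inv\<^bsub>Gt\<^esub> g \<in> M"
    if n: "n \<in> kernel Gt G (covering_proj G)" and g: "g \<in> carrier Gt" for n g
  proof -
    have nc: "n \<in> carrier Gt" and fn: "f (deg_hom n) = \<one>\<^bsub>G\<^esub>"
      using n by (auto simp: kernel_def covering_proj_factor)
    have "deg_hom n \<otimes>\<^bsub>H\<^esub> deg_hom g = deg_hom g \<otimes>\<^bsub>H\<^esub> deg_hom n"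
      by (rule kernel_f_central[OF _ fn]) (use nc g in auto)
    then have "deg_hom (n \<otimes>\<^bsub>Gt\<^esub> g \<otimes>\<^bsub>Gt\<^esub> inv\<^bsub>Gt\<^esub> n \<otimes>\<^bsub>Gt\<^esub> inv\<^bsub>Gt\<^esub> g) =
        deg_hom g \<otimes>\<^bsub>H\<^esub> deg_hom n \<otimes>\<^bsub>H\<^esub> inv\<^bsub>H\<^esub> deg_hom n \<otimes>\<^bsub>H\<^esub> inv\<^bsub>H\<^esub> deg_hom g"
      using nc g by simp
    also have "\<dots> = \<one>\<^bsub>H\<^esub>" using nc g by (simp add: H.m_assoc)
    finally show ?thesis using nc g by (simp add: M_def kernel_def)
  qed
  then show "{n \<otimes>\<^bsub>Gt\<^esub> g \<otimes>\<^bsub>Gt\<^esub> inv\<^bsub>Gt\<^esub> n \<otimes>\<^bsub>Gt\<^esub> inv\<^bsub>Gt\<^esub> g |n g.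
      n \<in> kernel Gt G (covering_proj G) \<and> g \<in> carrier Gt} \<subseteq> M" by blast
qed

abbreviation "K \<equiv> Gt Mod M"

text \<open>
  The isomorphism with \<open>H\<close> induced by \<open>deg_hom\<close> and, below, its inverse \<open>\<phi>\<close>.  The latter maps \<open>deg x\<close> to
  the coset of \<open>[v\<^sub>x]\<close>.
\<close>

definition \<theta> :: "('a \<times> bool) list set set set \<Rightarrow> 'h"
  where "\<theta> = (\<lambda>C. the_elem (deg_hom ` C))"

definition \<phi> :: "'h \<Rightarrow> ('a \<times> bool) list set set set"
  where "\<phi> = inv_into (carrier K) \<theta>"

abbreviation "can \<equiv> \<lambda>C. the_elem (covering_proj G ` C)"
abbreviation "coset_gen \<equiv> \<lambda>x. M #>\<^bsub>Gt\<^esub> gen x"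
abbreviation "actM \<equiv> \<lambda>C. act (can C)"
abbreviation "dM \<equiv> linext (\<lambda>x. bvec (coset_gen x, x)) :: ('a \<Rightarrow>\<^sub>0 'k) \<Rightarrow> _"
abbreviation "FM \<equiv> reindex (\<lambda>(p, C). (p, can C)) :: (('a list \<times> _) \<Rightarrow>\<^sub>0 'k) \<Rightarrow> _"

lemma group_K: "group K"
  by (rule normal.factorgroup_is_group[OF normal_M])

lemma \<theta>_iso: "\<theta> \<in> iso K H"
  unfolding \<theta>_def M_def by (rule deg_hom.FactGroup_iso_set[OF deg_hom_surj])

lemma \<theta>_bij: "bij_betw \<theta> (carrier K) (carrier H)"
  using \<theta>_iso by (simp add: iso_def)

lemma \<phi>_iso: "\<phi> \<in> iso H K"
  unfolding \<phi>_def by (rule group.iso_set_sym[OF group_K \<theta>_iso])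

lemma \<theta>_\<phi>: "h \<in> carrier H \<Longrightarrow> \<theta> (\<phi> h) = h"
  unfolding \<phi>_def by (rule bij_betw_inv_into_right[OF \<theta>_bij])

lemma \<phi>_\<theta>: "C \<in> carrier K \<Longrightarrow> \<phi> (\<theta> C) = C"
  unfolding \<phi>_def by (rule bij_betw_inv_into_left[OF \<theta>_bij])

lemma \<theta>_carrier: "C \<in> carrier K \<Longrightarrow> \<theta> C \<in> carrier H"
  using \<theta>_bij by (auto simp: bij_betw_def)

lemma \<phi>_carrier: "h \<in> carrier H \<Longrightarrow> \<phi> h \<in> carrier K"
  using \<phi>_iso by (auto simp: iso_def bij_betw_def)

lemma can_\<theta>:
  assumes "C \<in> carrier K"
  shows "can C = f (\<theta> C)"
proof -
  obtain a where a: "a \<in> carrier Gt" "C = M #>\<^bsub>Gt\<^esub> a"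
    using assms by (auto simp: FactGroup_def RCOSETS_def)
  have "can C = covering_proj G a"
    unfolding a(2) by (rule factor_value(1)[OF covering_proj_hom normal_M M_subset_kernel a(1)])
  moreover have "\<theta> C = deg_hom a"
    unfolding a(2) \<theta>_def by (rule factor_value(1)[OF deg_hom normal_M _ a(1)]) (simp add: M_def)
  ultimately show ?thesis by (simp add: covering_proj_factor a(1))
qed

lemma coset_gen_deg:
  assumes "x \<in> X"
  shows "coset_gen x = \<phi> (deg x)" "coset_gen x \<in> carrier K"
proof -
  have g: "gen x \<in> carrier Gt" by (rule covering_gen_carrier[OF assms])
  then show K: "coset_gen x \<in> carrier K" by (auto simp: FactGroup_def RCOSETS_def)
  have "\<theta> (coset_gen x) = deg x"
    unfolding \<theta>_def deg_hom_gen[OF assms, symmetric]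
    by (rule factor_value(1)[OF deg_hom normal_M _ g]) (simp add: M_def)
  then show "coset_gen x = \<phi> (deg x)" using \<phi>_\<theta>[OF K] by simp
qed

lemma hom_can: "can \<in> hom K G"
  by (rule factor_value(2)[OF covering_proj_hom normal_M M_subset_kernel])

lemma can_\<phi>: "h \<in> carrier H \<Longrightarrow> can (\<phi> h) = f h"
  by (simp add: can_\<theta> \<phi>_carrier \<theta>_\<phi>)

lemma can_surj: "can ` carrier K = carrier G"
proof -
  have "can ` carrier K = f ` \<theta> ` carrier K"
    unfolding image_image by (rule image_cong) (simp_all add: can_\<theta>)
  then show ?thesis using \<theta>_bij f_surj by (simp add: bij_betw_def)
qed

interpretation change: group_change H K \<phi> \<theta> R actH dH "tensor_action actM" "tensor_coaction K dM"
proof (rule group_change.intro)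
  show "group H" "group K" "\<phi> \<in> iso H K" by (rule group_H group_K \<phi>_iso)+
  show "braided_graded_hopf H R actH dH" by (rule braided_H)
  show "\<theta> (\<phi> h) = h" if "h \<in> carrier H" for h by (rule \<theta>_\<phi>[OF that])
  show "tensor_action actM (\<phi> h) r = actH h r" if "h \<in> carrier H" "r \<in> V" for h r
    using that by (simp add: actH_eq tensor_action_def can_\<phi>)
  show "tensor_coaction K dM r = rtens \<phi> (\<lambda>b. b) (dH r)" if r: "r \<in> V" for r
  proof -
    interpret \<phi>: group_hom H K \<phi>
      using \<phi>_iso by (intro group_hom.intro group_hom_axioms.intro group_H group_K) (simp add: iso_def)
    have "\<phi> (path_deg p) = path_value K coset_gen p" if p: "set p \<subseteq> X" for p
      using path_value_hom[OF \<phi>.group_hom_axioms deg(1) p]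
        path_value_eta_cong[of X "\<lambda>x. \<phi> (deg x)" coset_gen] p
      by (simp add: coset_gen_deg)
    then have "reindex (\<lambda>p. (path_value K coset_gen p, p)) r = reindex (\<lambda>p. (\<phi> (path_deg p), p)) r"
      using path_in_X[OF r] by (intro reindex_cong) simp
    moreover have "tensor_coaction K dM r = reindex (\<lambda>p. (path_value K coset_gen p, p)) r"
      by (rule tensor_coaction_paths[of X]) (use V_paths r in auto)
    ultimately show ?thesis by (simp add: dH_paths[OF r] reindex_reindex)
  qed
qed

abbreviation "bosM \<equiv> bosonization K R (tensor_action actM) (tensor_coaction K dM)"
abbreviation "\<Psi> \<equiv> reindex (\<lambda>(p, h). (p, \<phi> h)) :: (('a list \<times> 'h) \<Rightarrow>\<^sub>0 'k) \<Rightarrow> _"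

lemma bosonization_iso: "hopf_reindex bosH bosM (\<lambda>(p, h). (p, \<phi> h)) (\<lambda>(p, C). (p, \<theta> C))"
  by (rule change.bosonization_transport)
     (use hopf_H graded_H in \<open>simp_all add: hopf_algebra_def hopf_axioms_wrt_def coradically_graded_def\<close>)

interpretation bos: hopf_reindex bosH bosM "\<lambda>(p, h). (p, \<phi> h)" "\<lambda>(p, C). (p, \<theta> C)"
  by (rule bosonization_iso)

lemma F_factor:
  assumes "z \<in> hspace bosH"
  shows "F z = FM (\<Psi> z)"
  unfolding reindex_reindex F_reindex[OF assms]
  using change.space_bosH_keys[OF assms] by (intro reindex_cong) (auto simp: can_\<phi>)

text \<open>
  The action comes from \<open>G\<close>, and the coaction is given on letters, so only the Yetter-Drinfeld
  condition needs an argument: under \<open>\<phi>\<close> it becomes \<open>deg_conjugate\<close>.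
\<close>

lemma yd_module_M: "yd_module K (free X) actM dM"
proof -
  note Y = yd[unfolded yd_module_def]
  have canG: "can C \<in> carrier G" if "C \<in> carrier K" for C using can_surj that by blast
  have "linear_on (free X) (actM C) \<and> actM C ` free X \<subseteq> free X" if "C \<in> carrier K" for C
    using Y canG[OF that] by blast
  moreover have "actM \<one>\<^bsub>K\<^esub> w = w" if "w \<in> free X" for w
    using Y that hom_one[OF hom_can group_K group_G] by simp
  moreover have "actM (C \<otimes>\<^bsub>K\<^esub> C') w = actM C (actM C' w)"
    if "C \<in> carrier K" "C' \<in> carrier K" "w \<in> free X" for C C' w
    using Y that canG hom_mult[OF hom_can] by simp
  moreover have "dM ` free X \<subseteq> tensor (free (carrier K)) (free X)"
  proof -
    have "dM u \<in> tensor (free (carrier K)) (free X)" if "u \<in> free X" for u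
      by (rule linext_in[OF subspace_tensor _ that])
         (use coset_gen_deg(2) in \<open>simp add: tens_in_tensor flip: tens_bvec\<close>)
    then show ?thesis by blast
  qed
  moreover have "rmap dM (dM w) = reindex (\<lambda>(g, b). (g, g, b)) (dM w)" if w: "w \<in> free X" for w
  proof (rule linear_on_free_eq[where S = X and f = "\<lambda>w. rmap dM (dM w)", OF _ _ _ w])
    have "dM u \<in> tensor (free UNIV) (free X)" if "u \<in> free X" for u
      by (rule linext_in[OF subspace_tensor _ that]) (simp add: tens_in_tensor flip: tens_bvec)
    then show "linear_on (free X) (\<lambda>w. rmap dM (dM w))"
      by (intro linear_on_comp[OF linear_on_linext _ linear_on_rmap[OF linear_on_linext subspace_free]]) auto
    show "linear_on (free X) (\<lambda>w. reindex (\<lambda>(g, b). (g, g, b)) (dM w))"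
      by (rule linear_on_comp[OF linear_on_linext subset_UNIV linear_on_reindex])
    show "rmap dM (dM (bvec x)) = reindex (\<lambda>(g, b). (g, g, b)) (dM (bvec x))" for x
      using rmap_tens[OF linear_on_linext subspace_free[of UNIV], of "bvec x"
          "\<lambda>x. bvec (coset_gen x, x)" "bvec (coset_gen x)"] by simp
  qed
  moreover have "reindex snd (dM w) = w" for w
    by (simp add: reindex_def linext_linext linext_bvec_id)
  moreover have "dM (actM C w) =
      tmap (reindex (\<lambda>h. C \<otimes>\<^bsub>K\<^esub> h \<otimes>\<^bsub>K\<^esub> inv\<^bsub>K\<^esub> C)) (actM C) (dM w)"
    if C: "C \<in> carrier K" and w: "w \<in> free X" for C w
  proof (rule linear_on_free_eq[where S = X and f = "\<lambda>w. dM (actM C w)", OF _ _ _ w])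
    interpret \<phi>: group_hom H K \<phi>
      using \<phi>_iso by (intro group_hom.intro group_hom_axioms.intro group_H group_K) (simp add: iso_def)
    let ?c = "\<lambda>h. C \<otimes>\<^bsub>K\<^esub> h \<otimes>\<^bsub>K\<^esub> inv\<^bsub>K\<^esub> C"
    have lin: "linear_on (free X) (actM C)" using Y canG[OF C] by blast
    show "linear_on (free X) (\<lambda>w. dM (actM C w))"
      by (rule linear_on_comp[OF lin subset_UNIV linear_on_linext])
    have "dM u \<in> tensor UNIV (free X)" if "u \<in> free X" for u
      by (rule linext_in[OF subspace_tensor _ that]) (simp add: tens_in_tensor flip: tens_bvec)
    then show "linear_on (free X) (\<lambda>w. tmap (reindex ?c) (actM C) (dM w))"
      by (intro linear_on_comp[OF linear_on_linext _ linear_on_tmap[OF linear_on_reindex _ lin]])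
         (use subspace_free[of UNIV] in auto)
    fix x assume x: "x \<in> X"
    have "?c (coset_gen x) = coset_gen y" if y: "y \<in> supp (actM C (bvec x))" for y
    proof -
      have "y \<in> X" using act_free(2)[OF canG[OF C], of "bvec x"] x y by (auto simp: free_def)
      moreover have "deg y = \<theta> C \<otimes>\<^bsub>H\<^esub> deg x \<otimes>\<^bsub>H\<^esub> inv\<^bsub>H\<^esub> \<theta> C"
        by (rule deg_conjugate[OF \<theta>_carrier[OF C] x]) (use y C in \<open>simp add: can_\<theta>\<close>)
      ultimately show ?thesis
        using x C \<theta>_carrier[OF C] deg(1)[OF x] by (simp add: coset_gen_deg \<phi>_\<theta>)
    qed
    then have "dM (actM C (bvec x)) = tens (bvec (?c (coset_gen x))) (actM C (bvec x))"
      unfolding tens_bvec_left reindex_def by (intro linext_cong) simp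
    then show "dM (actM C (bvec x)) = tmap (reindex ?c) (actM C) (dM (bvec x))"
      using tmap_tens[OF linear_on_reindex subspace_free[of UNIV] lin subspace_free, of "bvec (coset_gen x)" "bvec x" ?c] x
      by simp
  qed
  ultimately show ?thesis
    unfolding yd_module_def by (intro conjI ballI subspace_free linear_on_linext) auto
qed

lemma covering_M: "covering_hopf_algebra R K (tensor_action actM) (tensor_coaction K dM) G actG dG can FM"
proof -
  have "hopf_map bosM bosG FM"
    by (rule bos.hopf_map_factor[OF F_map]) (rule F_factor[symmetric])
  moreover have "FM (tens r (bvec C)) = tens r (bvec (can C))" for r C
    using reindex_tens[of "\<lambda>p. p" can r "bvec C"] by simp
  ultimately show ?thesis
    unfolding covering_hopf_algebra_def hopf_covering_def Let_def
    using group_K group_G change.braided_K braided_G hopf_G pointed_G graded_G hom_can can_surj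
      bos.hopf_algebra_B[OF hopf_H] bos.pointed_B[OF pointed_H] bos.coradically_graded_B[OF graded_H]
      bos.link_indecomposable_B[OF link_H]
    by simp
qed

lemma hopf_iso_M: "hopf_iso bosH bosM \<Psi>"
  by (rule bos.hopf_iso_\<Phi>)

end

theorem theorem3p5:
  fixes G :: "'a monoid" and X :: "'a set"
    and act :: "'a \<Rightarrow> ('a \<Rightarrow>\<^sub>0 'k::field) \<Rightarrow> ('a \<Rightarrow>\<^sub>0 'k)"
    and d :: "('a \<Rightarrow>\<^sub>0 'k) \<Rightarrow> (('a \<times> 'a) \<Rightarrow>\<^sub>0 'k)"
    and R :: "('a list, 'k) hopf_data"
    and Gt :: "('a \<times> bool) list set set monoid"
    and N :: "('a \<times> bool) list set set set"
    and H :: "'h monoid"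
    and actH :: "'h \<Rightarrow> ('a list \<Rightarrow>\<^sub>0 'k) \<Rightarrow> ('a list \<Rightarrow>\<^sub>0 'k)"
    and dH :: "('a list \<Rightarrow>\<^sub>0 'k) \<Rightarrow> (('h \<times> 'a list) \<Rightarrow>\<^sub>0 'k)"
    and f :: "'h \<Rightarrow> 'a"
    and F :: "(('a list \<times> 'h) \<Rightarrow>\<^sub>0 'k) \<Rightarrow> (('a list \<times> 'a) \<Rightarrow>\<^sub>0 'k)"
  defines "R \<equiv> nichols (yd_braiding act d) X"
    and "Gt \<equiv> covering_grp X (hspace R)"
    and "N \<equiv> kernel Gt G (covering_proj G)"
  assumes "group G" and "finite X" and "X \<subseteq> carrier G"
    and "\<And>g x. g \<in> carrier G \<Longrightarrow> x \<in> X \<Longrightarrow> g \<otimes>\<^bsub>G\<^esub> x \<otimes>\<^bsub>G\<^esub> inv\<^bsub>G\<^esub> g \<in> X"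
    and "generate G X = carrier G"
    and "yd_module G (free X) act d"
    and "yd_support G (free X) d = X"
    and "\<And>x. x \<in> X \<Longrightarrow> homogeneous (free X) d x = lin.span {bvec x}"
    and "covering_hopf_algebra R H actH dH G (tensor_action act) (tensor_coaction G d) f F"
  shows "\<exists>M. M \<lhd> Gt \<and> commutator_subgroup Gt N (carrier Gt) \<subseteq> M \<and> M \<subseteq> N \<and>
    (let K = Gt Mod M;
         can = (\<lambda>C. the_elem (covering_proj G ` C));
         actM = (\<lambda>C. act (can C));
         dM = linext (\<lambda>x. bvec (M #>\<^bsub>Gt\<^esub> covering_gen X (hspace R) x, x));
         FM = reindex (\<lambda>(p, C). (p, can C))
     in yd_module K (free X) actM dM \<and>
        covering_hopf_algebra R K (tensor_action actM) (tensor_coaction K dM)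
          G (tensor_action act) (tensor_coaction G d) can FM \<and>
        (\<exists>\<phi> \<in> iso H K.
          hopf_iso (bosonization H R actH dH)
            (bosonization K R (tensor_action actM) (tensor_coaction K dM))
            (reindex (\<lambda>(p, h). (p, \<phi> h))) \<and>
          (\<forall>z\<in>hspace (bosonization H R actH dH). F z = FM (reindex (\<lambda>(p, h). (p, \<phi> h)) z))))"
proof -
  interpret nichols_covering G X act d R H actH dH f F
    by unfold_locales (use assms in auto)
  show ?thesis unfolding Gt_def N_def Let_def
    by (intro exI[of _ M] conjI bexI[of _ \<phi>] ballI normal_M commutator_subset_M M_subset_kernel
        yd_module_M covering_M \<phi>_iso hopf_iso_M F_factor)
qed

end
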